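(* Let $K$ be a field, let $A=K[a_1,\dots,a_m]$, let $R=P/I$ be a positive $A$-algebra, and let $\Gamma=(\gamma_1,\dots,\gamma_m)\in K^m$. Then the following conditions are equivalent. (a) The local ring $R_{\Gamma_0}$ of the zero point over $\Gamma$ is regular. (b) The local ring $R_{F_\Gamma}$ of the fiber at its origin is regular, and we have the equality $d_{F_\Gamma}=d_{\Gamma_0}-m$. In addition, if the ring $R_{F_\Gamma}$ is a regular local ring, then the fiber $F_\Gamma$ is isomorphic to an affine space.
   Context: $A=K[a_1,\dots,a_m]$ is a trivially graded polynomial ring over the field $K$, and $P=A[x_1,\dots,x_k]$ is graded by $\deg(a_i)=0$ and $\deg(x_j)=w_j$, with positive integers $w_j$; $W=(w_1,\dots,w_k)$, $X=\{x_1,\dots,x_k\}$, $K[X]=K[x_1,\dots,x_k]$. A positive $A$-algebra is a ring $R=P/I$ where $I$ is a $W$-homogeneous ideal of $P$ with $I\cap A=\{0\}$ (hence $I\subseteq\langle x_1,\dots,x_k\rangle$). For $\Gamma=(\gamma_1,\dots,\gamma_m)\in K^m$: $R_{\Gamma_0}$ is the localization of $R$ at the maximal ideal $\langle a_1-\gamma_1,\dots,a_m-\gamma_m,x_1,\dots,x_k\rangle/I$ of the zero point $\Gamma_0=(\gamma_1,\dots,\gamma_m,0,\dots,0)$, and $d_{\Gamma_0}$ is its Krull dimension; $I_\Gamma\subseteq K[X]$ is the image of $I$ under $P\to K[X]$, $a_i\mapsto\gamma_i$, $x_j\mapsto x_j$; $F_\Gamma$, the fiber over $\Gamma$ of the morphism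 $\Theta:\operatorname{Spec}(R)\to\operatorname{Spec}(A)$ induced by $A\to R$, has coordinate ring $K[X]/I_\Gamma$; $R_{F_\Gamma}$ is the localization of $K[X]/I_\Gamma$ at $\langle X\rangle/I_\Gamma$, and $d_{F_\Gamma}$ is its Krull dimension. *)

theory Defs
  imports
    "HOL-Algebra.Ring_Divisibility"
    "HOL-Library.Poly_Mapping"
    "HOL-Library.Extended_Nat"
begin

section \<open>Polynomial rings\<close>

type_synonym ('v, 'a) mpoly = "('v \<Rightarrow>\<^sub>0 nat) \<Rightarrow>\<^sub>0 'a"

definition mconst :: "'a \<Rightarrow> ('v, 'a::field) mpoly" where
  "mconst c = Poly_Mapping.single 0 c"

definition mvar :: "'v \<Rightarrow> ('v, 'a::field) mpoly" where
  "mvar v = Poly_Mapping.single (Poly_Mapping.single v 1) 1"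

definition mpoly_ring :: "'v set \<Rightarrow> ('v, 'a::field) mpoly ring" where
  "mpoly_ring V =
     \<lparr>carrier = {p. \<forall>t \<in> Poly_Mapping.keys p. Poly_Mapping.keys t \<subseteq> V},
      mult = (*), one = 1, zero = 0, add = (+)\<rparr>"

definition msubst :: "('v \<Rightarrow> ('u, 'a) mpoly) \<Rightarrow> ('v, 'a::field) mpoly \<Rightarrow> ('u, 'a) mpoly" where
  "msubst \<sigma> p =
     (\<Sum>t \<in> Poly_Mapping.keys p. mconst (Poly_Mapping.lookup p t) *
        (\<Prod>v \<in> Poly_Mapping.keys t. \<sigma> v ^ Poly_Mapping.lookup t v))"


section \<open>Local rings, Krull dimension, regularity\<close>

text \<open>Pairs \<open>(r, s)\<close> and \<open>(r', s')\<close> denote the same fraction iff \<open>t r s' = t r' s\<close> for some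
  \<open>t \<in> S\<close>; the extra factor \<open>t\<close> matters because \<open>R\<close> need not be a domain.\<close>

definition frac_rel :: "('a, 'b) ring_scheme \<Rightarrow> 'a set \<Rightarrow> (('a \<times> 'a) \<times> ('a \<times> 'a)) set" where
  "frac_rel R S =
     {((r, s), (r', s')). r \<in> carrier R \<and> r' \<in> carrier R \<and> s \<in> S \<and> s' \<in> S \<and>
        (\<exists>t \<in> S. t \<otimes>\<^bsub>R\<^esub> (r \<otimes>\<^bsub>R\<^esub> s') = t \<otimes>\<^bsub>R\<^esub> (r' \<otimes>\<^bsub>R\<^esub> s))}"

definition frac_class :: "('a, 'b) ring_scheme \<Rightarrow> 'a set \<Rightarrow> 'a \<Rightarrow> 'a \<Rightarrow> ('a \<times> 'a) set" where
  "frac_class R S r s = frac_rel R S `` {(r, s)}"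

text \<open>The unions below are unions of equal sets when \<open>S\<close> is multiplicatively closed: they
  define the operations on representatives.\<close>

definition localization :: "('a, 'b) ring_scheme \<Rightarrow> 'a set \<Rightarrow> ('a \<times> 'a) set ring" where
  "localization R S =
     \<lparr>carrier = (carrier R \<times> S) // frac_rel R S,
      mult = (\<lambda>X Y. \<Union>(r, s) \<in> X. \<Union>(r', s') \<in> Y. frac_class R S (r \<otimes>\<^bsub>R\<^esub> r') (s \<otimes>\<^bsub>R\<^esub> s')),
      one = frac_class R S \<one>\<^bsub>R\<^esub> \<one>\<^bsub>R\<^esub>,
      zero = frac_class R S \<zero>\<^bsub>R\<^esub> \<one>\<^bsub>R\<^esub>,
      add = (\<lambda>X Y. \<Union>(r, s) \<in> X. \<Union>(r', s') \<in> Y.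
               frac_class R S (r \<otimes>\<^bsub>R\<^esub> s' \<oplus>\<^bsub>R\<^esub> r' \<otimes>\<^bsub>R\<^esub> s) (s \<otimes>\<^bsub>R\<^esub> s'))\<rparr>"

definition localize_at :: "('a, 'b) ring_scheme \<Rightarrow> 'a set \<Rightarrow> ('a \<times> 'a) set ring" where
  "localize_at R \<pp> = localization R (carrier R - \<pp>)"

text \<open>The supremum of the lengths \<open>n\<close> of the chains \<open>Q 0 \<subset> \<dots> \<subset> Q n\<close> of prime ideals.
  The zero ring gets the value \<open>0\<close>.\<close>

definition krull_dim :: "('a, 'b) ring_scheme \<Rightarrow> enat" where
  "krull_dim R =
     Sup {enat n | n. \<exists>Q. (\<forall>i \<le> n. primeideal (Q i) R) \<and> (\<forall>i < n. Q i \<subset> Q (Suc i))}"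

definition local_ring :: "('a, 'b) ring_scheme \<Rightarrow> bool" where
  "local_ring R \<longleftrightarrow> cring R \<and> (\<exists>!M. maximalideal M R)"

definition max_ideal :: "('a, 'b) ring_scheme \<Rightarrow> 'a set" where
  "max_ideal R = (THE M. maximalideal M R)"

text \<open>The embedding dimension of a Noetherian local ring, as the least number of generators
  of its maximal ideal.\<close>

definition embdim :: "('a, 'b) ring_scheme \<Rightarrow> nat" where
  "embdim R =
     (LEAST n. \<exists>G. G \<subseteq> carrier R \<and> finite G \<and> card G = n \<and> genideal R G = max_ideal R)"

definition regular_local_ring :: "('a, 'b) ring_scheme \<Rightarrow> bool" where
  "regular_local_ring R \<longleftrightarrow>
     noetherian_ring R \<and> local_ring R \<and> krull_dim R = enat (embdim R)"


section \<open>Positive algebras\<close>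

text \<open>\<open>Par i\<close> stands for $a_i$ and \<open>Ind j\<close> for $x_j$; indices start at \<open>1\<close>.  The rings
  $A$ and $K[X]$ are realized as subrings of $P$.\<close>

datatype pvar = Par nat | Ind nat

definition A_ring :: "nat \<Rightarrow> (pvar, 'a::field) mpoly ring" where
  "A_ring m = mpoly_ring (Par ` {1..m})"

definition KX_ring :: "nat \<Rightarrow> (pvar, 'a::field) mpoly ring" where
  "KX_ring k = mpoly_ring (Ind ` {1..k})"

definition P_ring :: "nat \<Rightarrow> nat \<Rightarrow> (pvar, 'a::field) mpoly ring" where
  "P_ring m k = mpoly_ring (Par ` {1..m} \<union> Ind ` {1..k})"

primrec var_weight :: "(nat \<Rightarrow> nat) \<Rightarrow> pvar \<Rightarrow> nat" where
  "var_weight w (Par i) = 0"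
| "var_weight w (Ind j) = w j"

definition wdeg :: "(nat \<Rightarrow> nat) \<Rightarrow> (pvar \<Rightarrow>\<^sub>0 nat) \<Rightarrow> nat" where
  "wdeg w t = (\<Sum>v \<in> Poly_Mapping.keys t. Poly_Mapping.lookup t v * var_weight w v)"

definition hom_component :: "(nat \<Rightarrow> nat) \<Rightarrow> nat \<Rightarrow> (pvar, 'a::field) mpoly \<Rightarrow> (pvar, 'a) mpoly" where
  "hom_component w d p =
     (\<Sum>t \<in> {t \<in> Poly_Mapping.keys p. wdeg w t = d}. Poly_Mapping.single t (Poly_Mapping.lookup p t))"

definition homogeneous_ideal ::
    "nat \<Rightarrow> nat \<Rightarrow> (nat \<Rightarrow> nat) \<Rightarrow> (pvar, 'a::field) mpoly set \<Rightarrow> bool" where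
  "homogeneous_ideal m k w I \<longleftrightarrow>
     ideal I (P_ring m k) \<and> (\<forall>p \<in> I. \<forall>d. hom_component w d p \<in> I)"

text \<open>\<open>P_ring m k Quot I\<close>, with \<open>x\<^sub>j\<close> of weight \<open>w j\<close>, is a positive $A$-algebra.\<close>

definition positive_algebra ::
    "nat \<Rightarrow> nat \<Rightarrow> (nat \<Rightarrow> nat) \<Rightarrow> (pvar, 'a::field) mpoly set \<Rightarrow> bool" where
  "positive_algebra m k w I \<longleftrightarrow>
     (\<forall>j \<in> {1..k}. 0 < w j) \<and> homogeneous_ideal m k w I \<and> I \<inter> carrier (A_ring m) = {0}"

definition zero_point_ideal :: "nat \<Rightarrow> nat \<Rightarrow> (nat \<Rightarrow> 'a) \<Rightarrow> (pvar, 'a::field) mpoly set" where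
  "zero_point_ideal m k \<Gamma> =
     genideal (P_ring m k)
       ((\<lambda>i. mvar (Par i) - mconst (\<Gamma> i)) ` {1..m} \<union> (\<lambda>j. mvar (Ind j)) ` {1..k})"

definition zero_point_local_ring ::
    "nat \<Rightarrow> nat \<Rightarrow> (pvar, 'a::field) mpoly set \<Rightarrow> (nat \<Rightarrow> 'a)
      \<Rightarrow> ((pvar, 'a) mpoly set \<times> (pvar, 'a) mpoly set) set ring" where
  "zero_point_local_ring m k I \<Gamma> =
     localize_at (P_ring m k Quot I)
       ((\<lambda>p. I +>\<^bsub>P_ring m k\<^esub> p) ` zero_point_ideal m k \<Gamma>)"

primrec specialize_var :: "(nat \<Rightarrow> 'a) \<Rightarrow> pvar \<Rightarrow> (pvar, 'a::field) mpoly" where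
  "specialize_var \<Gamma> (Par i) = mconst (\<Gamma> i)"
| "specialize_var \<Gamma> (Ind j) = mvar (Ind j)"

definition fiber_ideal ::
    "(pvar, 'a::field) mpoly set \<Rightarrow> (nat \<Rightarrow> 'a) \<Rightarrow> (pvar, 'a) mpoly set" where
  "fiber_ideal I \<Gamma> = msubst (specialize_var \<Gamma>) ` I"

definition fiber_ring ::
    "nat \<Rightarrow> (pvar, 'a::field) mpoly set \<Rightarrow> (nat \<Rightarrow> 'a) \<Rightarrow> (pvar, 'a) mpoly set ring" where
  "fiber_ring k I \<Gamma> = KX_ring k Quot fiber_ideal I \<Gamma>"

definition fiber_local_ring ::
    "nat \<Rightarrow> (pvar, 'a::field) mpoly set \<Rightarrow> (nat \<Rightarrow> 'a)
      \<Rightarrow> ((pvar, 'a) mpoly set \<times> (pvar, 'a) mpoly set) set ring" where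
  "fiber_local_ring k I \<Gamma> =
     localize_at (fiber_ring k I \<Gamma>)
       ((\<lambda>p. fiber_ideal I \<Gamma> +>\<^bsub>KX_ring k\<^esub> p) `
          genideal (KX_ring k) ((\<lambda>j. mvar (Ind j)) ` {1..k}))"

text \<open>The fiber is an affine $K$-scheme, so it is isomorphic to $\mathbb{A}^n_K$ iff its
  coordinate ring is isomorphic to a polynomial ring over $K$ as a $K$-algebra, that is, by a
  ring isomorphism that respects the constants.\<close>

definition fiber_iso_affine_space ::
    "nat \<Rightarrow> (pvar, 'a::field) mpoly set \<Rightarrow> (nat \<Rightarrow> 'a) \<Rightarrow> bool" where
  "fiber_iso_affine_space k I \<Gamma> \<longleftrightarrow>
     (\<exists>n::nat. \<exists>\<phi> \<in> ring_iso (fiber_ring k I \<Gamma>) (mpoly_ring {1..n} :: (nat, 'a) mpoly ring).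
        \<forall>c. \<phi> (fiber_ideal I \<Gamma> +>\<^bsub>KX_ring k\<^esub> mconst c) = mconst c)"

end

theory Submission
  imports Defs
begin

text \<open>Write \<open>M\<close> for the maximal ideal of the zero point in \<open>P\<close>, write \<open>O\<close> for the local ring \<open>R\<^bsub>\<Gamma>0\<^esub>\<close>, and let \<open>r\<close> be
the rank over \<open>K\<close> of the linear parts at \<open>\<Gamma>\<^sub>0\<close> of the elements of \<open>I\<close>.  As \<open>I\<close> lies in \<open>\<langle>X\<rangle>\<close>, these
linear parts involve the \<open>x\<^sub>j\<close> only.

Gaussian elimination among the homogeneous elements of \<open>I\<close> (\<open>elimination_exists\<close>) gives \<open>h \<in> A\<close> with
\<open>h(\<Gamma>) \<noteq> 0\<close>, a set \<open>J\<close> of \<open>r\<close> indices and, for \<open>j \<in> J\<close>, an element \<open>F\<^sub>j \<in> I\<close> of weight \<open>w\<^sub>j\<close> whose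
linear part is \<open>h x\<^sub>j\<close> plus terms in the \<open>x\<^sub>i\<close> with \<open>i \<notin> J\<close>.  The remaining terms of \<open>F\<^sub>j\<close> are
products of at least two indeterminates, and positivity of the weights makes each factor lighter
than \<open>x\<^sub>j\<close>.  So \<open>F\<^sub>j\<close> expresses \<open>h x\<^sub>j\<close> by free variables (the \<open>a\<^sub>i\<close> and the \<open>x\<^sub>i\<close> with \<open>i \<notin> J\<close>) and by
lighter variables, and recursion on the weight eliminates all \<open>x\<^sub>j\<close> with \<open>j \<in> J\<close>: every element of \<open>P\<close>
lies, after multiplication by a power of \<open>h\<close>, in \<open>B\<close> plus the ideal of the \<open>F\<^sub>j\<close>, where \<open>B\<close> is the
polynomial ring in the \<open>m + k - r\<close> free variables (\<open>clear_denominators\<close>).  This is the graded Nakayama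
lemma made explicit.  Specializing \<open>a\<^sub>i\<close> to \<open>\<gamma>\<^sub>i\<close> turns the data into data of the same kind for the
fiber, which is the case of no parameters (\<open>elimination_fiber\<close>); everything below is thus
proved once and used for \<open>R\<close> and for its fiber.

The free variables, shifted to vanish at \<open>\<Gamma>\<^sub>0\<close>, are a minimal generating system of the maximal ideal
of \<open>O\<close>, so the embedding dimensions of \<open>R\<^bsub>\<Gamma>0\<^esub>\<close> and of the local ring of the fiber are \<open>m + k - r\<close>
and \<open>k - r\<close> (\<open>embdim_eq\<close>).  Both local rings are Noetherian by Hilbert's basis theorem
(\<open>noetherian_mpoly_ring\<close>), so they are regular if and only if their dimension equals their embedding
dimension (\<open>regular_iff\<close>).  As the embedding dimensions always differ by \<open>m\<close>, (b) implies (a).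

A strict chain of primes of \<open>O\<close> contracts to a strict chain of primes of \<open>B\<close>, and a polynomial ring in
\<open>N\<close> variables has no chain of length greater than \<open>N\<close> (\<open>prime_chain_length_le\<close>).  If \<open>O\<close> has the full
dimension \<open>m + k - r\<close>, then \<open>I \<inter> B = 0\<close>, because otherwise the zero ideal of \<open>B\<close> would prolong a
contracted chain of maximal length (\<open>full_dimension_imp_free\<close>).

Applied to the fiber, this gives the last claim: there \<open>h\<close> is a constant, so \<open>K[X]/I\<^sub>\<Gamma>\<close> is the
polynomial ring \<open>B\<close> in \<open>k - r\<close> variables.  Applied to \<open>R\<close>, it gives that (a) implies (b).  Indeed,
solving the specialized equations \<open>F\<^sub>j\<close> recursively yields a retraction \<open>\<rho>\<close> of \<open>K[X]\<close> onto
\<open>K[x\<^sub>i | i \<notin> J]\<close> that kills them.  For \<open>f \<in> I\<close> some \<open>h\<^sup>N f\<close> is the sum of an element of \<open>B\<close> and of an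
element of \<open>I\<close> whose specialization is killed by \<open>\<rho>\<close>; the first summand lies in \<open>I \<inter> B = 0\<close>, so \<open>\<rho>\<close>
kills the specialization of \<open>f\<close>.  Hence \<open>\<rho>\<close> kills \<open>I\<^sub>\<Gamma>\<close>, and the kernels of \<open>\<rho>\<close> followed by setting
more and more variables to \<open>0\<close> form a chain of length \<open>k - r\<close> in the fiber.\<close>


section \<open>Polynomials as linear combinations of monomials\<close>

abbreviation "lookup \<equiv> Poly_Mapping.lookup"
abbreviation "keys \<equiv> Poly_Mapping.keys"
abbreviation "single \<equiv> Poly_Mapping.single"


lemma sum_of_terms: "p = (\<Sum>t\<in>keys p. single t (lookup p t))"
proof (rule poly_mapping_eqI)
  fix s
  have "lookup (\<Sum>t\<in>keys p. single t (lookup p t)) s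
      = (\<Sum>t\<in>keys p. if t = s then lookup p s else 0)"
    by (auto simp: lookup_sum lookup_single when_def intro: sum.cong)
  also have "\<dots> = lookup p s"
    by (simp add: in_keys_iff)
  finally show "lookup p s = lookup (\<Sum>t\<in>keys p. single t (lookup p t)) s" by simp
qed

lemma poly_mapping_additive_induct [case_names single add]:
  assumes s: "\<And>t c. Q (single t c)"
    and a: "\<And>p q. Q p \<Longrightarrow> Q q \<Longrightarrow> Q (p + q)"
  shows "Q (p :: 'm \<Rightarrow>\<^sub>0 'a::comm_monoid_add)"
proof -
  have "Q (\<Sum>t\<in>T. single t (lookup p t))" if "finite T" for T
    using that
  proof (induction T)
    case empty
    show ?case using s[of undefined 0] by simp
  qed (simp add: s a)
  then show ?thesis
    using sum_of_terms[of p] by (metis finite_keys)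
qed

text \<open>The scalars \<open>K\<close> act on polynomial rings through \<open>mconst\<close> and on values through the identity.  One
linear extension operator for both serves evaluations, substitutions and derivations.\<close>

locale scalars =
  fixes \<iota> :: "'a::field \<Rightarrow> 'r::comm_ring_1"
  assumes scal_add: "\<iota> (a + b) = \<iota> a + \<iota> b"
    and scal_mult: "\<iota> (a * b) = \<iota> a * \<iota> b"
    and scal_one: "\<iota> 1 = 1"
begin

lemma scal_zero: "\<iota> 0 = 0"
  using scal_add[of 0 0] by simp

definition lin_ext :: "('m \<Rightarrow> 'r) \<Rightarrow> ('m \<Rightarrow>\<^sub>0 'a) \<Rightarrow> 'r" where
  "lin_ext \<phi> p = (\<Sum>t\<in>keys p. \<iota> (lookup p t) * \<phi> t)"

lemma lin_ext_superset:
  assumes "finite T" "keys p \<subseteq> T"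
  shows "lin_ext \<phi> p = (\<Sum>t\<in>T. \<iota> (lookup p t) * \<phi> t)"
  unfolding lin_ext_def using assms by (intro sum.mono_neutral_left) (auto simp: in_keys_iff scal_zero)

lemma lin_ext_zero [simp]: "lin_ext \<phi> 0 = 0"
  by (simp add: lin_ext_def)

lemma lin_ext_add: "lin_ext \<phi> (p + q) = lin_ext \<phi> p + lin_ext \<phi> q"
proof -
  let ?T = "keys p \<union> keys q"
  have "lin_ext \<phi> (p + q) = (\<Sum>t\<in>?T. \<iota> (lookup (p + q) t) * \<phi> t)"
    by (rule lin_ext_superset) (use keys_add[of p q] in auto)
  then show ?thesis
    by (simp add: lin_ext_superset[of ?T] lookup_add scal_add ring_distribs sum.distrib)
qed

lemma lin_ext_single [simp]: "lin_ext \<phi> (single t c) = \<iota> c * \<phi> t"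
  by (simp add: lin_ext_superset[of "{t}"] scal_zero)

lemma lin_ext_uminus: "lin_ext \<phi> (- p) = - lin_ext \<phi> p"
  using lin_ext_add[of \<phi> p "- p"] by (simp add: eq_neg_iff_add_eq_0 add.commute)

lemma lin_ext_diff: "lin_ext \<phi> (p - q) = lin_ext \<phi> p - lin_ext \<phi> q"
  using lin_ext_add[of \<phi> p "- q"] by (simp add: lin_ext_uminus)

text \<open>Both sides are additive in each argument, so monomials decide.  One summand suffices
for multiplicative maps; two summands give Leibniz' rule for derivations.\<close>

lemma lin_ext_leibniz:
  assumes "\<And>s t. \<phi> (s + t) = \<alpha> s * \<beta> t + \<gamma> s * \<delta> t"
  shows "lin_ext \<phi> (p * q) = lin_ext \<alpha> p * lin_ext \<beta> q + lin_ext \<gamma> p * lin_ext \<delta> q"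
proof (induction p rule: poly_mapping_additive_induct)
  case (single s a)
  show ?case
  proof (induction q rule: poly_mapping_additive_induct)
    case (single t b)
    show ?case by (simp add: mult_single assms scal_mult algebra_simps)
  qed (simp add: ring_distribs lin_ext_add)
qed (simp add: ring_distribs lin_ext_add)

lemma lin_ext_mult:
  assumes "\<And>s t. \<phi> (s + t) = \<phi> s * \<phi> t"
  shows "lin_ext \<phi> (p * q) = lin_ext \<phi> p * lin_ext \<phi> q"
  using lin_ext_leibniz[of \<phi> \<phi> \<phi> "\<lambda>_. 0" "\<lambda>_. 0"] assms by (simp add: lin_ext_def)

end

lemma mconst_add: "mconst (a + b) = mconst a + mconst b"
  by (simp add: mconst_def single_add)

lemma mconst_mult: "mconst (a * b) = mconst a * mconst b"
  by (simp add: mconst_def mult_single)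

lemma mconst_0 [simp]: "mconst 0 = 0" and mconst_1 [simp]: "mconst 1 = 1"
  by (simp_all add: mconst_def)

lemma mconst_uminus: "mconst (- a) = - mconst a"
  by (simp add: mconst_def single_uminus)

lemma mconst_eq_0_iff [simp]: "mconst a = 0 \<longleftrightarrow> a = 0"
  by (metis mconst_def single_zero lookup_single_eq lookup_zero)

lemma mconst_power: "mconst a ^ n = mconst (a ^ n)"
  by (induction n) (simp_all add: mconst_mult)

interpretation val: scalars "\<lambda>a::'a::field. a"
  by unfold_locales simp_all

interpretation poly: scalars mconst
  by unfold_locales (rule mconst_add mconst_mult mconst_1)+

lemma lookup_mconst_mult [simp]: "lookup (mconst c * p) t = c * lookup p t"
proof (induction p rule: poly_mapping_additive_induct)
  case (single s a)
  show ?case unfolding mconst_def mult_single by (simp add: lookup_single mult_when)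
next
  case (add p q)
  then show ?case unfolding distrib_left lookup_add by simp
qed

lemma lookup_0_eq_lin_ext: "lookup p 0 = val.lin_ext (\<lambda>t. if t = 0 then 1 else 0) p"
  by (induction p rule: poly_mapping_additive_induct)
     (auto simp: lookup_single when_def lookup_add val.lin_ext_add)

lemma lookup_var_eq_lin_ext: "lookup p s = val.lin_ext (\<lambda>t. if t = s then 1 else 0) p"
  by (induction p rule: poly_mapping_additive_induct)
     (auto simp: lookup_single when_def lookup_add val.lin_ext_add)

lemma monomial_add_eq_0_iff: "s + t = 0 \<longleftrightarrow> s = 0 \<and> t = (0 :: 'v \<Rightarrow>\<^sub>0 nat)"
  by (metis add_is_0 lookup_add lookup_zero poly_mapping_eqI)

lemma lookup_mult_0: "lookup (p * q) 0 = lookup p 0 * lookup (q :: ('v, 'a::field) mpoly) 0"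
  unfolding lookup_0_eq_lin_ext by (rule val.lin_ext_mult) (auto simp: monomial_add_eq_0_iff)

lemma monomial_add_eq_var_iff:
  "s + t = single v (1::nat) \<longleftrightarrow>
     s = single v 1 \<and> t = 0 \<or> s = 0 \<and> t = single v 1"
proof
  assume st: "s + t = single v 1"
  have l: "lookup s u + lookup t u = (if u = v then 1 else 0)" for u
    using arg_cong[OF st, of "\<lambda>x. lookup x u"]
    by (auto simp: lookup_add lookup_single when_def)
  show "s = single v 1 \<and> t = 0 \<or> s = 0 \<and> t = single v 1"
  proof (cases "lookup s v = 0")
    case True
    have "s = 0"
    proof (rule poly_mapping_eqI)
      fix u show "lookup s u = lookup 0 u"
        using l[of u] True by (auto split: if_splits)
    qed
    then show ?thesis using st by simp
  next
    case False
    have "t = 0"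
    proof (rule poly_mapping_eqI)
      fix u show "lookup t u = lookup 0 u"
        using l[of u] False by (auto split: if_splits)
    qed
    then show ?thesis using st by simp
  qed
qed auto

text \<open>The coefficient at a variable is a derivation at the origin, since a variable is a sum of two
exponents in two ways only.\<close>

lemma lookup_mult_var:
  "lookup (p * q) (single v 1) =
     lookup p (single v 1) * lookup q 0 +
     lookup p 0 * lookup (q :: ('v, 'a::field) mpoly) (single v 1)"
proof -
  have ne: "single v (Suc 0) \<noteq> 0" by (metis lookup_single_eq lookup_zero nat.simps(3))
  show ?thesis
    unfolding lookup_0_eq_lin_ext lookup_var_eq_lin_ext[of _ "single v 1"]
    by (rule val.lin_ext_leibniz) (use ne in \<open>auto simp: monomial_add_eq_var_iff[unfolded One_nat_def]\<close>)
qed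


section \<open>Substitution\<close>

definition mon :: "('v \<Rightarrow> 'r::comm_ring_1) \<Rightarrow> ('v \<Rightarrow>\<^sub>0 nat) \<Rightarrow> 'r" where
  "mon \<sigma> t = (\<Prod>v\<in>keys t. \<sigma> v ^ lookup t v)"

lemma mon_superset:
  assumes "finite T" "keys t \<subseteq> T"
  shows "mon \<sigma> t = (\<Prod>v\<in>T. \<sigma> v ^ lookup t v)"
  unfolding mon_def using assms by (intro prod.mono_neutral_left) (auto simp: in_keys_iff)

lemma mon_0 [simp]: "mon \<sigma> 0 = 1"
  by (simp add: mon_def)

lemma mon_add: "mon \<sigma> (s + t) = mon \<sigma> s * mon \<sigma> t"
proof -
  let ?T = "keys s \<union> keys t"
  have "mon \<sigma> (s + t) = (\<Prod>v\<in>?T. \<sigma> v ^ lookup (s + t) v)"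
    by (rule mon_superset) (use keys_add[of s t] in auto)
  then show ?thesis
    by (simp add: mon_superset[of ?T] lookup_add power_add prod.distrib)
qed

lemma mon_single [simp]: "mon \<sigma> (single v n) = \<sigma> v ^ n"
  by (simp add: mon_superset[of "{v}"])

lemma msubst_eq_lin_ext: "msubst \<sigma> = poly.lin_ext (mon \<sigma>)"
  by (simp add: fun_eq_iff msubst_def poly.lin_ext_def mon_def)

lemma msubst_0 [simp]: "msubst \<sigma> 0 = 0"
  and msubst_add: "msubst \<sigma> (p + q) = msubst \<sigma> p + msubst \<sigma> q"
  and msubst_uminus: "msubst \<sigma> (- p) = - msubst \<sigma> p"
  and msubst_diff: "msubst \<sigma> (p - q) = msubst \<sigma> p - msubst \<sigma> q"
  and msubst_mult: "msubst \<sigma> (p * q) = msubst \<sigma> p * msubst \<sigma> q"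
  and msubst_mconst [simp]: "msubst \<sigma> (mconst c) = mconst c"
  and msubst_mvar [simp]: "msubst \<sigma> (mvar v) = \<sigma> v"
  by (simp_all add: msubst_eq_lin_ext poly.lin_ext_add poly.lin_ext_uminus poly.lin_ext_diff
      poly.lin_ext_mult mon_add mvar_def) (simp add: mconst_def[of c])

lemma msubst_1 [simp]: "msubst \<sigma> 1 = 1"
  using msubst_mconst[of \<sigma> 1] by simp

lemma msubst_power: "msubst \<sigma> (p ^ n) = msubst \<sigma> p ^ n"
  by (induction n) (simp_all add: msubst_mult)

lemma single_eq_mon: "single t (c::'a::field) = mconst c * mon mvar t"
proof -
  have pow: "single (single v n) (1::'a) = mvar v ^ n" for v :: 'b and n :: nat
  proof (induction n)
    case (Suc n)
    have "single (single v (Suc n)) (1::'a)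
        = mvar v * single (single v n) 1"
      unfolding mvar_def mult_single single_add[symmetric] by simp
    then show ?case by (simp only: Suc power_Suc)
  qed simp
  have "single (\<Sum>v\<in>T. single v (lookup t v)) (1::'a)
      = (\<Prod>v\<in>T. mvar v ^ lookup t v)" if "finite T" for T
    using that
  proof (induction T)
    case (insert v T)
    have "single (a + b) (1::'a) = single a 1 * single b 1"
      for a b :: "'b \<Rightarrow>\<^sub>0 nat"
      by (simp add: mult_single)
    then show ?case using insert by (simp only: sum.insert prod.insert pow simp_thms)
  qed simp
  from this[of "keys t"] have "single t (1::'a) = mon mvar t"
    by (simp add: mon_def flip: sum_of_terms)
  then show ?thesis
    by (metis add.left_neutral mconst_def mult.right_neutral mult_single)
qed

abbreviation polys :: "'v set \<Rightarrow> ('v, 'a::field) mpoly set" where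
  "polys V \<equiv> carrier (mpoly_ring V)"

lemma mpoly_ring_simps [simp]:
  "mult (mpoly_ring V) = (*)" "one (mpoly_ring V) = 1" "zero (mpoly_ring V) = 0"
  "add (mpoly_ring V) = (+)"
  by (simp_all add: mpoly_ring_def)

lemma mpoly_ring_iff: "p \<in> polys V \<longleftrightarrow> (\<forall>t\<in>keys p. keys t \<subseteq> V)"
  by (simp add: mpoly_ring_def)

lemma mpoly_ring_mono: "V \<subseteq> W \<Longrightarrow> polys V \<subseteq> polys W"
  by (auto simp: mpoly_ring_def)

lemma mconst_closed [simp, intro]: "mconst c \<in> polys V"
  by (auto simp: mpoly_ring_iff mconst_def split: if_splits)

lemma mpoly_0_closed [simp, intro]: "0 \<in> polys V"
  by (simp add: mpoly_ring_iff)

lemma mpoly_1_closed [simp, intro]: "1 \<in> polys V"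
  by (simp add: mpoly_ring_iff)

lemma mvar_closed_iff [simp]: "mvar v \<in> polys V \<longleftrightarrow> v \<in> V"
  by (auto simp: mpoly_ring_iff mvar_def)

lemma mpoly_add_closed [intro]:
  "p \<in> polys V \<Longrightarrow> q \<in> polys V \<Longrightarrow> p + q \<in> polys V"
  using keys_add[of p q] by (auto simp: mpoly_ring_iff)

lemma mpoly_uminus_closed [intro]:
  "p \<in> polys V \<Longrightarrow> - p \<in> polys V"
  by (auto simp: mpoly_ring_iff in_keys_iff)

lemma mpoly_diff_closed [intro]:
  "p \<in> polys V \<Longrightarrow> q \<in> polys V \<Longrightarrow> p - q \<in> polys V"
  using mpoly_add_closed[of p V "- q"] by auto

lemma mpoly_mult_closed [intro]:
  assumes "p \<in> polys V" "q \<in> polys V"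
  shows "p * q \<in> polys V"
  unfolding mpoly_ring_iff
proof
  fix t assume "t \<in> keys (p * q)"
  then obtain a b where "t = a + b" "a \<in> keys p" "b \<in> keys q"
    using keys_mult[of p q] by blast
  then show "keys t \<subseteq> V"
    using assms keys_add[of a b] by (fastforce simp: mpoly_ring_iff)
qed

lemma mpoly_power_closed [intro]:
  "p \<in> polys V \<Longrightarrow> p ^ n \<in> polys V"
  by (induction n) auto

lemma mpoly_sum_closed [intro]:
  "(\<And>x. x \<in> X \<Longrightarrow> f x \<in> polys V) \<Longrightarrow> sum f X \<in> polys V"
  by (induction X rule: infinite_finite_induct) auto

lemma mpoly_ring_cring: "cring (mpoly_ring V)"
proof (rule cringI)
  show "abelian_group (mpoly_ring V)"
  proof (rule abelian_groupI)
    fix x assume "x \<in> polys V"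
    then show "\<exists>y\<in>polys V. y \<oplus>\<^bsub>mpoly_ring V\<^esub> x = \<zero>\<^bsub>mpoly_ring V\<^esub>"
      by (intro bexI[of _ "- x"]) auto
  qed (auto simp: add.assoc add.commute)
  show "comm_monoid (mpoly_ring V)"
    by (rule comm_monoidI) (auto simp: mult.assoc mult.commute)
qed (auto simp: ring_distribs)

lemma mpoly_a_inv [simp]:
  assumes "p \<in> polys V" shows "\<ominus>\<^bsub>mpoly_ring V\<^esub> p = - p"
proof -
  interpret cring "mpoly_ring V" by (rule mpoly_ring_cring)
  show ?thesis using assms by (intro minus_equality) auto
qed

lemma mpoly_a_minus [simp]:
  assumes "p \<in> polys V" "q \<in> polys V"
  shows "p \<ominus>\<^bsub>mpoly_ring V\<^esub> q = p - q"
  using assms by (simp add: a_minus_def)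

text \<open>\<open>K[V]\<close> is generated by the constants and the variables.  Equalities of homomorphisms or
of derivations are all checked with this rule.\<close>

lemma mpoly_ring_induct [consumes 1, case_names const var add mult]:
  assumes p: "p \<in> polys V"
    and const: "\<And>c. Q (mconst c)"
    and var: "\<And>v. v \<in> V \<Longrightarrow> Q (mvar v)"
    and add: "\<And>p q. p \<in> polys V \<Longrightarrow> q \<in> polys V \<Longrightarrow> Q p \<Longrightarrow> Q q \<Longrightarrow> Q (p + q)"
    and mult: "\<And>p q. p \<in> polys V \<Longrightarrow> q \<in> polys V \<Longrightarrow> Q p \<Longrightarrow> Q q \<Longrightarrow> Q (p * q)"
  shows "Q p"
proof -
  let ?Q = "\<lambda>p. p \<in> polys V \<and> Q p"
  have one: "?Q 1" using const[of 1] by auto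
  have zero: "?Q 0" using const[of 0] by auto
  have pow: "?Q (mvar v ^ n)" if "v \<in> V" for v n
    using one var[OF that] that by (induction n) (auto simp: mult)
  have "?Q (\<Prod>v\<in>T. mvar v ^ lookup t v)" if "finite T" "T \<subseteq> V" for T t
    using that
  proof (induction T)
    case (insert v T)
    then show ?case using pow[of v] by (auto simp: mult)
  qed (use one in simp)
  then have single: "?Q (single t c)" if "keys t \<subseteq> V" for t c
    using that by (auto simp: single_eq_mon mon_def const intro!: mult)
  have "?Q (\<Sum>t\<in>T. single t (lookup p t))"
    if "finite T" "T \<subseteq> keys p" for T
    using that
  proof (induction T)
    case (insert t T)
    then have "?Q (single t (lookup p t))"
      using p by (intro single) (auto simp: mpoly_ring_iff)
    with insert show ?case by (auto simp: add)
  qed (use zero in simp)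
  from this[of "keys p"] show ?thesis by (simp flip: sum_of_terms)
qed

lemma carrier_mpoly_ring_UNIV: "p \<in> polys UNIV"
  by (simp add: mpoly_ring_iff)

lemma msubst_closed:
  assumes "p \<in> polys V" "\<And>v. v \<in> V \<Longrightarrow> \<sigma> v \<in> polys W"
  shows "msubst \<sigma> p \<in> polys W"
  using assms(1)
  by (induction p rule: mpoly_ring_induct) (auto simp: msubst_add msubst_mult assms(2))

lemma msubst_cong:
  assumes "p \<in> polys V" "\<And>v. v \<in> V \<Longrightarrow> \<sigma> v = \<tau> v"
  shows "msubst \<sigma> p = msubst \<tau> p"
  using assms(1)
  by (induction p rule: mpoly_ring_induct) (auto simp: msubst_add msubst_mult assms(2))

lemma msubst_msubst: "msubst \<tau> (msubst \<sigma> p) = msubst (\<lambda>v. msubst \<tau> (\<sigma> v)) p"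
  using carrier_mpoly_ring_UNIV[of p]
  by (induction p rule: mpoly_ring_induct) (auto simp: msubst_add msubst_mult)

lemma msubst_ident:
  assumes "p \<in> polys V" "\<And>v. v \<in> V \<Longrightarrow> \<sigma> v = mvar v"
  shows "msubst \<sigma> p = p"
  using assms(1)
  by (induction p rule: mpoly_ring_induct) (auto simp: msubst_add msubst_mult assms(2))


section \<open>Polynomial rings in finitely many variables are Noetherian\<close>

lemma mpoly_idealD:
  assumes "ideal \<aa> (mpoly_ring V)"
  shows "\<aa> \<subseteq> polys V" "0 \<in> \<aa>"
    and "p \<in> \<aa> \<Longrightarrow> q \<in> \<aa> \<Longrightarrow> p + q \<in> \<aa>"
    and "p \<in> \<aa> \<Longrightarrow> - p \<in> \<aa>"
    and "p \<in> \<aa> \<Longrightarrow> q \<in> \<aa> \<Longrightarrow> p - q \<in> \<aa>"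
    and "p \<in> \<aa> \<Longrightarrow> r \<in> polys V \<Longrightarrow> r * p \<in> \<aa>"
proof -
  interpret ideal \<aa> "mpoly_ring V" by fact
  show sub: "\<aa> \<subseteq> polys V" and "0 \<in> \<aa>"
    using a_subset additive_subgroup.zero_closed[OF additive_subgroup_axioms] by auto
  show add: "p + q \<in> \<aa>" if "p \<in> \<aa>" "q \<in> \<aa>" for p q
    using additive_subgroup.a_closed[OF additive_subgroup_axioms that] by simp
  show un: "- p \<in> \<aa>" if "p \<in> \<aa>" for p
    using additive_subgroup.a_inv_closed[OF additive_subgroup_axioms that] sub that by auto
  show "p - q \<in> \<aa>" if "p \<in> \<aa>" "q \<in> \<aa>" for p q
    using add[OF that(1) un[OF that(2)]] by simp
  show "r * p \<in> \<aa>" if "p \<in> \<aa>" "r \<in> polys V" for p r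
    using I_l_closed that by auto
qed

lemma mpoly_idealI:
  assumes sub: "\<aa> \<subseteq> polys V" and zero: "0 \<in> \<aa>"
    and add: "\<And>p q. p \<in> \<aa> \<Longrightarrow> q \<in> \<aa> \<Longrightarrow> p + q \<in> \<aa>"
    and mult: "\<And>p r. p \<in> \<aa> \<Longrightarrow> r \<in> polys V \<Longrightarrow> r * p \<in> \<aa>"
  shows "ideal \<aa> (mpoly_ring V)"
proof (rule idealI)
  interpret cring "mpoly_ring V" by (rule mpoly_ring_cring)
  show "ring (mpoly_ring V)" by unfold_locales
  show "subgroup \<aa> (add_monoid (mpoly_ring V))"
  proof (rule add.subgroupI)
    show "\<ominus>\<^bsub>mpoly_ring V\<^esub> p \<in> \<aa>" if "p \<in> \<aa>" for p
    proof -
      have "mconst (- 1) * p \<in> \<aa>" by (rule mult) (use that in auto)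
      moreover have "mconst (- 1) * p = \<ominus>\<^bsub>mpoly_ring V\<^esub> p"
        using that sub by (subst mpoly_a_inv) (auto simp: mconst_uminus)
      ultimately show ?thesis by simp
    qed
  qed (use sub zero add in auto)
qed (use mult in \<open>auto simp: mult.commute\<close>)

lemma nondecreasing_subsequence:
  fixes s :: "nat \<Rightarrow> nat"
  obtains f where "strict_mono (f :: nat \<Rightarrow> nat)" "\<And>i j. i \<le> j \<Longrightarrow> s (f i) \<le> s (f j)"
proof -
  obtain f :: "nat \<Rightarrow> nat" where f: "strict_mono f" "monoseq (\<lambda>n. s (f n))"
    using seq_monosub by blast
  show thesis
  proof (cases "\<forall>m. \<forall>n\<ge>m. s (f m) \<le> s (f n)")
    case True
    then show ?thesis using that f(1) by blast
  next
    case False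
    then have dec: "s (f n) \<le> s (f m)" if "m \<le> n" for m n
      using f(2) that by (auto simp: monoseq_def)
    define n0 where "n0 = (ARG_MIN (\<lambda>n. s (f n)) n. True)"
    have min: "s (f n0) \<le> s (f n)" for n
      unfolding n0_def by (rule arg_min_nat_le) simp
    have "s (f (n0 + i)) \<le> s (f (n0 + j))" for i j
      using dec[of n0 "n0 + i"] min[of "n0 + j"] by simp
    moreover have "strict_mono (\<lambda>i. f (n0 + i))"
      using f(1) by (simp add: strict_mono_def)
    ultimately show ?thesis using that by blast
  qed
qed

text \<open>Dickson's lemma as a well-quasi-order: passing to nondecreasing subsequences, one variable after
the other, makes all exponents nondecreasing.\<close>

lemma dickson:
  assumes "finite V" and sup: "\<And>i::nat. keys (t i) \<subseteq> V"
  obtains i j where "i < j" "\<And>v. lookup (t i) v \<le> (lookup (t j) v :: nat)"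
proof -
  have "\<exists>f::nat \<Rightarrow> nat. strict_mono f \<and>
      (\<forall>v\<in>V. \<forall>i j. i \<le> j \<longrightarrow> lookup (t (f i)) v \<le> lookup (t (f j)) v)"
    using \<open>finite V\<close>
  proof (induction V)
    case empty
    show ?case by (auto intro: exI[of _ id] simp: strict_mono_def)
  next
    case (insert v V)
    then obtain f :: "nat \<Rightarrow> nat" where f: "strict_mono f"
      "\<And>u i j. u \<in> V \<Longrightarrow> i \<le> j \<Longrightarrow> lookup (t (f i)) u \<le> lookup (t (f j)) u"
      by blast
    obtain g :: "nat \<Rightarrow> nat" where g: "strict_mono g"
      "\<And>i j. i \<le> j \<Longrightarrow> lookup (t (f (g i))) v \<le> lookup (t (f (g j))) v"
      using nondecreasing_subsequence[of "\<lambda>i. lookup (t (f i)) v"] by blast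
    have "strict_mono (\<lambda>i. f (g i))"
      using f(1) g(1) by (simp add: strict_mono_def)
    moreover have "g i \<le> g j" if "i \<le> j" for i j
      using g(1) that by (simp add: strict_mono_less_eq)
    ultimately show ?case
      using f(2) g(2) by (intro exI[of _ "\<lambda>i. f (g i)"]) auto
  qed
  then obtain f :: "nat \<Rightarrow> nat" where f: "strict_mono f"
    "\<And>v i j. v \<in> V \<Longrightarrow> i \<le> j \<Longrightarrow> lookup (t (f i)) v \<le> lookup (t (f j)) v"
    by blast
  show thesis
  proof (rule that)
    show "f 0 < f 1" using f(1) by (simp add: strict_mono_def)
    fix v
    show "lookup (t (f 0)) v \<le> lookup (t (f 1)) v"
    proof (cases "v \<in> V")
      case False
      then have "lookup (t (f 0)) v = 0"
        using sup[of "f 0"] by (auto simp: in_keys_iff)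
      then show ?thesis by simp
    qed (use f(2) in auto)
  qed
qed

text \<open>The term order is the lexicographic one that the type of finitely supported functions carries.\<close>

lemma monomial_nonneg: "0 \<le> (u :: 'v::linorder \<Rightarrow>\<^sub>0 nat)"
proof (cases "u = 0")
  case False
  then have ne: "keys u \<noteq> {}" by simp
  let ?k = "Min (keys u)"
  have "lookup u k = 0" if "k < ?k" for k
    using that ne by (metis Min_le finite_keys in_keys_iff linorder_not_less)
  moreover have "0 < lookup u ?k"
    using Min_in[OF finite_keys ne] by (simp add: in_keys_iff)
  ultimately have "0 < u"
    unfolding less_poly_mapping.rep_eq less_fun_def by auto
  then show ?thesis by simp
qed simp

lemma monomial_divides:
  assumes "\<And>v. lookup s v \<le> (lookup t v :: nat)"
  obtains u where "t = s + u"
proof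
  show "t = s + (t - s)"
    using assms by (intro poly_mapping_eqI) (simp add: lookup_add lookup_minus)
qed

text \<open>A descending sequence would contain, by Dickson's lemma, a monomial that divides a later one and
hence is not greater than it.\<close>

lemma wf_monomials:
  fixes V :: "'v::linorder set"
  assumes "finite V"
  shows "wf {(s :: 'v \<Rightarrow>\<^sub>0 nat, t). s < t \<and> keys s \<subseteq> V}"
  unfolding wf_iff_no_infinite_down_chain
proof
  assume "\<exists>t. \<forall>i. (t (Suc i), t i) \<in> {(s :: 'v \<Rightarrow>\<^sub>0 nat, t). s < t \<and> keys s \<subseteq> V}"
  then obtain t :: "nat \<Rightarrow> 'v \<Rightarrow>\<^sub>0 nat" where t: "\<And>i. t (Suc i) < t i" "\<And>i. keys (t (Suc i)) \<subseteq> V"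
    by auto
  obtain i j where ij: "i < j"
    "\<And>v. lookup (t (Suc i)) v \<le> lookup (t (Suc j)) v"
    using dickson[OF assms, of "\<lambda>i. t (Suc i)"] t(2) by blast
  obtain u where "t (Suc j) = t (Suc i) + u"
    using monomial_divides ij(2) by blast
  then have "t (Suc i) \<le> t (Suc j)"
    using add_left_mono[OF monomial_nonneg[of u], of "t (Suc i)"] by simp
  moreover have "t (Suc j) < t (Suc i)"
  proof -
    have "t (Suc (i + d + 1)) < t (Suc i)" for d
      by (induction d) (use t(1) less_trans in \<open>auto\<close>)
    then show ?thesis using ij(1) by (metis less_iff_Suc_add Suc_eq_plus1 add_Suc_right)
  qed
  ultimately show False by simp
qed

lemma lookup_single_mult:
  "lookup (single u c * p) (u + s) = c * lookup (p :: ('v, 'a::field) mpoly) s"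
proof (induction p rule: poly_mapping_additive_induct)
  case (single s' a)
  show ?case by (simp add: mult_single lookup_single mult_when)
next
  case (add p q)
  then show ?case by (simp add: distrib_left lookup_add)
qed

definition lead :: "('v::linorder, 'a::field) mpoly \<Rightarrow> 'v \<Rightarrow>\<^sub>0 nat" where
  "lead p = Max (keys p)"

lemma lead_in_keys: "p \<noteq> 0 \<Longrightarrow> lead p \<in> keys p"
  by (simp add: lead_def)

lemma le_lead: "t \<in> keys p \<Longrightarrow> t \<le> lead p"
  by (simp add: lead_def)

lemma lead_reduce:
  fixes p q :: "('v::linorder, 'a::field) mpoly"
  assumes p: "p \<noteq> 0" and q: "q \<noteq> 0" and u: "lead q = lead p + u"
  defines "r \<equiv> q - single u (lookup q (lead q) / lookup p (lead p)) * p"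
  assumes r: "r \<noteq> 0"
  shows "lead r < lead q"
proof -
  let ?s = "single u (lookup q (lead q) / lookup p (lead p))"
  have "lookup p (lead p) \<noteq> 0"
    using lead_in_keys[OF p] by (simp add: in_keys_iff)
  then have "lookup r (lead q) = 0"
    using lookup_single_mult[of u _ p "lead p"] by (simp add: r_def lookup_minus u add.commute)
  then have "lead r \<noteq> lead q"
    using lead_in_keys[OF r] by (metis in_keys_iff)
  moreover have "t \<le> lead q" if t: "t \<in> keys r" for t
  proof (cases "t \<in> keys q")
    case False
    then have "t \<in> keys (?s * p)"
      using t by (auto simp: r_def in_keys_iff lookup_minus)
    then obtain s where "t = u + s" "s \<in> keys p"
      using keys_mult[of ?s p] by (auto split: if_splits)
    then show ?thesis using add_left_mono[OF le_lead[of s p], of u] u by (simp add: add.commute)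
  qed (simp add: le_lead)
  ultimately show ?thesis using lead_in_keys[OF r] by force
qed

text \<open>Hilbert's basis theorem.  If \<open>\<aa>\<close> is not finitely generated, choose repeatedly an element outside
of the ideal of the previous ones, with minimal leading monomial.  By Dickson's lemma some leading
monomial divides a later one, and one reduction step contradicts minimality.\<close>

theorem noetherian_mpoly_ring:
  fixes V :: "'v::linorder set"
  assumes V: "finite V"
  shows "noetherian_ring (mpoly_ring V :: ('v, 'a::field) mpoly ring)"
proof -
  let ?R = "mpoly_ring V :: ('v, 'a::field) mpoly ring"
  interpret R: cring ?R by (rule mpoly_ring_cring)
  show ?thesis
  proof (rule R.noetherian_ringI, rule ccontr)
    fix \<aa> :: "('v, 'a) mpoly set"
    assume id: "ideal \<aa> ?R" and no: "\<not> (\<exists>A\<subseteq>carrier ?R. finite A \<and> \<aa> = genideal ?R A)"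
    note a = mpoly_idealD[OF id]
    have ex: "\<exists>p. p \<in> \<aa> - genideal ?R A \<and> (\<forall>q\<in>\<aa> - genideal ?R A. \<not> lead q < lead p)"
      if A: "finite A" "A \<subseteq> \<aa>" for A
    proof -
      have "genideal ?R A \<subseteq> \<aa>" using R.genideal_minimal[OF id A(2)] .
      with no A a(1) have ne: "\<aa> - genideal ?R A \<noteq> {}" by blast
      have "0 \<in> genideal ?R A"
        using mpoly_idealD(2)[OF R.genideal_ideal] A(2) a(1) by blast
      then have supp: "keys (lead q) \<subseteq> V" if "q \<in> \<aa> - genideal ?R A" for q
        using lead_in_keys[of q] that a(1) by (metis DiffE mpoly_ring_iff subsetD)
      obtain p where "p \<in> \<aa> - genideal ?R A"
        "\<And>q. (q, p) \<in> inv_image {(s, t). s < t \<and> keys s \<subseteq> V} lead \<Longrightarrow> q \<notin> \<aa> - genideal ?R A"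
        using wfE_min'[OF wf_inv_image[OF wf_monomials[OF V], of lead] ne] by blast
      then show ?thesis using supp by (auto simp: in_inv_image)
    qed
    define pick where "pick A = (SOME p. p \<in> \<aa> - genideal ?R A \<and> (\<forall>q\<in>\<aa> - genideal ?R A. \<not> lead q < lead p))" for A
    have pick: "pick A \<in> \<aa> - genideal ?R A" "\<And>q. q \<in> \<aa> - genideal ?R A \<Longrightarrow> \<not> lead q < lead (pick A)"
      if "finite A" "A \<subseteq> \<aa>" for A
      using someI_ex[OF ex[OF that]] by (auto simp: pick_def)
    define S where "S = rec_nat {} (\<lambda>_ A. insert (pick A) A)"
    have S_simps: "S 0 = {}" "S (Suc n) = insert (pick (S n)) (S n)" for n
      by (simp_all add: S_def)
    have S: "finite (S n) \<and> S n \<subseteq> \<aa>" for n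
      by (induction n) (use pick in \<open>auto simp: S_simps\<close>)
    have p_in_S: "pick (S i) \<in> S j" if "i < j" for i j
      using that by (induction j) (auto simp: S_simps less_Suc_eq)
    have Gid: "ideal (genideal ?R (S n)) ?R" for n
      using R.genideal_ideal[of "S n"] S[of n] a(1) by blast
    have p: "pick (S n) \<in> \<aa>" "pick (S n) \<notin> genideal ?R (S n)" "pick (S n) \<noteq> 0" for n
      using pick(1)[of "S n"] S[of n] mpoly_idealD(2)[OF Gid[of n]] by auto
    have keys: "keys (lead (pick (S n))) \<subseteq> V" for n
      using lead_in_keys[OF p(3)[of n]] p(1)[of n] a(1) unfolding mpoly_ring_iff[abs_def] subset_iff by blast
    obtain i j where ij: "i < j"
      "\<And>v. lookup (lead (pick (S i))) v \<le> lookup (lead (pick (S j))) v"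
      using dickson[of V "\<lambda>n. lead (pick (S n))"] V keys by metis
    obtain u where u: "lead (pick (S j)) = lead (pick (S i)) + u"
      using monomial_divides ij(2) by blast
    define c where "c = lookup (pick (S j)) (lead (pick (S j))) / lookup (pick (S i)) (lead (pick (S i)))"
    define r where "r = pick (S j) - single u c * pick (S i)"
    have "keys u \<subseteq> V"
      using keys[of j] by (auto simp: u in_keys_iff lookup_add)
    then have su: "single u c \<in> carrier ?R"
      by (auto simp: mpoly_ring_iff)
    have "pick (S i) \<in> genideal ?R (S j)"
      using R.genideal_self[of "S j"] S[of j] a(1) p_in_S[OF ij(1)] by blast
    then have G: "single u c * pick (S i) \<in> genideal ?R (S j)"
      using mpoly_idealD(6)[OF Gid _ su] by blast
    have r1: "r \<notin> genideal ?R (S j)"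
      using mpoly_idealD(3)[OF Gid[of j] _ G, of r] p(2)[of j] by (auto simp: r_def)
    have r2: "r \<in> \<aa>"
      unfolding r_def by (intro a(5) a(6) p(1) su)
    have "r \<noteq> 0" using r1 mpoly_idealD(2)[OF Gid] by blast
    then have "lead r < lead (pick (S j))"
      using lead_reduce[OF p(3)[of i] p(3)[of j] u] by (simp add: r_def c_def)
    then show False
      using pick(2)[of "S j" r] S[of j] r1 r2 by blast
  qed
qed


section \<open>Chains of primes in a polynomial ring\<close>

interpretation mpoly_vs: vector_space "\<lambda>(c::'a::field) p :: ('v, 'a) mpoly. mconst c * p"
  by unfold_locales (simp_all add: distrib_left distrib_right mconst_add mconst_mult mult.assoc)

definition list_monomial :: "('v, 'a::field) mpoly list \<Rightarrow> nat list \<Rightarrow> ('v, 'a) mpoly" where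
  "list_monomial fs es = prod_list (map2 (^) fs es)"

lemma list_monomial_Nil [simp]: "list_monomial [] es = 1"
  and list_monomial_Cons [simp]: "list_monomial (f # fs) (e # es) = f ^ e * list_monomial fs es"
  by (simp_all add: list_monomial_def)

lemma list_monomial_closed:
  "set fs \<subseteq> polys V \<Longrightarrow> list_monomial fs es \<in> polys V"
proof (induction fs arbitrary: es)
  case (Cons f fs)
  then show ?case by (cases es) (auto simp: list_monomial_def)
qed auto

lemma mpoly_primeD:
  assumes "primeideal Q (mpoly_ring V)"
  shows "ideal Q (mpoly_ring V)"
    and "a \<in> polys V \<Longrightarrow> b \<in> polys V \<Longrightarrow> a * b \<in> Q \<Longrightarrow> a \<in> Q \<or> b \<in> Q"
    and "mconst c \<in> Q \<Longrightarrow> c = 0"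
    and "a \<in> polys V \<Longrightarrow> a ^ n \<in> Q \<Longrightarrow> a \<in> Q"
proof -
  interpret primeideal Q "mpoly_ring V" by fact
  show id: "ideal Q (mpoly_ring V)" by (rule is_ideal)
  show prime: "a \<in> Q \<or> b \<in> Q" if "a \<in> polys V" "b \<in> polys V" "a * b \<in> Q" for a b
    using I_prime that by simp
  have one: "1 \<notin> Q"
    using I_notcarr one_imp_carrier by auto
  show "c = 0" if "mconst c \<in> Q"
  proof (rule ccontr)
    assume c: "c \<noteq> 0"
    have "mconst (inverse c) * mconst c \<in> Q"
      by (rule mpoly_idealD(6)[OF id that]) simp
    with c one show False by (simp flip: mconst_mult)
  qed
  show "a ^ n \<in> Q \<Longrightarrow> a \<in> Q" if "a \<in> polys V" for a n
  proof (induction n)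
    case (Suc n)
    then show ?case using prime[of a "a ^ n"] that mpoly_power_closed[OF that] by auto
  qed (use one in simp)
qed

text \<open>Elements \<open>f\<^sub>i \<in> Q\<^bsub>i+1\<^esub> - Q\<^sub>i\<close> are algebraically independent modulo \<open>Q\<^sub>0\<close>.  In a relation divide by
the smallest power of the first element \<open>f\<close>, which is not in the prime \<open>Q\<^sub>0\<close>; modulo \<open>Q\<^sub>1 \<ni> f\<close> there
remains a nontrivial relation between the other elements.\<close>

lemma monomials_independent_mod_chain:
  assumes "\<And>i. i \<le> length fs \<Longrightarrow> primeideal (Q i) (mpoly_ring V)"
    and "\<And>i. i < length fs \<Longrightarrow> Q i \<subseteq> Q (Suc i)"
    and "\<And>i. i < length fs \<Longrightarrow> fs ! i \<in> Q (Suc i) - Q i"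
    and "finite E" "E \<noteq> {}" "\<And>e. e \<in> E \<Longrightarrow> length e = length fs" "\<And>e. e \<in> E \<Longrightarrow> c e \<noteq> 0"
  shows "(\<Sum>e\<in>E. mconst (c e) * list_monomial fs e) \<notin> Q 0"
  using assms
proof (induction fs arbitrary: Q E c)
  case Nil
  then have "E = {[]}" by auto
  then show ?case using Nil mpoly_primeD(3)[of "Q 0"] by auto
next
  case (Cons f fs)
  let ?R = "polys V"
  note prime = Cons.prems(1)
  have id: "ideal (Q i) (mpoly_ring V)" if "i \<le> Suc (length fs)" for i
    using mpoly_primeD(1)[OF prime] that by simp
  have f: "f \<in> Q 1" "f \<notin> Q 0" using Cons.prems(3)[of 0] by auto
  have fR: "f \<in> ?R" using mpoly_idealD(1)[OF id[of 1]] f by auto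
  have "fs ! i \<in> ?R" if "i < length fs" for i
    using mpoly_idealD(1)[OF id[of "Suc (Suc i)"]] Cons.prems(3)[of "Suc i"] that by auto
  then have fsR: "set fs \<subseteq> ?R" by (auto simp: in_set_conv_nth)
  (* the smallest exponent of f that occurs *)
  define e0 where "e0 = Min (hd ` E)"
  define E0 where "E0 = {e\<in>E. hd e = e0}"
  have "e0 \<in> hd ` E" unfolding e0_def using Cons.prems(4,5) by (intro Min_in) auto
  then have E0: "E0 \<noteq> {}" "finite E0" "E0 \<subseteq> E" using Cons.prems(4) by (auto simp: E0_def)
  have ge: "e0 \<le> hd e" if "e \<in> E" for e
    using that Cons.prems(4) by (auto simp: e0_def)
  have eq: "e = hd e # tl e" if "e \<in> E" for e
    using Cons.prems(6)[OF that] by (cases e) auto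
  define T where "T = (\<Sum>e\<in>E0. mconst (c e) * list_monomial fs (tl e))"
  define U where "U = (\<Sum>e\<in>E - E0. mconst (c e) * (f ^ (hd e - e0 - 1) * list_monomial fs (tl e)))"
  have TU: "T \<in> ?R" "U \<in> ?R"
    unfolding T_def U_def using fR list_monomial_closed[OF fsR] by auto
  have "(\<Sum>e\<in>E. mconst (c e) * list_monomial (f # fs) e)
      = (\<Sum>e\<in>E0. mconst (c e) * list_monomial (f # fs) e) + (\<Sum>e\<in>E - E0. mconst (c e) * list_monomial (f # fs) e)"
    by (rule trans[OF sum.subset_diff[OF E0(3) Cons.prems(4)] add.commute])
  also have "(\<Sum>e\<in>E0. mconst (c e) * list_monomial (f # fs) e) = f ^ e0 * T"
    unfolding T_def sum_distrib_left
  proof (rule sum.cong[OF refl])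
    fix e assume "e \<in> E0"
    then have "e = e0 # tl e" using eq by (auto simp: E0_def)
    then have "list_monomial (f # fs) e = f ^ e0 * list_monomial fs (tl e)" by (metis list_monomial_Cons)
    then show "mconst (c e) * list_monomial (f # fs) e = f ^ e0 * (mconst (c e) * list_monomial fs (tl e))"
      by (simp add: mult.left_commute)
  qed
  also have "(\<Sum>e\<in>E - E0. mconst (c e) * list_monomial (f # fs) e) = f ^ e0 * (f * U)"
    unfolding U_def sum_distrib_left
  proof (rule sum.cong[OF refl])
    fix e assume e: "e \<in> E - E0"
    then have "e0 < hd e" using ge[of e] by (auto simp: E0_def)
    then have "f ^ hd e = f ^ e0 * (f * f ^ (hd e - e0 - 1))"
      by (simp flip: power_Suc power_add)
    moreover have "list_monomial (f # fs) e = f ^ hd e * list_monomial fs (tl e)" using eq e by (metis DiffD1 list_monomial_Cons)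
    ultimately show "mconst (c e) * list_monomial (f # fs) e
        = f ^ e0 * (f * (mconst (c e) * (f ^ (hd e - e0 - 1) * list_monomial fs (tl e))))"
      by (simp add: mult_ac)
  qed
  finally have sum: "(\<Sum>e\<in>E. mconst (c e) * list_monomial (f # fs) e) = f ^ e0 * (T + f * U)"
    by (simp add: distrib_left)
  have "T \<notin> Q 1"
  proof -
    have inj: "inj_on tl E0"
    proof (rule inj_onI)
      fix x y assume "x \<in> E0" "y \<in> E0" "tl x = tl y"
      then show "x = y" using eq[of x] eq[of y] by (simp add: E0_def)
    qed
    have "T = (\<Sum>e\<in>tl ` E0. mconst (c (e0 # e)) * list_monomial fs e)"
      unfolding T_def sum.reindex[OF inj] o_def
    proof (rule sum.cong[OF refl])
      fix e assume "e \<in> E0"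
      then have "e = e0 # tl e" using eq by (auto simp: E0_def)
      then show "mconst (c e) * list_monomial fs (tl e) = mconst (c (e0 # tl e)) * list_monomial fs (tl e)" by simp
    qed
    moreover have "(\<Sum>e\<in>tl ` E0. mconst (c (e0 # e)) * list_monomial fs e) \<notin> Q (Suc 0)"
    proof (rule Cons.IH[of "\<lambda>i. Q (Suc i)"])
      fix i assume i: "i < length fs"
      show "fs ! i \<in> Q (Suc (Suc i)) - Q (Suc i)" "Q (Suc i) \<subseteq> Q (Suc (Suc i))"
        using Cons.prems(2,3)[of "Suc i"] i by auto
    next
      fix e assume "e \<in> tl ` E0"
      then obtain e' where e': "e' \<in> E" "hd e' = e0" "e = tl e'" by (auto simp: E0_def)
      then have "e' = e0 # e" using eq by metis
      then show "length e = length fs" "c (e0 # e) \<noteq> 0"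
        using Cons.prems(6,7)[OF e'(1)] by auto
    qed (use prime E0 in auto)
    ultimately show ?thesis by simp
  qed
  then have "T + f * U \<notin> Q 1"
    using mpoly_idealD(5)[OF id[of 1], of "T + f * U" "f * U"]
      mpoly_idealD(6)[OF id[of 1] f(1) TU(2)] by (auto simp: mult.commute)
  then have "T + f * U \<notin> Q 0" using Cons.prems(2)[of 0] by auto
  moreover have "f ^ e0 \<notin> Q 0"
    using mpoly_primeD(4)[OF prime[of 0] fR] f(2) by auto
  ultimately show ?case
    unfolding sum using mpoly_primeD(2)[OF prime[of 0], of "f ^ e0" "T + f * U"] TU fR by auto
qed

text \<open>The degree in each single variable behaves better under counting than the total degree: the
monomials below a bound form a box.\<close>

definition exps_le :: "nat \<Rightarrow> ('v, 'a::field) mpoly \<Rightarrow> bool" where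
  "exps_le N p \<longleftrightarrow> (\<forall>t\<in>keys p. \<forall>v. lookup t v \<le> N)"

lemma exps_le_mult:
  assumes "exps_le M p" "exps_le N q"
  shows "exps_le (M + N) (p * q)"
  unfolding exps_le_def
proof (intro ballI allI)
  fix t v assume "t \<in> keys (p * q)"
  then obtain a b where "t = a + b" "a \<in> keys p" "b \<in> keys q"
    using keys_mult[of p q] by blast
  then show "lookup t v \<le> M + N"
    using assms by (auto simp: exps_le_def lookup_add intro!: add_mono)
qed

lemma exps_le_mono: "exps_le M p \<Longrightarrow> M \<le> N \<Longrightarrow> exps_le N p"
  unfolding exps_le_def using order_trans by blast

lemma exps_le_1: "exps_le N 1"
  by (simp add: exps_le_def)

lemma exps_le_power: "exps_le M p \<Longrightarrow> exps_le (n * M) (p ^ n)"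
  by (induction n) (auto simp: exps_le_1 intro: exps_le_mult)

lemma exps_le_list_monomial:
  assumes "\<And>f. f \<in> set fs \<Longrightarrow> exps_le M f" "length es = length fs" "\<And>e. e \<in> set es \<Longrightarrow> e \<le> D"
  shows "exps_le (length fs * (D * M)) (list_monomial fs es)"
  using assms(2,1,3)
proof (induction es fs rule: list_induct2)
  case (Cons e es f fs)
  have "exps_le (D * M) (f ^ e)"
    by (rule exps_le_mono[OF exps_le_power[of M]]) (use Cons.prems in auto)
  then show ?case using Cons by (auto intro: exps_le_mult)
qed (simp add: exps_le_1)

lemma exps_le_exists: "\<exists>N. exps_le N p"
proof -
  have "finite (\<Union>t\<in>keys p. lookup t ` keys t)" by simp
  then obtain N where N: "\<And>x. x \<in> (\<Union>t\<in>keys p. lookup t ` keys t) \<Longrightarrow> x \<le> N"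
    using finite_nat_set_iff_bounded_le by meson
  have "lookup t v \<le> N" if "t \<in> keys p" for t v
  proof (cases "v \<in> keys t")
    case True
    with that show ?thesis by (intro N) blast
  qed (simp add: in_keys_iff)
  then show ?thesis by (auto simp: exps_le_def)
qed

lemma exps_le_common: "finite F \<Longrightarrow> \<exists>N. \<forall>f\<in>F. exps_le N f"
proof (induction F rule: finite_induct)
  case (insert f F)
  then obtain N where N: "\<forall>f\<in>F. exps_le N f" by blast
  obtain M where M: "exps_le M f" using exps_le_exists by blast
  show ?case
    using N M by (intro exI[of _ "M + N"]) (auto intro: exps_le_mono)
qed simp

definition box_monomials :: "'v set \<Rightarrow> nat \<Rightarrow> ('v \<Rightarrow>\<^sub>0 nat) set" where
  "box_monomials V N = {t. keys t \<subseteq> V \<and> (\<forall>v. lookup t v \<le> N)}"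

lemma card_box_monomials:
  assumes V: "finite V"
  shows "finite (box_monomials V N)" and "card (box_monomials V N) \<le> (N + 1) ^ card V"
proof -
  have inj: "inj_on (\<lambda>t. restrict (lookup t) V) (box_monomials V N)"
  proof (rule inj_onI)
    fix s t assume st: "s \<in> box_monomials V N" "t \<in> box_monomials V N"
      and eq: "restrict (lookup s) V = restrict (lookup t) V"
    show "s = t"
    proof (rule poly_mapping_eqI)
      fix v show "lookup s v = lookup t v"
      proof (cases "v \<in> V")
        case True
        then show ?thesis using fun_cong[OF eq, of v] by simp
      next
        case False
        then show ?thesis using st by (metis (mono_tags, lifting) box_monomials_def in_keys_iff mem_Collect_eq subsetD)
      qed
    qed
  qed
  have sub: "(\<lambda>t. restrict (lookup t) V) ` box_monomials V N \<subseteq> PiE V (\<lambda>_. {..N})"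
    by (auto simp: box_monomials_def)
  have fin: "finite (PiE V (\<lambda>_. {..N}))" using V by (simp add: finite_PiE)
  show "finite (box_monomials V N)"
    using inj sub fin by (metis finite_imageD finite_subset)
  have "card (box_monomials V N) \<le> card (PiE V (\<lambda>_. {..N}))"
    using card_inj_on_le[OF inj sub fin] .
  then show "card (box_monomials V N) \<le> (N + 1) ^ card V"
    using V by (simp add: card_PiE)
qed

lemma in_span_box:
  assumes "p \<in> polys V" "exps_le N p"
  shows "p \<in> mpoly_vs.span ((\<lambda>t. single t 1) ` box_monomials V N)"
proof -
  have "(\<Sum>t\<in>keys p. single t (lookup p t))
      \<in> mpoly_vs.span ((\<lambda>t. single t 1) ` box_monomials V N)"
  proof (rule mpoly_vs.span_sum)
    fix t assume "t \<in> keys p"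
    then have "t \<in> box_monomials V N" using assms by (auto simp: box_monomials_def mpoly_ring_iff exps_le_def)
    moreover have "single t c = mconst c * single t 1" for c
      by (simp add: mconst_def mult_single)
    ultimately show "single t (lookup p t) \<in> mpoly_vs.span ((\<lambda>t. single t 1) ` box_monomials V N)"
      by (metis image_eqI mpoly_vs.span_base mpoly_vs.span_scale)
  qed
  then show ?thesis by (simp flip: sum_of_terms)
qed

text \<open>A chain of length \<open>l\<close> provides \<open>l\<close> algebraically independent polynomials.  Their \<open>D\<^sup>l\<close> monomials with
exponents less than \<open>D\<close> are linearly independent and lie in a space of dimension
\<open>O(D\<^sup>s)\<close> for \<open>s\<close> variables, so \<open>l \<le> s\<close>.\<close>

theorem prime_chain_length_le:
  fixes Q :: "nat \<Rightarrow> ('v, 'a::field) mpoly set"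
  assumes V: "finite V"
    and prime: "\<And>i. i \<le> l \<Longrightarrow> primeideal (Q i) (mpoly_ring V)"
    and chain: "\<And>i. i < l \<Longrightarrow> Q i \<subset> Q (Suc i)"
  shows "l \<le> card V"
proof (rule ccontr)
  assume "\<not> l \<le> card V"
  then have less: "card V < l" by simp
  have "\<forall>i. \<exists>f. i < l \<longrightarrow> f \<in> Q (Suc i) - Q i" using chain by blast
  then obtain f where f: "\<And>i. i < l \<Longrightarrow> f i \<in> Q (Suc i) - Q i" by metis
  define fs where "fs = map f [0..<l]"
  have len: "length fs = l" by (simp add: fs_def)
  have fsR: "set fs \<subseteq> polys V"
  proof
    fix g assume "g \<in> set fs"
    then obtain i where "i < l" "g = f i" by (auto simp: fs_def)
    then show "g \<in> polys V"
      using f[of i] mpoly_idealD(1)[OF mpoly_primeD(1)[OF prime[of "Suc i"]]] by auto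
  qed
  obtain M where M: "\<And>g. g \<in> set fs \<Longrightarrow> exps_le M g"
    using exps_le_common[of "set fs"] by auto
  (* large enough for D^l > ((l * M + 1) * D) ^ card V when l > card V *)
  define D where "D = (l * M + 1) ^ card V + 1"
  define L where "L = {es. set es \<subseteq> {..<D} \<and> length es = l}"
  have cardL: "finite L" "card L = D ^ l"
    using card_lists_length_eq[of "{..<D}" l] finite_lists_length_eq[of "{..<D}" l] by (simp_all add: L_def)
  have zero: "0 \<in> Q 0" using mpoly_idealD(2)[OF mpoly_primeD(1)[OF prime[of 0]]] by simp
  have indep: "(\<Sum>e\<in>E. mconst (c e) * list_monomial fs e) \<noteq> 0"
    if "E \<subseteq> L" "E \<noteq> {}" "\<And>e. e \<in> E \<Longrightarrow> c e \<noteq> 0" for E c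
  proof -
    have "(\<Sum>e\<in>E. mconst (c e) * list_monomial fs e) \<notin> Q 0"
    proof (rule monomials_independent_mod_chain[of fs Q V])
      show "finite E" using that(1) cardL(1) finite_subset by blast
    qed (use prime chain f that in \<open>auto simp: len fs_def L_def\<close>)
    then show ?thesis using zero by metis
  qed
  have inj: "inj_on (list_monomial fs) L"
  proof (rule inj_onI, rule ccontr)
    fix x y assume "x \<in> L" "y \<in> L" "list_monomial fs x = list_monomial fs y" "x \<noteq> y"
    moreover have "(\<Sum>e\<in>{x, y}. mconst (if e = x then 1 else - 1) * list_monomial fs e) \<noteq> 0"
      by (rule indep) (use \<open>x \<in> L\<close> \<open>y \<in> L\<close> in auto)
    ultimately show False by (simp add: mconst_uminus)
  qed
  have "mpoly_vs.independent (list_monomial fs ` L)"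
    unfolding mpoly_vs.independent_explicit_finite_subsets
  proof (intro allI impI ballI, rule ccontr)
    fix S u p
    assume S: "S \<subseteq> list_monomial fs ` L" "finite S" and sum: "(\<Sum>v\<in>S. mconst (u v) * v) = 0"
      and p: "p \<in> S" "u p \<noteq> 0"
    define E where "E = {e\<in>L. list_monomial fs e \<in> S \<and> u (list_monomial fs e) \<noteq> 0}"
    have img: "list_monomial fs ` E = {v\<in>S. u v \<noteq> 0}" using S(1) by (auto simp: E_def)
    have "inj_on (list_monomial fs) E" using inj by (rule inj_on_subset) (auto simp: E_def)
    then have "(\<Sum>e\<in>E. mconst (u (list_monomial fs e)) * list_monomial fs e) = (\<Sum>v\<in>list_monomial fs ` E. mconst (u v) * v)"
      by (simp add: sum.reindex)
    also have "\<dots> = (\<Sum>v\<in>S. mconst (u v) * v)"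
      unfolding img by (rule sum.mono_neutral_left) (use S in auto)
    also have "\<dots> = 0" by (rule sum)
    finally have "(\<Sum>e\<in>E. mconst (u (list_monomial fs e)) * list_monomial fs e) = 0" .
    moreover have "p \<in> list_monomial fs ` E" unfolding img using p by simp
    then have "E \<noteq> {}" by blast
    then have "(\<Sum>e\<in>E. mconst (u (list_monomial fs e)) * list_monomial fs e) \<noteq> 0"
      by (intro indep) (simp_all add: E_def subset_iff)
    ultimately show False by contradiction
  qed
  moreover have "list_monomial fs ` L \<subseteq> mpoly_vs.span ((\<lambda>t. single t 1) ` box_monomials V (l * (D * M)))"
  proof
    fix p assume "p \<in> list_monomial fs ` L"
    then obtain es where es: "p = list_monomial fs es" "length es = l" "set es \<subseteq> {..<D}" by (auto simp: L_def)
    have "exps_le (l * (D * M)) p"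
      unfolding es(1) using exps_le_list_monomial[of fs M es D] M es len by (auto simp: subset_iff less_imp_le)
    then show "p \<in> mpoly_vs.span ((\<lambda>t. single t 1) ` box_monomials V (l * (D * M)))"
      by (intro in_span_box) (auto simp: es(1) intro!: list_monomial_closed fsR)
  qed
  ultimately have "card (list_monomial fs ` L) \<le> card ((\<lambda>t. single t (1::'a)) ` box_monomials V (l * (D * M)))"
    using mpoly_vs.independent_span_bound card_box_monomials(1)[OF V] by blast
  also have "\<dots> \<le> card (box_monomials V (l * (D * M)))"
    by (rule card_image_le) (rule card_box_monomials(1)[OF V])
  also have "\<dots> \<le> (l * (D * M) + 1) ^ card V" by (rule card_box_monomials(2)[OF V])
  also have "\<dots> \<le> ((l * M + 1) * D) ^ card V"
    by (rule power_mono) (auto simp: D_def algebra_simps)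
  finally have "D ^ l \<le> (l * M + 1) ^ card V * D ^ card V"
    using cardL(2) by (simp only: card_image[OF inj] power_mult_distrib)
  moreover have "D * D ^ card V \<le> D ^ l"
    using power_increasing[of "Suc (card V)" l D] less by (simp add: D_def)
  ultimately have "D * D ^ card V \<le> (l * M + 1) ^ card V * D ^ card V"
    by (rule order_trans[rotated])
  moreover have "0 < D ^ card V" by (simp add: D_def)
  ultimately have "D \<le> (l * M + 1) ^ card V" by (simp only: mult_le_cancel2)
  then show False by (simp add: D_def)
qed


section \<open>Localization\<close>

locale multiplicative_set = cring R for R (structure) +
  fixes S
  assumes S_sub: "S \<subseteq> carrier R"
    and S_one: "\<one> \<in> S"
    and S_mult: "s \<in> S \<Longrightarrow> t \<in> S \<Longrightarrow> s \<otimes> t \<in> S"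
begin

abbreviation "mk_frac \<equiv> frac_class R S"
abbreviation "loc \<equiv> localization R S"

lemma S_carrier [simp, intro]: "s \<in> S \<Longrightarrow> s \<in> carrier R"
  using S_sub by blast

lemma frac_relI:
  "r \<in> carrier R \<Longrightarrow> r' \<in> carrier R \<Longrightarrow> s \<in> S \<Longrightarrow> s' \<in> S \<Longrightarrow> t \<in> S \<Longrightarrow>
   t \<otimes> (r \<otimes> s') = t \<otimes> (r' \<otimes> s) \<Longrightarrow> ((r, s), (r', s')) \<in> frac_rel R S"
  by (auto simp: frac_rel_def)

lemma frac_rel_equiv: "equiv (carrier R \<times> S) (frac_rel R S)"
proof (rule equivI)
  show "frac_rel R S \<subseteq> (carrier R \<times> S) \<times> (carrier R \<times> S)"
    by (auto simp: frac_rel_def)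
  show "refl_on (carrier R \<times> S) (frac_rel R S)"
    by (auto simp: refl_on_def frac_rel_def S_one)
  show "sym (frac_rel R S)"
    by (auto simp: sym_def frac_rel_def) metis
  show "trans (frac_rel R S)"
  proof (rule transI, clarify)
    fix a s b t c u
    assume 1: "((a, s), (b, t)) \<in> frac_rel R S" and 2: "((b, t), (c, u)) \<in> frac_rel R S"
    from 1 obtain x where x: "x \<in> S" "x \<otimes> (a \<otimes> t) = x \<otimes> (b \<otimes> s)" by (auto simp: frac_rel_def)
    from 2 obtain y where y: "y \<in> S" "y \<otimes> (b \<otimes> u) = y \<otimes> (c \<otimes> t)" by (auto simp: frac_rel_def)
    have car: "a \<in> carrier R" "b \<in> carrier R" "c \<in> carrier R" "s \<in> S" "t \<in> S" "u \<in> S"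
      using 1 2 by (auto simp: frac_rel_def)
    have "(x \<otimes> y \<otimes> t) \<otimes> (a \<otimes> u) = (x \<otimes> (a \<otimes> t)) \<otimes> (y \<otimes> u)"
      using x(1) y(1) car by (simp add: m_ac)
    also have "\<dots> = (y \<otimes> (b \<otimes> u)) \<otimes> (x \<otimes> s)"
      unfolding x(2) using x(1) y(1) car by (simp add: m_ac)
    also have "\<dots> = (x \<otimes> y \<otimes> t) \<otimes> (c \<otimes> s)"
      unfolding y(2) using x(1) y(1) car by (simp add: m_ac)
    finally show "((a, s), (c, u)) \<in> frac_rel R S"
      using car x y by (intro frac_relI[of _ _ _ _ "x \<otimes> y \<otimes> t"] S_mult) auto
  qed
qed

lemma frac_eq_iff:
  assumes "r \<in> carrier R" "r' \<in> carrier R" "s \<in> S" "s' \<in> S"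
  shows "mk_frac r s = mk_frac r' s' \<longleftrightarrow> (\<exists>t\<in>S. t \<otimes> (r \<otimes> s') = t \<otimes> (r' \<otimes> s))"
  using eq_equiv_class_iff[OF frac_rel_equiv, of "(r, s)" "(r', s')"] assms
  by (auto simp: frac_class_def frac_rel_def)

lemma frac_eqI:
  assumes "r \<in> carrier R" "r' \<in> carrier R" "s \<in> S" "s' \<in> S" "r \<otimes> s' = r' \<otimes> s"
  shows "mk_frac r s = mk_frac r' s'"
  using assms frac_eq_iff S_one by auto

lemma mem_fracD:
  assumes "(r', s') \<in> mk_frac r s"
  shows "r' \<in> carrier R" "s' \<in> S" "\<exists>t\<in>S. t \<otimes> (r \<otimes> s') = t \<otimes> (r' \<otimes> s)"
  using assms by (auto simp: frac_class_def frac_rel_def)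

lemma frac_self: "r \<in> carrier R \<Longrightarrow> s \<in> S \<Longrightarrow> (r, s) \<in> mk_frac r s"
  using equiv_class_self[OF frac_rel_equiv, of "(r, s)"] by (simp add: frac_class_def)

lemma frac_closed [simp, intro]: "r \<in> carrier R \<Longrightarrow> s \<in> S \<Longrightarrow> mk_frac r s \<in> carrier loc"
  by (auto simp: localization_def frac_class_def intro: quotientI)

lemma carrier_locE:
  assumes "x \<in> carrier loc"
  obtains r s where "r \<in> carrier R" "s \<in> S" "x = mk_frac r s"
  using assms by (auto simp: localization_def frac_class_def elim!: quotientE)

lemma UN_const2:
  assumes "\<And>r s r' s'. (r, s) \<in> X \<Longrightarrow> (r', s') \<in> Y \<Longrightarrow> F r s r' s' = C" "X \<noteq> {}" "Y \<noteq> {}"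
  shows "(\<Union>(r, s)\<in>X. \<Union>(r', s')\<in>Y. F r s r' s') = C"
  using assms by fastforce

lemma frac_mult:
  assumes "r \<in> carrier R" "r' \<in> carrier R" "s \<in> S" "s' \<in> S"
  shows "mk_frac r s \<otimes>\<^bsub>loc\<^esub> mk_frac r' s' = mk_frac (r \<otimes> r') (s \<otimes> s')"
proof -
  have "mk_frac (x \<otimes> x') (y \<otimes> y') = mk_frac (r \<otimes> r') (s \<otimes> s')"
    if 1: "(x, y) \<in> mk_frac r s" and 2: "(x', y') \<in> mk_frac r' s'" for x y x' y'
  proof -
    note xy = mem_fracD(1,2)[OF 1] mem_fracD(1,2)[OF 2]
    from mem_fracD(3)[OF 1] obtain t where t: "t \<in> S" "t \<otimes> (r \<otimes> y) = t \<otimes> (x \<otimes> s)" by blast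
    from mem_fracD(3)[OF 2] obtain t' where t': "t' \<in> S" "t' \<otimes> (r' \<otimes> y') = t' \<otimes> (x' \<otimes> s')" by blast
    have "(t \<otimes> t') \<otimes> ((x \<otimes> x') \<otimes> (s \<otimes> s')) = (t \<otimes> (x \<otimes> s)) \<otimes> (t' \<otimes> (x' \<otimes> s'))"
      using xy t(1) t'(1) assms by (simp add: m_ac)
    also have "\<dots> = (t \<otimes> t') \<otimes> ((r \<otimes> r') \<otimes> (y \<otimes> y'))"
      unfolding t(2)[symmetric] t'(2)[symmetric] using xy t(1) t'(1) assms by (simp add: m_ac)
    finally show ?thesis
      using xy assms t(1) t'(1) by (subst frac_eq_iff) (auto intro: S_mult)
  qed
  then have "(\<Union>(r, s)\<in>mk_frac r s. \<Union>(r', s')\<in>mk_frac r' s'. mk_frac (r \<otimes> r') (s \<otimes> s')) = mk_frac (r \<otimes> r') (s \<otimes> s')"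
    using frac_self assms by (intro UN_const2) blast+
  then show ?thesis by (simp add: localization_def)
qed

lemma frac_add:
  assumes "r \<in> carrier R" "r' \<in> carrier R" "s \<in> S" "s' \<in> S"
  shows "mk_frac r s \<oplus>\<^bsub>loc\<^esub> mk_frac r' s' = mk_frac (r \<otimes> s' \<oplus> r' \<otimes> s) (s \<otimes> s')"
proof -
  have "mk_frac (x \<otimes> y' \<oplus> x' \<otimes> y) (y \<otimes> y') = mk_frac (r \<otimes> s' \<oplus> r' \<otimes> s) (s \<otimes> s')"
    if 1: "(x, y) \<in> mk_frac r s" and 2: "(x', y') \<in> mk_frac r' s'" for x y x' y'
  proof -
    note xy = mem_fracD(1,2)[OF 1] mem_fracD(1,2)[OF 2]
    from mem_fracD(3)[OF 1] obtain t where t: "t \<in> S" "t \<otimes> (r \<otimes> y) = t \<otimes> (x \<otimes> s)" by blast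
    from mem_fracD(3)[OF 2] obtain t' where t': "t' \<in> S" "t' \<otimes> (r' \<otimes> y') = t' \<otimes> (x' \<otimes> s')" by blast
    have "(t \<otimes> t') \<otimes> ((x \<otimes> y' \<oplus> x' \<otimes> y) \<otimes> (s \<otimes> s'))
        = (t \<otimes> (x \<otimes> s)) \<otimes> (t' \<otimes> (y' \<otimes> s')) \<oplus> (t' \<otimes> (x' \<otimes> s')) \<otimes> (t \<otimes> (y \<otimes> s))"
      using xy t(1) t'(1) assms by (simp add: m_ac l_distr r_distr)
    also have "\<dots> = (t \<otimes> t') \<otimes> ((r \<otimes> s' \<oplus> r' \<otimes> s) \<otimes> (y \<otimes> y'))"
      unfolding t(2)[symmetric] t'(2)[symmetric] using xy t(1) t'(1) assms by (simp add: m_ac l_distr r_distr)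
    finally show ?thesis
      using xy assms t(1) t'(1) by (subst frac_eq_iff) (auto intro: S_mult)
  qed
  then have "(\<Union>(r, s)\<in>mk_frac r s. \<Union>(r', s')\<in>mk_frac r' s'. mk_frac (r \<otimes> s' \<oplus> r' \<otimes> s) (s \<otimes> s'))
      = mk_frac (r \<otimes> s' \<oplus> r' \<otimes> s) (s \<otimes> s')"
    using frac_self assms by (intro UN_const2) blast+
  then show ?thesis by (simp add: localization_def)
qed

lemma loc_one: "\<one>\<^bsub>loc\<^esub> = mk_frac \<one> \<one>" and loc_zero: "\<zero>\<^bsub>loc\<^esub> = mk_frac \<zero> \<one>"
  by (simp_all add: localization_def)

lemma localization_cring: "cring loc"
proof (rule cringI)
  note simps = frac_mult frac_add loc_one loc_zero S_one S_mult
  show "abelian_group loc"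
  proof (rule abelian_groupI)
    fix x y z
    assume "x \<in> carrier loc" "y \<in> carrier loc" "z \<in> carrier loc"
    then obtain a s b t c u where "a \<in> carrier R" "s \<in> S" "x = mk_frac a s"
      "b \<in> carrier R" "t \<in> S" "y = mk_frac b t" "c \<in> carrier R" "u \<in> S" "z = mk_frac c u"
      by (metis carrier_locE)
    then show "x \<oplus>\<^bsub>loc\<^esub> y \<oplus>\<^bsub>loc\<^esub> z = x \<oplus>\<^bsub>loc\<^esub> (y \<oplus>\<^bsub>loc\<^esub> z)"
      by (simp add: simps) (simp add: m_ac a_ac l_distr r_distr)
  next
    fix x assume "x \<in> carrier loc"
    then obtain a s where x: "a \<in> carrier R" "s \<in> S" "x = mk_frac a s" by (metis carrier_locE)
    have "mk_frac (\<ominus> a) s \<oplus>\<^bsub>loc\<^esub> x = mk_frac \<zero> (s \<otimes> s)"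
      using x by (simp add: frac_add l_neg flip: l_distr)
    also have "\<dots> = \<zero>\<^bsub>loc\<^esub>"
      unfolding loc_zero using x by (intro frac_eqI) (auto simp: simps)
    finally show "\<exists>y\<in>carrier loc. y \<oplus>\<^bsub>loc\<^esub> x = \<zero>\<^bsub>loc\<^esub>" using x by blast
  qed (auto elim!: carrier_locE simp: simps a_comm m_comm intro!: frac_closed)
  show "comm_monoid loc"
    by (rule comm_monoidI) (auto elim!: carrier_locE simp: simps m_ac intro!: frac_closed)
  fix x y z
  assume "x \<in> carrier loc" "y \<in> carrier loc" "z \<in> carrier loc"
  then obtain a s b t c u where *: "a \<in> carrier R" "s \<in> S" "x = mk_frac a s"
    "b \<in> carrier R" "t \<in> S" "y = mk_frac b t" "c \<in> carrier R" "u \<in> S" "z = mk_frac c u"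
    by (metis carrier_locE)
  then show "(x \<oplus>\<^bsub>loc\<^esub> y) \<otimes>\<^bsub>loc\<^esub> z = x \<otimes>\<^bsub>loc\<^esub> z \<oplus>\<^bsub>loc\<^esub> y \<otimes>\<^bsub>loc\<^esub> z"
    unfolding * by (simp add: simps, intro frac_eqI) (auto simp: simps m_ac l_distr r_distr)
qed

lemma frac_hom: "(\<lambda>r. mk_frac r \<one>) \<in> ring_hom R loc"
  by (rule ring_hom_memI) (auto simp: S_one frac_mult frac_add loc_one)

lemma frac_unit: "s \<in> S \<Longrightarrow> mk_frac s \<one> \<in> Units loc"
proof -
  assume s: "s \<in> S"
  have "mk_frac \<one> s \<otimes>\<^bsub>loc\<^esub> mk_frac s \<one> = \<one>\<^bsub>loc\<^esub>" "mk_frac s \<one> \<otimes>\<^bsub>loc\<^esub> mk_frac \<one> s = \<one>\<^bsub>loc\<^esub>"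
    using s by (simp_all add: frac_mult S_one loc_one) (intro frac_eqI; simp add: S_one)+
  then show ?thesis using s S_one by (auto simp: Units_def intro!: bexI[of _ "mk_frac \<one> s"])
qed

lemma frac_times_denominator:
  "r \<in> carrier R \<Longrightarrow> s \<in> S \<Longrightarrow> mk_frac r s \<otimes>\<^bsub>loc\<^esub> mk_frac s \<one> = mk_frac r \<one>"
  by (simp add: frac_mult S_one) (intro frac_eqI; simp add: S_one)

lemma frac_eq_zero_iff: "r \<in> carrier R \<Longrightarrow> mk_frac r \<one> = \<zero>\<^bsub>loc\<^esub> \<longleftrightarrow> (\<exists>t\<in>S. t \<otimes> r = \<zero>)"
  by (auto simp: loc_zero frac_eq_iff S_one)

end

text \<open>The properties that characterize \<open>L\<close> as the localization of \<open>P/I\<close> at \<open>M/I\<close>, in terms of the composite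
\<open>\<theta>: P \<rightarrow> P/I \<rightarrow> L\<close>.  They allow computing with elements of \<open>P\<close> instead of classes of pairs of cosets.\<close>

locale localization_at = ring_hom_cring P L \<theta> + M: primeideal M P + I: ideal I P
  for P (structure) and L (structure) and \<theta> and M and I +
  assumes I_sub_M: "I \<subseteq> M"
    and unit: "s \<in> carrier P - M \<Longrightarrow> \<theta> s \<in> Units L"
    and surj: "y \<in> carrier L \<Longrightarrow> \<exists>p\<in>carrier P. \<exists>s\<in>carrier P - M. y \<otimes>\<^bsub>L\<^esub> \<theta> s = \<theta> p"
    and ker: "p \<in> carrier P \<Longrightarrow> \<theta> p = \<zero>\<^bsub>L\<^esub> \<longleftrightarrow> (\<exists>s\<in>carrier P - M. s \<otimes> p \<in> I)"
begin

lemma denominators_mult: "s \<in> carrier P - M \<Longrightarrow> t \<in> carrier P - M \<Longrightarrow> s \<otimes> t \<in> carrier P - M"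
  using M.I_prime by blast

lemma one_denominator: "\<one> \<in> carrier P - M"
  using M.I_notcarr M.one_imp_carrier by blast

text \<open>Denominators are units, so an element lies in an ideal as soon as a multiple by a denominator does.\<close>

lemma unit_cancel:
  assumes "ideal J L" "s \<in> carrier P - M" "y \<in> carrier L" "y \<otimes>\<^bsub>L\<^esub> \<theta> s \<in> J"
  shows "y \<in> J"
proof -
  interpret J: ideal J L by fact
  have u: "\<theta> s \<in> Units L" using unit assms by blast
  have "(y \<otimes>\<^bsub>L\<^esub> \<theta> s) \<otimes>\<^bsub>L\<^esub> inv\<^bsub>L\<^esub> (\<theta> s) \<in> J"
    by (rule J.I_r_closed) (use assms u in auto)
  also have "(y \<otimes>\<^bsub>L\<^esub> \<theta> s) \<otimes>\<^bsub>L\<^esub> inv\<^bsub>L\<^esub> (\<theta> s) = y"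
    using assms u by (simp add: S.m_assoc S.Units_r_inv)
  finally show ?thesis .
qed

lemma theta_eq:
  assumes "p \<in> carrier P" "q \<in> carrier P" "\<theta> p = \<theta> q"
  obtains u where "u \<in> carrier P - M" "u \<otimes> (p \<ominus> q) \<in> I"
proof -
  have "\<theta> (p \<ominus> q) = \<zero>\<^bsub>L\<^esub>"
    using assms by (simp add: R.minus_eq hom_add hom_a_inv S.r_neg)
  then show thesis using ker[of "p \<ominus> q"] assms that by auto
qed

definition extend :: "'a set \<Rightarrow> 'c set" where
  "extend Q = {y \<in> carrier L. \<exists>p\<in>Q. \<exists>s\<in>carrier P - M. y \<otimes>\<^bsub>L\<^esub> \<theta> s = \<theta> p}"

lemma extendI:
  assumes "ideal Q P" "p \<in> Q"
  shows "\<theta> p \<in> extend Q"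
proof -
  have p: "p \<in> carrier P" using ideal.Icarr[OF assms] .
  then have "\<theta> p \<otimes>\<^bsub>L\<^esub> \<theta> \<one> = \<theta> p" by simp
  then show ?thesis
    using p assms(2) one_denominator unfolding extend_def by blast
qed

lemma extend_ideal:
  assumes "ideal Q P"
  shows "ideal (extend Q) L"
proof -
  interpret Q: ideal Q P by fact
  show ?thesis
  proof (rule idealI)
    show "ring L" by unfold_locales
    show sub: "subgroup (extend Q) (add_monoid L)"
    proof (rule S.add.subgroupI)
      show "extend Q \<subseteq> carrier L" by (auto simp: extend_def)
      show "extend Q \<noteq> {}" using extendI[OF assms] Q.zero_closed by blast
      fix x assume x: "x \<in> extend Q"
      then obtain p s where p: "x \<in> carrier L" "p \<in> Q" "s \<in> carrier P - M" "x \<otimes>\<^bsub>L\<^esub> \<theta> s = \<theta> p"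
        by (auto simp: extend_def)
      then have "(\<ominus>\<^bsub>L\<^esub> x) \<otimes>\<^bsub>L\<^esub> \<theta> s = \<theta> (\<ominus> p)"
        by (simp add: S.l_minus hom_a_inv Q.Icarr)
      then show "\<ominus>\<^bsub>L\<^esub> x \<in> extend Q"
        using p(1,3) Q.a_inv_closed[OF p(2)] unfolding extend_def by blast
      fix y assume "y \<in> extend Q"
      then obtain q t where q: "y \<in> carrier L" "q \<in> Q" "t \<in> carrier P - M" "y \<otimes>\<^bsub>L\<^esub> \<theta> t = \<theta> q"
        by (auto simp: extend_def)
      have "(x \<oplus>\<^bsub>L\<^esub> y) \<otimes>\<^bsub>L\<^esub> \<theta> (s \<otimes> t)
          = (x \<otimes>\<^bsub>L\<^esub> \<theta> s) \<otimes>\<^bsub>L\<^esub> \<theta> t \<oplus>\<^bsub>L\<^esub> (y \<otimes>\<^bsub>L\<^esub> \<theta> t) \<otimes>\<^bsub>L\<^esub> \<theta> s"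
        using p(1,3) q(1,3) by (simp add: S.l_distr S.r_distr S.m_ac)
      also have "\<dots> = \<theta> (p \<otimes> t \<oplus> q \<otimes> s)"
        unfolding p(4) q(4) using p q by (simp add: Q.Icarr)
      finally have "(x \<oplus>\<^bsub>L\<^esub> y) \<otimes>\<^bsub>L\<^esub> \<theta> (s \<otimes> t) = \<theta> (p \<otimes> t \<oplus> q \<otimes> s)" .
      moreover have "p \<otimes> t \<oplus> q \<otimes> s \<in> Q"
        using p q by (intro Q.a_closed Q.I_r_closed) auto
      ultimately show "x \<oplus>\<^bsub>L\<^esub> y \<in> extend Q"
        using denominators_mult[OF p(3) q(3)] p q unfolding extend_def by blast
    qed
    have l_closed: "y \<otimes>\<^bsub>L\<^esub> x \<in> extend Q" if x: "x \<in> extend Q" and y: "y \<in> carrier L" for x y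
    proof -
      obtain p s where p: "x \<in> carrier L" "p \<in> Q" "s \<in> carrier P - M" "x \<otimes>\<^bsub>L\<^esub> \<theta> s = \<theta> p"
        using x by (auto simp: extend_def)
      obtain q t where q: "q \<in> carrier P" "t \<in> carrier P - M" "y \<otimes>\<^bsub>L\<^esub> \<theta> t = \<theta> q"
        using surj y by blast
      have "(y \<otimes>\<^bsub>L\<^esub> x) \<otimes>\<^bsub>L\<^esub> \<theta> (s \<otimes> t) = (y \<otimes>\<^bsub>L\<^esub> \<theta> t) \<otimes>\<^bsub>L\<^esub> (x \<otimes>\<^bsub>L\<^esub> \<theta> s)"
        using p(1,3) q(1,2) y by (simp add: S.m_ac)
      also have "\<dots> = \<theta> (q \<otimes> p)"
        unfolding p(4) q(3) using p q by (simp add: Q.Icarr)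
      finally show ?thesis
        using denominators_mult[OF p(3) q(2)] p(1) y Q.I_l_closed[OF p(2) q(1)]
        unfolding extend_def by blast
    qed
    then show "y \<otimes>\<^bsub>L\<^esub> x \<in> extend Q" if "x \<in> extend Q" "y \<in> carrier L" for x y
      using that by blast
    then show "x \<otimes>\<^bsub>L\<^esub> y \<in> extend Q" if "x \<in> extend Q" "y \<in> carrier L" for x y
      using that l_closed[OF that] by (simp add: S.m_comm extend_def)
  qed
qed

lemma theta_in_extend:
  assumes "ideal Q P" "I \<subseteq> Q" "p \<in> carrier P" "\<theta> p \<in> extend Q"
  obtains u where "u \<in> carrier P - M" "u \<otimes> p \<in> Q"
proof -
  interpret Q: ideal Q P by fact
  obtain q s where q: "q \<in> Q" "s \<in> carrier P - M" "\<theta> p \<otimes>\<^bsub>L\<^esub> \<theta> s = \<theta> q"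
    using assms by (auto simp: extend_def)
  then have "\<theta> (p \<otimes> s) = \<theta> q" using assms by simp
  then obtain u where u: "u \<in> carrier P - M" "u \<otimes> (p \<otimes> s \<ominus> q) \<in> I"
    using theta_eq[of "p \<otimes> s" q] assms q Q.Icarr by auto
  have "u \<otimes> (p \<otimes> s \<ominus> q) \<oplus> u \<otimes> q \<in> Q"
    using u q assms by (intro Q.a_closed) (auto intro: Q.I_l_closed)
  also have "u \<otimes> (p \<otimes> s \<ominus> q) \<oplus> u \<otimes> q = (u \<otimes> s) \<otimes> p"
  proof -
    have c: "u \<in> carrier P" "p \<otimes> s \<in> carrier P" "q \<in> carrier P"
      using u q assms Q.Icarr by auto
    have "u \<otimes> (p \<otimes> s \<ominus> q) \<oplus> u \<otimes> q = u \<otimes> ((p \<otimes> s \<ominus> q) \<oplus> q)"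
      using c by (simp add: R.r_distr)
    also have "(p \<otimes> s \<ominus> q) \<oplus> q = p \<otimes> s"
      using c by (simp add: R.minus_eq R.a_assoc R.l_neg)
    finally show ?thesis using c q assms by (simp add: R.m_ac)
  qed
  finally show thesis using that denominators_mult[OF u(1) q(2)] by blast
qed

lemma theta_in_extend_prime:
  assumes "primeideal Q P" "I \<subseteq> Q" "Q \<subseteq> M" "p \<in> carrier P"
  shows "\<theta> p \<in> extend Q \<longleftrightarrow> p \<in> Q"
proof
  interpret Q: primeideal Q P by fact
  show "p \<in> Q" if \<theta>: "\<theta> p \<in> extend Q"
  proof -
    obtain u where "u \<in> carrier P - M" "u \<otimes> p \<in> Q"
      using theta_in_extend[OF Q.is_ideal assms(2,4) \<theta>] .
    then show ?thesis using Q.I_prime[of u p] assms by blast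
  qed
  show "p \<in> Q \<Longrightarrow> \<theta> p \<in> extend Q" by (rule extendI[OF Q.is_ideal])
qed

lemma extend_prime:
  assumes "primeideal Q P" "I \<subseteq> Q" "Q \<subseteq> M"
  shows "primeideal (extend Q) L"
proof -
  interpret Q: primeideal Q P by fact
  interpret E: ideal "extend Q" L by (rule extend_ideal[OF Q.is_ideal])
  show ?thesis
  proof (rule primeidealI[OF E.is_ideal])
    show "cring L" by unfold_locales
    show "carrier L \<noteq> extend Q"
    proof
      assume "carrier L = extend Q"
      then have "\<theta> \<one> \<in> extend Q" by (metis R.one_closed hom_closed)
      then have "\<one> \<in> Q" using theta_in_extend_prime[OF assms] by blast
      then show False using Q.one_imp_carrier Q.I_notcarr by blast
    qed
    fix x y assume xy: "x \<in> carrier L" "y \<in> carrier L" "x \<otimes>\<^bsub>L\<^esub> y \<in> extend Q"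
    obtain p s where p: "p \<in> carrier P" "s \<in> carrier P - M" "x \<otimes>\<^bsub>L\<^esub> \<theta> s = \<theta> p"
      using surj xy by blast
    obtain q t where q: "q \<in> carrier P" "t \<in> carrier P - M" "y \<otimes>\<^bsub>L\<^esub> \<theta> t = \<theta> q"
      using surj xy by blast
    have "\<theta> (p \<otimes> q) = (x \<otimes>\<^bsub>L\<^esub> \<theta> s) \<otimes>\<^bsub>L\<^esub> (y \<otimes>\<^bsub>L\<^esub> \<theta> t)"
      unfolding p(3) q(3) using p(1) q(1) by simp
    also have "\<dots> = (x \<otimes>\<^bsub>L\<^esub> y) \<otimes>\<^bsub>L\<^esub> (\<theta> s \<otimes>\<^bsub>L\<^esub> \<theta> t)" using p(1,2) q(1,2) xy by (simp add: S.m_ac)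
    also have "\<dots> \<in> extend Q" using E.I_r_closed[OF xy(3)] p(2) q(2) by auto
    finally have "p \<otimes> q \<in> Q" using theta_in_extend_prime[OF assms] p(1) q(1) by blast
    then have "p \<in> Q \<or> q \<in> Q" using Q.I_prime p q by blast
    then show "x \<in> extend Q \<or> y \<in> extend Q"
      using p q xy unfolding extend_def by blast
  qed
qed

definition contract :: "'c set \<Rightarrow> 'a set" where
  "contract Q = {p \<in> carrier P. \<theta> p \<in> Q}"

lemma contract_ideal: "ideal Q L \<Longrightarrow> ideal (contract Q) P"
  unfolding contract_def by (rule ring.ideal_vimage)

lemma I_sub_contract:
  assumes "ideal Q L" shows "I \<subseteq> contract Q"
proof
  fix p assume p: "p \<in> I"
  have "\<theta> p = \<zero>\<^bsub>L\<^esub>" using one_denominator ker[of p] p I.Icarr by (auto intro!: bexI[of _ "\<one>"])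
  then show "p \<in> contract Q"
    using p I.Icarr additive_subgroup.zero_closed[OF ideal.axioms(1)[OF assms]] by (simp add: contract_def)
qed

lemma contract_sub_M:
  assumes "ideal Q L" "Q \<noteq> carrier L" shows "contract Q \<subseteq> M"
proof
  fix p assume p: "p \<in> contract Q"
  interpret Q: ideal Q L by fact
  show "p \<in> M"
  proof (rule ccontr)
    assume "p \<notin> M"
    then have "p \<in> carrier P - M" "\<one>\<^bsub>L\<^esub> \<otimes>\<^bsub>L\<^esub> \<theta> p \<in> Q" using p by (auto simp: contract_def)
    then have "\<one>\<^bsub>L\<^esub> \<in> Q" using unit_cancel[OF assms(1)] by blast
    then show False using Q.one_imp_carrier assms(2) by blast
  qed
qed

lemma contract_prime:
  assumes "primeideal Q L" shows "primeideal (contract Q) P"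
proof -
  interpret Q: primeideal Q L by fact
  show ?thesis
  proof (rule primeidealI[OF contract_ideal[OF Q.is_ideal]])
    show "cring P" by unfold_locales
    show "carrier P \<noteq> contract Q"
      using contract_sub_M[OF Q.is_ideal] Q.I_notcarr M.I_notcarr M.a_subset by blast
    fix a b assume "a \<in> carrier P" "b \<in> carrier P" "a \<otimes> b \<in> contract Q"
    then show "a \<in> contract Q \<or> b \<in> contract Q"
      using Q.I_prime[of "\<theta> a" "\<theta> b"] by (simp add: contract_def)
  qed
qed

lemma contract_strict_mono:
  assumes "ideal Q L" "ideal Q' L" "Q \<subset> Q'" shows "contract Q \<subset> contract Q'"
proof -
  interpret Q': ideal Q' L by fact
  obtain y where y: "y \<in> Q'" "y \<notin> Q" using assms by blast
  then have yL: "y \<in> carrier L" by (simp add: Q'.Icarr)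
  obtain p s where p: "p \<in> carrier P" "s \<in> carrier P - M" "y \<otimes>\<^bsub>L\<^esub> \<theta> s = \<theta> p"
    using surj yL by blast
  have "\<theta> p \<in> Q'" using Q'.I_r_closed[OF y(1), of "\<theta> s"] p by auto
  moreover have "\<theta> p \<notin> Q" using unit_cancel[OF assms(1) p(2) yL] p(3) y by metis
  ultimately show ?thesis using assms(3) p(1) by (auto simp: contract_def)
qed

text \<open>Contraction and extension identify the primes of \<open>L\<close> with the primes of \<open>P\<close> between \<open>I\<close> and \<open>M\<close>.\<close>

lemma krull_dim_eq:
  "krull_dim L = Sup {enat n | n. \<exists>Q. (\<forall>i\<le>n. primeideal (Q i) P \<and> I \<subseteq> Q i \<and> Q i \<subseteq> M) \<and> (\<forall>i<n. Q i \<subset> Q (Suc i))}"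
proof -
  have "(\<exists>Q. (\<forall>i\<le>n. primeideal (Q i) L) \<and> (\<forall>i<n. Q i \<subset> Q (Suc i))) \<longleftrightarrow>
      (\<exists>Q. (\<forall>i\<le>n. primeideal (Q i) P \<and> I \<subseteq> Q i \<and> Q i \<subseteq> M) \<and> (\<forall>i<n. Q i \<subset> Q (Suc i)))" for n
  proof
    assume "\<exists>Q. (\<forall>i\<le>n. primeideal (Q i) L) \<and> (\<forall>i<n. Q i \<subset> Q (Suc i))"
    then obtain Q where Q: "\<And>i. i \<le> n \<Longrightarrow> primeideal (Q i) L" "\<And>i. i < n \<Longrightarrow> Q i \<subset> Q (Suc i)" by blast
    then have id: "ideal (Q i) L" "Q i \<noteq> carrier L" if "i \<le> n" for i
      using primeideal.axioms(1) primeideal.I_notcarr that by metis+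
    show "\<exists>Q. (\<forall>i\<le>n. primeideal (Q i) P \<and> I \<subseteq> Q i \<and> Q i \<subseteq> M) \<and> (\<forall>i<n. Q i \<subset> Q (Suc i))"
      using Q id contract_prime I_sub_contract contract_sub_M contract_strict_mono
      by (intro exI[of _ "\<lambda>i. contract (Q i)"]) simp
  next
    assume "\<exists>Q. (\<forall>i\<le>n. primeideal (Q i) P \<and> I \<subseteq> Q i \<and> Q i \<subseteq> M) \<and> (\<forall>i<n. Q i \<subset> Q (Suc i))"
    then obtain Q where Q: "\<And>i. i \<le> n \<Longrightarrow> primeideal (Q i) P" "\<And>i. i \<le> n \<Longrightarrow> I \<subseteq> Q i"
        "\<And>i. i \<le> n \<Longrightarrow> Q i \<subseteq> M" "\<And>i. i < n \<Longrightarrow> Q i \<subset> Q (Suc i)" by blast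
    have "extend (Q i) \<subset> extend (Q (Suc i))" if i: "i < n" for i
    proof -
      obtain p where p: "p \<in> Q (Suc i)" "p \<notin> Q i" using Q(4)[OF i] by blast
      have pP: "p \<in> carrier P"
        using p(1) ideal.Icarr[OF primeideal.axioms(1)[OF Q(1)[of "Suc i"]]] i by simp
      have "extend (Q i) \<subseteq> extend (Q (Suc i))" using Q(4)[OF i] by (auto simp: extend_def)
      moreover have "\<theta> p \<in> extend (Q (Suc i))" "\<theta> p \<notin> extend (Q i)"
        using theta_in_extend_prime[OF Q(1,2,3) pP] p i by auto
      ultimately show ?thesis by blast
    qed
    then show "\<exists>Q. (\<forall>i\<le>n. primeideal (Q i) L) \<and> (\<forall>i<n. Q i \<subset> Q (Suc i))"
      using Q extend_prime by (intro exI[of _ "\<lambda>i. extend (Q i)"]) simp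
  qed
  then show ?thesis unfolding krull_dim_def by simp
qed

lemma proper_sub_extend_M:
  assumes "ideal Q L" "Q \<noteq> carrier L" shows "Q \<subseteq> extend M"
proof
  fix y assume y: "y \<in> Q"
  interpret Q: ideal Q L by fact
  obtain p s where p: "p \<in> carrier P" "s \<in> carrier P - M" "y \<otimes>\<^bsub>L\<^esub> \<theta> s = \<theta> p"
    using surj y Q.Icarr by blast
  have "\<theta> p \<in> Q" using Q.I_r_closed[OF y, of "\<theta> s"] p by auto
  then have "p \<in> M" using contract_sub_M[OF assms] p by (auto simp: contract_def)
  then show "y \<in> extend M" using p y Q.Icarr by (auto simp: extend_def)
qed

lemma maximalideal_iff: "maximalideal Q L \<longleftrightarrow> Q = extend M"
proof
  interpret E: primeideal "extend M" L
    by (rule extend_prime) (use M.primeideal I_sub_M in auto)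
  show "Q = extend M" if Q: "maximalideal Q L"
    using maximalideal.I_maximal[OF Q E.is_ideal] E.a_subset E.I_notcarr
      proper_sub_extend_M[OF maximalideal.axioms(1)[OF Q]] maximalideal.I_notcarr[OF Q] by metis
  show "maximalideal Q L" if "Q = extend M"
    unfolding that using E.is_ideal E.I_notcarr proper_sub_extend_M by (intro maximalidealI) auto
qed

lemma local_ring: "local_ring L"
  unfolding local_ring_def maximalideal_iff by (auto intro: S.is_cring)

lemma max_ideal_eq: "max_ideal L = extend M"
  unfolding max_ideal_def maximalideal_iff by simp

lemma noetherian:
  assumes "noetherian_ring P" shows "noetherian_ring L"
proof (rule S.noetherian_ringI)
  fix Q assume Q: "ideal Q L"
  interpret Q: ideal Q L by fact
  obtain A where A: "A \<subseteq> carrier P" "finite A" "contract Q = genideal P A"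
    using noetherian_ring.finetely_gen[OF assms contract_ideal[OF Q]] by blast
  have AL: "\<theta> ` A \<subseteq> carrier L" using A(1) by auto
  have G: "ideal (genideal L (\<theta> ` A)) L" by (rule S.genideal_ideal[OF AL])
  have "genideal P A \<subseteq> contract (genideal L (\<theta> ` A))"
    by (rule R.genideal_minimal[OF contract_ideal[OF G]])
       (use A(1) S.genideal_self[OF AL] in \<open>auto simp: contract_def\<close>)
  then have sub: "contract Q \<subseteq> contract (genideal L (\<theta> ` A))" by (simp add: A(3))
  have "Q = genideal L (\<theta> ` A)"
  proof
    show "genideal L (\<theta> ` A) \<subseteq> Q"
      by (rule S.genideal_minimal[OF Q]) (use A R.genideal_self[OF A(1)] in \<open>auto simp: contract_def\<close>)
    show "Q \<subseteq> genideal L (\<theta> ` A)"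
    proof
      fix y assume y: "y \<in> Q"
      then have yL: "y \<in> carrier L" by (rule Q.Icarr)
      obtain p s where p: "p \<in> carrier P" "s \<in> carrier P - M" "y \<otimes>\<^bsub>L\<^esub> \<theta> s = \<theta> p"
        using surj yL by blast
      have "\<theta> p \<in> Q" using Q.I_r_closed[OF y, of "\<theta> s"] p by auto
      then have "\<theta> p \<in> genideal L (\<theta> ` A)" using sub p(1) by (auto simp: contract_def)
      then show "y \<in> genideal L (\<theta> ` A)" using unit_cancel[OF G p(2) yL] p(3) by metis
    qed
  qed
  then show "\<exists>A\<subseteq>carrier L. finite A \<and> Q = genideal L A"
    using AL A(2) by blast
qed

lemma extend_M_generated:
  assumes G: "G \<subseteq> M"
    and gen: "\<And>p. p \<in> M \<Longrightarrow> \<exists>u\<in>carrier P - M. u \<otimes> p \<in> genideal P (G \<union> I)"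
  shows "genideal L (\<theta> ` G) = extend M"
proof
  have GP: "G \<subseteq> carrier P" using G M.a_subset by blast
  have GL: "\<theta> ` G \<subseteq> carrier L" using GP by auto
  have Gid: "ideal (genideal L (\<theta> ` G)) L" by (rule S.genideal_ideal[OF GL])
  show "genideal L (\<theta> ` G) \<subseteq> extend M"
    by (rule S.genideal_minimal[OF extend_ideal[OF M.is_ideal]]) (use G extendI[OF M.is_ideal] in auto)
  have sub: "genideal P (G \<union> I) \<subseteq> contract (genideal L (\<theta> ` G))"
    by (rule R.genideal_minimal[OF contract_ideal[OF Gid]])
       (use GP S.genideal_self[OF GL] I_sub_contract[OF Gid] in \<open>auto simp: contract_def\<close>)
  show "extend M \<subseteq> genideal L (\<theta> ` G)"
  proof
    fix y assume "y \<in> extend M"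
    then obtain p s where p: "y \<in> carrier L" "p \<in> M" "s \<in> carrier P - M" "y \<otimes>\<^bsub>L\<^esub> \<theta> s = \<theta> p"
      by (auto simp: extend_def)
    obtain u where u: "u \<in> carrier P - M" "u \<otimes> p \<in> genideal P (G \<union> I)" using gen[OF p(2)] by blast
    have "\<theta> (u \<otimes> p) \<in> genideal L (\<theta> ` G)" using sub u(2) by (auto simp: contract_def)
    also have "\<theta> (u \<otimes> p) = y \<otimes>\<^bsub>L\<^esub> \<theta> (s \<otimes> u)"
      using p u M.Icarr by (simp add: S.m_ac flip: p(4))
    finally show "y \<in> genideal L (\<theta> ` G)"
      using unit_cancel[OF Gid denominators_mult[OF p(3) u(1)] p(1)] by blast
  qed
qed

text \<open>A finite generating system of the maximal ideal of \<open>L\<close> consists, up to units, of images of elements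
of \<open>M\<close>.\<close>

lemma generators_lift:
  assumes G: "finite G" "G \<subseteq> carrier L" "genideal L G = extend M"
  obtains H where "H \<subseteq> M" "finite H" "card H \<le> card G"
    "\<And>p. p \<in> M \<Longrightarrow> \<exists>u\<in>carrier P - M. u \<otimes> p \<in> genideal P (H \<union> I)"
proof -
  have "\<forall>g\<in>G. \<exists>p\<in>M. \<exists>s\<in>carrier P - M. g \<otimes>\<^bsub>L\<^esub> \<theta> s = \<theta> p"
    using S.genideal_self[OF G(2)] G(3) by (auto simp: extend_def)
  then obtain f where f: "\<And>g. g \<in> G \<Longrightarrow> f g \<in> M" "\<And>g. g \<in> G \<Longrightarrow> \<exists>s\<in>carrier P - M. g \<otimes>\<^bsub>L\<^esub> \<theta> s = \<theta> (f g)"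
    by metis
  let ?H = "f ` G" let ?J = "genideal P (f ` G \<union> I)"
  have HI: "?H \<union> I \<subseteq> carrier P" using f(1) M.a_subset I.a_subset by blast
  have J: "ideal ?J P" by (rule R.genideal_ideal[OF HI])
  have HJ: "?H \<union> I \<subseteq> ?J" by (rule R.genideal_self[OF HI])
  have "genideal L G \<subseteq> extend ?J"
    by (rule S.genideal_minimal[OF extend_ideal[OF J]]) (use f(2) HJ G(2) in \<open>unfold extend_def, blast\<close>)
  then have sub: "extend M \<subseteq> extend ?J" by (simp add: G(3))
  show thesis
  proof (rule that)
    show "?H \<subseteq> M" "finite ?H" "card ?H \<le> card G" using f(1) G(1) card_image_le by auto
    fix p assume p: "p \<in> M"
    then have "\<theta> p \<in> extend ?J" using extendI[OF M.is_ideal] sub by blast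
    then show "\<exists>u\<in>carrier P - M. u \<otimes> p \<in> ?J"
      using theta_in_extend[OF J _ M.Icarr[OF p]] HJ by blast
  qed
qed

end

text \<open>The cosets outside of \<open>M/I\<close> are the cosets of elements outside of \<open>M\<close>, since \<open>I \<subseteq> M\<close>.\<close>

theorem localization_at_quotient:
  assumes "cring P" "ideal I P" "primeideal M P" "I \<subseteq> M"
  shows "localization_at P (localize_at (P Quot I) ((\<lambda>p. I +>\<^bsub>P\<^esub> p) ` M))
    (\<lambda>p. frac_class (P Quot I) (carrier (P Quot I) - (\<lambda>p. I +>\<^bsub>P\<^esub> p) ` M) (I +>\<^bsub>P\<^esub> p) \<one>\<^bsub>P Quot I\<^esub>) M I"
proof -
  interpret P: cring P by fact
  interpret I: ideal I P by fact
  interpret M: primeideal M P by fact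
  interpret Q: ring_hom_cring P "P Quot I" "(+>\<^bsub>P\<^esub>) I"
    by (rule I.rcos_ring_hom_cring) fact
  define S where "S = carrier (P Quot I) - (\<lambda>p. I +>\<^bsub>P\<^esub> p) ` M"
  have eqI: "p \<ominus>\<^bsub>P\<^esub> q \<in> I" if "p \<in> carrier P" "q \<in> carrier P" "I +>\<^bsub>P\<^esub> p = I +>\<^bsub>P\<^esub> q" for p q
    using that P.quotient_eq_iff_same_a_r_cos[OF I.is_ideal] by blast
  have zero: "I +>\<^bsub>P\<^esub> p = \<zero>\<^bsub>P Quot I\<^esub> \<longleftrightarrow> p \<in> I" if "p \<in> carrier P" for p
  proof -
    have "I +>\<^bsub>P\<^esub> p = I \<longleftrightarrow> p \<in> I"
      using that I.rcos_const_imp_mem P.a_rcos_zero[OF assms(2)] by blast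
    moreover have "\<zero>\<^bsub>P Quot I\<^esub> = I" unfolding FactRing_def by simp
    ultimately show ?thesis by metis
  qed
  have memM: "I +>\<^bsub>P\<^esub> p \<in> (\<lambda>p. I +>\<^bsub>P\<^esub> p) ` M \<longleftrightarrow> p \<in> M" if p: "p \<in> carrier P" for p
  proof
    assume "I +>\<^bsub>P\<^esub> p \<in> (\<lambda>p. I +>\<^bsub>P\<^esub> p) ` M"
    then obtain q where q: "q \<in> M" "I +>\<^bsub>P\<^esub> p = I +>\<^bsub>P\<^esub> q" by blast
    have qP: "q \<in> carrier P" using q M.Icarr by blast
    then have "p \<ominus>\<^bsub>P\<^esub> q \<in> M" using eqI[OF p qP q(2)] assms(4) by blast
    then have "(p \<ominus>\<^bsub>P\<^esub> q) \<oplus>\<^bsub>P\<^esub> q \<in> M" using q by (intro M.a_closed)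
    also have "(p \<ominus>\<^bsub>P\<^esub> q) \<oplus>\<^bsub>P\<^esub> q = p"
      using p qP by (simp add: P.minus_eq P.a_assoc P.l_neg)
    finally show "p \<in> M" .
  qed blast
  have carr: "\<exists>p\<in>carrier P. x = I +>\<^bsub>P\<^esub> p" if "x \<in> carrier (P Quot I)" for x
    using that unfolding FactRing_def A_RCOSETS_def' by auto
  have S_iff: "I +>\<^bsub>P\<^esub> p \<in> S \<longleftrightarrow> p \<notin> M" if "p \<in> carrier P" for p
    using that memM by (auto simp: S_def)
  have SE: "\<exists>p\<in>carrier P - M. x = I +>\<^bsub>P\<^esub> p" if "x \<in> S" for x
    using carr[of x] that S_iff by (auto simp: S_def)
  have one: "\<one>\<^bsub>P\<^esub> \<notin> M" using M.I_notcarr M.one_imp_carrier by blast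
  interpret S: multiplicative_set "P Quot I" S
  proof
    show "S \<subseteq> carrier (P Quot I)" by (auto simp: S_def)
    show "\<one>\<^bsub>P Quot I\<^esub> \<in> S" using S_iff[of "\<one>\<^bsub>P\<^esub>"] one by simp
    fix s t assume "s \<in> S" "t \<in> S"
    then obtain p q where "p \<in> carrier P - M" "s = I +>\<^bsub>P\<^esub> p" "q \<in> carrier P - M" "t = I +>\<^bsub>P\<^esub> q"
      using SE by metis
    then show "s \<otimes>\<^bsub>P Quot I\<^esub> t \<in> S"
      using S_iff[of "p \<otimes>\<^bsub>P\<^esub> q"] M.I_prime[of p q] by auto
  qed
  let ?L = "localization (P Quot I) S"
  let ?\<theta> = "\<lambda>p. frac_class (P Quot I) S (I +>\<^bsub>P\<^esub> p) \<one>\<^bsub>P Quot I\<^esub>"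
  have hom: "?\<theta> \<in> ring_hom P ?L"
    using ring_hom_trans[OF Q.homh S.frac_hom] by (simp add: o_def)
  have "localization_at P ?L ?\<theta> M I"
  proof (intro localization_at.intro localization_at_axioms.intro ring_hom_cring.intro ring_hom_cring_axioms.intro)
    show "cring ?L" by (rule S.localization_cring)
    show "I \<subseteq> M" by fact
    show "?\<theta> s \<in> Units ?L" if "s \<in> carrier P - M" for s
      using S.frac_unit S_iff that by blast
    show "\<exists>p\<in>carrier P. \<exists>s\<in>carrier P - M. y \<otimes>\<^bsub>?L\<^esub> ?\<theta> s
        = ?\<theta> p" if y: "y \<in> carrier ?L" for y
    proof -
      obtain x s where "x \<in> carrier (P Quot I)" "s \<in> S" "y = frac_class (P Quot I) S x s"
        using S.carrier_locE[OF y] .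
      then show ?thesis using carr[of x] SE[of s] S.frac_times_denominator by metis
    qed
    show "?\<theta> p = \<zero>\<^bsub>?L\<^esub> \<longleftrightarrow> (\<exists>s\<in>carrier P - M. s \<otimes>\<^bsub>P\<^esub> p \<in> I)"
      if p: "p \<in> carrier P" for p
    proof -
      have "?\<theta> p = \<zero>\<^bsub>?L\<^esub>
          \<longleftrightarrow> (\<exists>s\<in>carrier P - M. (I +>\<^bsub>P\<^esub> s) \<otimes>\<^bsub>P Quot I\<^esub> (I +>\<^bsub>P\<^esub> p) = \<zero>\<^bsub>P Quot I\<^esub>)"
        using S.frac_eq_zero_iff[of "I +>\<^bsub>P\<^esub> p"] p SE S_iff by (metis DiffD1 DiffD2 Q.hom_closed)
      also have "\<dots> \<longleftrightarrow> (\<exists>s\<in>carrier P - M. s \<otimes>\<^bsub>P\<^esub> p \<in> I)"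
        by (rule bex_cong) (use p zero in \<open>auto simp flip: Q.hom_mult\<close>)
      finally show ?thesis .
    qed
  qed (use hom assms in \<open>auto simp: P.is_cring\<close>)
  then show ?thesis by (simp add: localize_at_def S_def)
qed


section \<open>Values and derivatives at a zero point\<close>

text \<open>Some linear order on the variables is needed for a term order, and for the polynomial ring to be
recognized as a domain.\<close>

instantiation pvar :: linorder
begin

primrec pvar_code :: "pvar \<Rightarrow> nat" where
  "pvar_code (Par i) = 2 * i"
| "pvar_code (Ind j) = 2 * j + 1"

definition less_eq_pvar :: "pvar \<Rightarrow> pvar \<Rightarrow> bool" where
  "u \<le> v \<longleftrightarrow> pvar_code u \<le> pvar_code v"

definition less_pvar :: "pvar \<Rightarrow> pvar \<Rightarrow> bool" where
  "u < v \<longleftrightarrow> pvar_code u < pvar_code v"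

instance
proof
  fix u v :: pvar
  show "u \<le> v \<Longrightarrow> v \<le> u \<Longrightarrow> u = v"
    by (cases u; cases v) (auto simp: less_eq_pvar_def, presburger+)
qed (auto simp: less_eq_pvar_def less_pvar_def)

end

text \<open>Moving \<open>\<Gamma>\<^sub>0\<close> to the origin makes the value and the partial derivatives at \<open>\<Gamma>\<^sub>0\<close> coefficients.\<close>

primrec translate_var :: "(nat \<Rightarrow> 'a) \<Rightarrow> pvar \<Rightarrow> (pvar, 'a::field) mpoly" where
  "translate_var \<Gamma> (Par i) = mvar (Par i) + mconst (\<Gamma> i)"
| "translate_var \<Gamma> (Ind j) = mvar (Ind j)"

definition eval_at :: "(nat \<Rightarrow> 'a) \<Rightarrow> (pvar, 'a::field) mpoly \<Rightarrow> 'a" where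
  "eval_at \<Gamma> p = lookup (msubst (translate_var \<Gamma>) p) 0"

definition deriv_at :: "(nat \<Rightarrow> 'a) \<Rightarrow> pvar \<Rightarrow> (pvar, 'a::field) mpoly \<Rightarrow> 'a" where
  "deriv_at \<Gamma> v p = lookup (msubst (translate_var \<Gamma>) p) (single v 1)"

lemma single_var_neq_0 [simp]: "single v (Suc 0) \<noteq> 0" "0 \<noteq> single v (Suc 0)"
  by (metis lookup_single_eq lookup_zero nat.simps(3))+

lemma single_var_eq_iff [simp]: "single u (Suc 0) = single v (Suc 0) \<longleftrightarrow> u = v"
  by (metis lookup_single_eq lookup_single_not_eq nat.simps(3))

lemma lookup_mvar: "lookup (mvar u) t = (if t = single u 1 then 1 else 0)"
  by (auto simp: mvar_def lookup_single)

lemma lookup_mconst: "lookup (mconst c) t = (if t = 0 then c else 0)"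
  by (auto simp: mconst_def lookup_single)

lemma eval_at_add: "eval_at \<Gamma> (p + q) = eval_at \<Gamma> p + eval_at \<Gamma> q"
  and eval_at_diff: "eval_at \<Gamma> (p - q) = eval_at \<Gamma> p - eval_at \<Gamma> q"
  and eval_at_mult: "eval_at \<Gamma> (p * q) = eval_at \<Gamma> p * eval_at \<Gamma> q"
  and eval_at_mconst [simp]: "eval_at \<Gamma> (mconst c) = c"
  and eval_at_0 [simp]: "eval_at \<Gamma> 0 = 0"
  by (simp_all add: eval_at_def msubst_add msubst_diff msubst_mult lookup_add lookup_minus lookup_mult_0 lookup_mconst)

lemma eval_at_1 [simp]: "eval_at \<Gamma> 1 = 1"
  using eval_at_mconst[of \<Gamma> 1] by simp

lemma eval_at_Par [simp]: "eval_at \<Gamma> (mvar (Par i)) = \<Gamma> i"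
  and eval_at_Ind [simp]: "eval_at \<Gamma> (mvar (Ind j)) = 0"
  by (simp_all add: eval_at_def lookup_add lookup_mconst lookup_mvar)

lemma eval_at_power: "eval_at \<Gamma> (p ^ n) = eval_at \<Gamma> p ^ n"
  by (induction n) (simp_all add: eval_at_mult)

lemma deriv_at_add: "deriv_at \<Gamma> v (p + q) = deriv_at \<Gamma> v p + deriv_at \<Gamma> v q"
  and deriv_at_diff: "deriv_at \<Gamma> v (p - q) = deriv_at \<Gamma> v p - deriv_at \<Gamma> v q"
  and deriv_at_mult: "deriv_at \<Gamma> v (p * q) = deriv_at \<Gamma> v p * eval_at \<Gamma> q + eval_at \<Gamma> p * deriv_at \<Gamma> v q"
  and deriv_at_mconst [simp]: "deriv_at \<Gamma> v (mconst c) = 0"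
  and deriv_at_0 [simp]: "deriv_at \<Gamma> v 0 = 0"
  by (simp_all add: deriv_at_def eval_at_def msubst_add msubst_diff msubst_mult lookup_add lookup_minus
      lookup_mult_var[unfolded One_nat_def] lookup_mconst)

lemma deriv_at_mvar [simp]: "deriv_at \<Gamma> v (mvar u) = (if u = v then 1 else 0)"
  by (cases u) (auto simp: deriv_at_def lookup_add lookup_mconst lookup_mvar)

lemma deriv_at_sum: "deriv_at \<Gamma> v (sum f X) = (\<Sum>x\<in>X. deriv_at \<Gamma> v (f x))"
  by (induction X rule: infinite_finite_induct) (simp_all add: deriv_at_add)

primrec zero_section_var :: "pvar \<Rightarrow> (pvar, 'a::field) mpoly" where
  "zero_section_var (Par i) = mvar (Par i)"
| "zero_section_var (Ind j) = 0"

abbreviation zsec :: "(pvar, 'a::field) mpoly \<Rightarrow> (pvar, 'a) mpoly" where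
  "zsec \<equiv> msubst zero_section_var"

lemma eval_at_zsec: "eval_at \<Gamma> (zsec p) = eval_at \<Gamma> p"
  using carrier_mpoly_ring_UNIV[of p]
proof (induction p rule: mpoly_ring_induct)
  case (var v)
  then show ?case by (cases v) auto
qed (auto simp: msubst_add msubst_mult eval_at_add eval_at_mult)

text \<open>Derivatives along the zero section only see the restriction to it; so parameter derivatives vanish
on \<open>I\<close>, which restricts to \<open>0\<close>.\<close>

lemma deriv_at_Par_zsec: "deriv_at \<Gamma> (Par i) (zsec p) = deriv_at \<Gamma> (Par i) p"
  using carrier_mpoly_ring_UNIV[of p]
proof (induction p rule: mpoly_ring_induct)
  case (var v)
  then show ?case by (cases v) auto
qed (auto simp: msubst_add msubst_mult deriv_at_add deriv_at_mult eval_at_zsec)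

definition param_only :: "(pvar \<Rightarrow>\<^sub>0 nat) \<Rightarrow> bool" where
  "param_only t \<longleftrightarrow> (\<forall>j. lookup t (Ind j) = 0)"

definition linear_in :: "nat \<Rightarrow> (pvar \<Rightarrow>\<^sub>0 nat) \<Rightarrow> bool" where
  "linear_in i t \<longleftrightarrow> lookup t (Ind i) = 1 \<and> (\<forall>j. j \<noteq> i \<longrightarrow> lookup t (Ind j) = 0)"

text \<open>The coefficient of \<open>x\<^sub>i\<close>, an element of \<open>A\<close>, when a polynomial is read as a polynomial in \<open>X\<close> over \<open>A\<close>.\<close>

definition lincoef :: "nat \<Rightarrow> (pvar, 'a::field) mpoly \<Rightarrow> (pvar, 'a) mpoly" where
  "lincoef i = poly.lin_ext
     (\<lambda>t. if linear_in i t then single (t - single (Ind i) 1) 1 else 0)"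

lemma mon_zero_section:
  "mon zero_section_var t = (if param_only t then single t (1::'a::field) else 0)"
proof (cases "param_only t")
  case True
  have "mon zero_section_var t = (mon mvar t :: (pvar, 'a) mpoly)"
    unfolding mon_def
  proof (rule prod.cong[OF refl])
    fix v assume "v \<in> keys t"
    with True obtain i where "v = Par i"
      by (cases v) (auto simp: param_only_def in_keys_iff)
    then show "zero_section_var v ^ lookup t v = (mvar v :: (pvar, 'a) mpoly) ^ lookup t v" by simp
  qed
  with True show ?thesis by (simp add: single_eq_mon)
next
  case False
  then obtain j where "lookup t (Ind j) \<noteq> 0" by (auto simp: param_only_def)
  then have "\<exists>v\<in>keys t. zero_section_var v ^ lookup t v = (0 :: (pvar, 'a) mpoly)"
    by (intro bexI[of _ "Ind j"]) (auto simp: in_keys_iff)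
  then have "mon zero_section_var t = (0 :: (pvar, 'a) mpoly)"
    unfolding mon_def by (intro prod_zero) auto
  with False show ?thesis by simp
qed

lemma linear_in_add: "linear_in i (s + t) \<longleftrightarrow> linear_in i s \<and> param_only t \<or> param_only s \<and> linear_in i t"
  (is "?l \<longleftrightarrow> ?r")
proof
  assume l: ?l
  then have i: "lookup s (Ind i) + lookup t (Ind i) = 1"
    and other: "\<And>j. j \<noteq> i \<Longrightarrow> lookup s (Ind j) = 0 \<and> lookup t (Ind j) = 0"
    by (auto simp: linear_in_def lookup_add)
  show ?r
  proof (cases "lookup s (Ind i) = 0")
    case True
    then have "lookup s (Ind j) = 0" for j using other[of j] by (cases "j = i") auto
    then show ?r using True i other by (simp add: linear_in_def param_only_def)
  next
    case False
    with i have st: "lookup s (Ind i) = 1" "lookup t (Ind i) = 0" by simp_all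
    then have "lookup t (Ind j) = 0" for j using other[of j] by (cases "j = i") auto
    then show ?r using st other by (simp add: linear_in_def param_only_def)
  qed
qed (auto simp: linear_in_def param_only_def lookup_add)

lemma linear_in_not_param_only: "linear_in i t \<Longrightarrow> \<not> param_only t"
  unfolding linear_in_def param_only_def by (metis zero_neq_one)

lemma linear_in_split:
  assumes "linear_in i t"
  shows "t = (t - single (Ind i) 1) + single (Ind i) 1"
    and "param_only (t - single (Ind i) 1)"
proof -
  show "t = (t - single (Ind i) 1) + single (Ind i) 1"
    using assms by (intro poly_mapping_eqI) (auto simp: linear_in_def lookup_minus lookup_add lookup_single when_def)
  have "lookup t (Ind j) = (if j = i then 1 else 0)" for j
    using assms by (simp add: linear_in_def)
  then show "param_only (t - single (Ind i) 1)"
    by (simp add: param_only_def lookup_minus lookup_single when_def)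
qed

lemma linear_in_minus_add:
  assumes "linear_in i s"
  shows "s + t - single (Ind i) 1 = (s - single (Ind i) 1) + t"
  using assms by (intro poly_mapping_eqI) (auto simp: linear_in_def lookup_minus lookup_add lookup_single when_def)

text \<open>\<open>lincoef i\<close> is the derivative in the direction of \<open>x\<^sub>i\<close> along the zero section.\<close>

lemma lincoef_mult: "lincoef i (p * q) = lincoef i p * zsec q + zsec p * lincoef i q"
  unfolding lincoef_def msubst_eq_lin_ext
proof (rule poly.lin_ext_leibniz)
  fix s t :: "pvar \<Rightarrow>\<^sub>0 nat"
  let ?e = "single (Ind i) 1"
  let ?\<phi> = "\<lambda>t. if linear_in i t then single (t - ?e) 1 else (0 :: (pvar, 'a) mpoly)"
  consider "linear_in i s" "param_only t" | "param_only s" "linear_in i t" | "\<not> linear_in i (s + t)"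
    using linear_in_add by blast
  then show "?\<phi> (s + t) = ?\<phi> s * mon zero_section_var t + mon zero_section_var s * ?\<phi> t"
  proof cases
    case 1
    then show ?thesis
      using linear_in_not_param_only[of i s] linear_in_minus_add[of i s t]
      by (simp add: mon_zero_section linear_in_add mult_single)
  next
    case 2
    then show ?thesis
      using linear_in_not_param_only[of i t] linear_in_minus_add[of i t s]
      by (simp add: mon_zero_section linear_in_add mult_single add.commute)
  next
    case 3
    then show ?thesis by (auto simp: mon_zero_section linear_in_add)
  qed
qed

lemma lincoef_0 [simp]: "lincoef i 0 = 0"
  and lincoef_add: "lincoef i (p + q) = lincoef i p + lincoef i q"
  and lincoef_diff: "lincoef i (p - q) = lincoef i p - lincoef i q"
  by (simp_all add: lincoef_def poly.lin_ext_add poly.lin_ext_diff)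

lemma lincoef_mconst [simp]: "lincoef i (mconst c) = 0"
  by (simp add: lincoef_def mconst_def[of c] linear_in_def)

lemma lincoef_mvar [simp]: "lincoef i (mvar v) = (if v = Ind i then 1 else 0)"
  by (auto simp: lincoef_def mvar_def linear_in_def lookup_single when_def)

lemma lincoef_sum: "lincoef i (sum f X) = (\<Sum>x\<in>X. lincoef i (f x))"
  by (induction X rule: infinite_finite_induct) (simp_all add: lincoef_add)

lemma zsec_param: "a \<in> carrier (A_ring m) \<Longrightarrow> zsec a = a"
  unfolding A_ring_def by (erule msubst_ident) auto

lemma lincoef_param: "a \<in> carrier (A_ring m) \<Longrightarrow> lincoef i a = 0"
  unfolding A_ring_def by (induction a rule: mpoly_ring_induct) (auto simp: lincoef_add lincoef_mult)

lemma lincoef_param_mult: "a \<in> carrier (A_ring m) \<Longrightarrow> lincoef i (a * p) = a * lincoef i p"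
  by (simp add: lincoef_mult zsec_param lincoef_param)

lemma lincoef_closed:
  assumes "p \<in> carrier (P_ring m k)" shows "lincoef i p \<in> carrier (A_ring m)"
proof -
  have z: "zsec q \<in> carrier (A_ring m)" if "q \<in> carrier (P_ring m k)" for q :: "(pvar, 'a) mpoly"
    using that unfolding P_ring_def A_ring_def by (rule msubst_closed) auto
  show ?thesis
    using assms z unfolding P_ring_def A_ring_def
    by (induction p rule: mpoly_ring_induct) (auto simp: lincoef_add lincoef_mult)
qed

lemma eval_at_lincoef: "eval_at \<Gamma> (lincoef i p) = deriv_at \<Gamma> (Ind i) p"
  using carrier_mpoly_ring_UNIV[of p]
  by (induction p rule: mpoly_ring_induct)
     (auto simp: lincoef_add lincoef_mult eval_at_add eval_at_mult eval_at_zsec deriv_at_add deriv_at_mult)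

abbreviation spec :: "(nat \<Rightarrow> 'a) \<Rightarrow> (pvar, 'a::field) mpoly \<Rightarrow> (pvar, 'a) mpoly" where
  "spec \<Gamma> \<equiv> msubst (specialize_var \<Gamma>)"

lemma eval_at_spec: "eval_at \<Gamma> (spec \<Gamma> p) = eval_at \<Gamma> p"
  using carrier_mpoly_ring_UNIV[of p]
proof (induction p rule: mpoly_ring_induct)
  case (var v)
  then show ?case by (cases v) auto
qed (auto simp: msubst_add msubst_mult eval_at_add eval_at_mult)

lemma deriv_at_Ind_spec: "deriv_at \<Gamma> (Ind j) (spec \<Gamma> p) = deriv_at \<Gamma> (Ind j) p"
  using carrier_mpoly_ring_UNIV[of p]
proof (induction p rule: mpoly_ring_induct)
  case (var v)
  then show ?case by (cases v) auto
qed (auto simp: msubst_add msubst_mult deriv_at_add deriv_at_mult eval_at_spec)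

lemma zsec_spec: "zsec (spec \<Gamma> p) = spec \<Gamma> (zsec p)"
  unfolding msubst_msubst
  by (rule arg_cong[of _ _ "\<lambda>\<sigma>. msubst \<sigma> p"], rule ext, rename_tac v, case_tac v) auto

lemma spec_param: "a \<in> carrier (A_ring m) \<Longrightarrow> spec \<Gamma> a = mconst (eval_at \<Gamma> a)"
  unfolding A_ring_def
  by (induction a rule: mpoly_ring_induct)
     (auto simp: msubst_add msubst_mult eval_at_add eval_at_mult mconst_add mconst_mult)

lemma A_sub_P: "carrier (A_ring m) \<subseteq> carrier (P_ring m k)"
  unfolding A_ring_def P_ring_def by (rule mpoly_ring_mono) blast

lemma KX_eq_P: "KX_ring k = P_ring 0 k"
  by (simp add: KX_ring_def P_ring_def)

lemma KX_sub_P: "carrier (KX_ring k) \<subseteq> carrier (P_ring m k)"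
  unfolding KX_ring_def P_ring_def by (rule mpoly_ring_mono) blast

lemma spec_closed: "p \<in> carrier (P_ring m k) \<Longrightarrow> spec \<Gamma> p \<in> carrier (KX_ring k)"
  unfolding KX_ring_def P_ring_def by (erule msubst_closed) auto

lemma spec_ident: "p \<in> carrier (KX_ring k) \<Longrightarrow> spec \<Gamma> p = p"
  unfolding KX_ring_def by (erule msubst_ident) auto


section \<open>Weighted homogeneous polynomials\<close>

lemma wdeg_superset:
  assumes "finite T" "keys t \<subseteq> T"
  shows "wdeg w t = (\<Sum>v\<in>T. lookup t v * var_weight w v)"
  unfolding wdeg_def using assms by (intro sum.mono_neutral_left) (auto simp: in_keys_iff)

lemma wdeg_add: "wdeg w (s + t) = wdeg w s + wdeg w t"
proof -
  let ?T = "keys s \<union> keys t"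
  have "wdeg w (s + t) = (\<Sum>v\<in>?T. lookup (s + t) v * var_weight w v)"
    by (rule wdeg_superset) (use keys_add[of s t] in auto)
  then show ?thesis
    by (simp add: wdeg_superset[of ?T] lookup_add distrib_right sum.distrib)
qed

lemma wdeg_single [simp]: "wdeg w (single v n) = n * var_weight w v"
  by (simp add: wdeg_superset[of "{v}"])

lemma wdeg_param_only: "param_only t \<Longrightarrow> wdeg w t = 0"
  unfolding wdeg_def
proof (rule sum.neutral, rule ballI)
  fix v assume "param_only t"
  then show "lookup t v * var_weight w v = 0"
    by (cases v) (auto simp: param_only_def)
qed

lemma wdeg_linear_in: "linear_in i t \<Longrightarrow> wdeg w t = w i"
  using linear_in_split[of i t] wdeg_param_only[of _ w] by (metis wdeg_add wdeg_single add_0 mult_1 var_weight.simps(2))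

lemma wdeg_ge: "lookup t v * var_weight w v \<le> wdeg w t"
proof (cases "v \<in> keys t")
  case True
  then show ?thesis unfolding wdeg_def by (intro member_le_sum) auto
qed (simp add: in_keys_iff)

text \<open>Weighted homogeneity, with the zero polynomial homogeneous of every weight.\<close>

definition whom :: "(nat \<Rightarrow> nat) \<Rightarrow> nat \<Rightarrow> (pvar, 'a::field) mpoly \<Rightarrow> bool" where
  "whom w d p \<longleftrightarrow> (\<forall>t\<in>keys p. wdeg w t = d)"

lemma whom_0 [simp]: "whom w d 0"
  by (simp add: whom_def)

lemma whom_add: "whom w d p \<Longrightarrow> whom w d q \<Longrightarrow> whom w d (p + q)"
  using keys_add[of p q] by (auto simp: whom_def)

lemma whom_uminus: "whom w d p \<Longrightarrow> whom w d (- p)"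
  by (auto simp: whom_def in_keys_iff)

lemma whom_diff: "whom w d p \<Longrightarrow> whom w d q \<Longrightarrow> whom w d (p - q)"
  using whom_add[of w d p "- q"] whom_uminus[of w d q] by simp

lemma whom_sum: "(\<And>x. x \<in> X \<Longrightarrow> whom w d (f x)) \<Longrightarrow> whom w d (sum f X)"
  by (induction X rule: infinite_finite_induct) (auto intro: whom_add)

lemma whom_mult: "whom w d p \<Longrightarrow> whom w e q \<Longrightarrow> whom w (d + e) (p * q)"
  using keys_mult[of p q] by (fastforce simp: whom_def wdeg_add)

lemma whom_param_mult:
  assumes "a \<in> carrier (A_ring m)" "whom w d p" shows "whom w d (a * p)"
proof -
  have "whom w 0 a"
    unfolding whom_def
  proof
    fix t assume "t \<in> keys a"
    then have "keys t \<subseteq> Par ` {1..m}"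
      using assms(1) by (auto simp: A_ring_def mpoly_ring_iff)
    then have "param_only t" by (auto simp: param_only_def in_keys_iff)
    then show "wdeg w t = 0" by (rule wdeg_param_only)
  qed
  then show ?thesis using whom_mult[of w 0 a d p] assms(2) by simp
qed

lemma lincoef_eq_0_of_wdeg:
  assumes "\<And>t. t \<in> keys p \<Longrightarrow> wdeg w t \<noteq> w i"
  shows "lincoef i p = 0"
  unfolding lincoef_def poly.lin_ext_def
  by (rule sum.neutral) (use assms wdeg_linear_in[of i _ w] in auto)

lemma lookup_hom_component:
  "lookup (hom_component w d p) t = (if wdeg w t = d then lookup p t else 0)"
proof -
  have "lookup (hom_component w d p) t
      = (\<Sum>s\<in>{s \<in> keys p. wdeg w s = d}. if s = t then lookup p t else 0)"
    unfolding hom_component_def lookup_sum by (rule sum.cong) (auto simp: lookup_single when_def)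
  also have "\<dots> = (if wdeg w t = d then lookup p t else 0)"
    by (auto simp: in_keys_iff)
  finally show ?thesis .
qed

lemma whom_hom_component: "whom w d (hom_component w d p)"
  by (auto simp: whom_def in_keys_iff lookup_hom_component split: if_splits)

text \<open>A monomial that is linear in \<open>x\<^sub>i\<close> and otherwise contains parameters only has the weight of \<open>x\<^sub>i\<close>.\<close>

lemma lincoef_hom_component: "lincoef i (hom_component w (w i) p) = lincoef i p"
proof -
  have "lincoef i (p - hom_component w (w i) p) = 0"
    by (rule lincoef_eq_0_of_wdeg[of _ w]) (auto simp: in_keys_iff lookup_minus lookup_hom_component split: if_splits)
  then show ?thesis by (simp add: lincoef_diff)
qed

text \<open>Positivity of the weights: a monomial of weight \<open>d\<close> that contains a variable of weight \<open>d\<close> is this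
variable times parameters, so all other monomials consist of parameters and lighter variables.\<close>

lemma whom_linear_part:
  assumes p: "p \<in> carrier (P_ring m k)" "whom w d p"
    and w: "\<And>j. j \<in> {1..k} \<Longrightarrow> 0 < w j" and d: "0 < d"
  shows "p - (\<Sum>i\<in>{i\<in>{1..k}. w i = d}. lincoef i p * mvar (Ind i))
    \<in> polys (Par ` {1..m} \<union> Ind ` {i\<in>{1..k}. w i < d})"
proof -
  let ?X = "{i\<in>{1..k}. w i = d}"
  let ?C = "polys (Par ` {1..m} \<union> Ind ` {i\<in>{1..k}. w i < d}) :: (pvar, 'a) mpoly set"
  define g where "g p = p - (\<Sum>i\<in>?X. lincoef i p * mvar (Ind i))" for p :: "(pvar, 'a) mpoly"
  have g_add: "g (p + q) = g p + g q" for p q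
    by (simp add: g_def lincoef_add distrib_right sum.distrib)
  have g0: "g 0 = 0" by (simp add: g_def)
  have single: "g (single t c) \<in> ?C"
    if t: "keys t \<subseteq> Par ` {1..m} \<union> Ind ` {1..k}" "wdeg w t = d" for t c
  proof (cases "\<exists>i\<in>?X. lookup t (Ind i) \<noteq> 0")
    case True
    then obtain i where i: "i \<in> {1..k}" "w i = d" "lookup t (Ind i) \<noteq> 0" by auto
    define s where "s = t - single (Ind i) 1"
    have ts: "t = s + single (Ind i) 1"
      using i(3) by (intro poly_mapping_eqI) (auto simp: s_def lookup_add lookup_minus lookup_single when_def)
    have s0: "wdeg w s = 0" using t(2) i(2) by (simp add: ts wdeg_add)
    have "lookup s (Ind j) = 0" for j
    proof (cases "j \<in> {1..k}")
      case True
      then show ?thesis using wdeg_ge[of s "Ind j" w] s0 w[of j] by simp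
    next
      case False
      then have "lookup t (Ind j) = 0" using t(1) by (auto simp: in_keys_iff)
      then show ?thesis by (simp add: s_def lookup_minus)
    qed
    then have s: "param_only s" by (simp add: param_only_def)
    have lin: "linear_in j t \<longleftrightarrow> j = i" for j
      using s by (auto simp: ts linear_in_def param_only_def lookup_add lookup_single when_def)
    have "lincoef j (single t c) * mvar (Ind j) = (if j = i then single t c else 0)" for j
    proof -
      have "lincoef j (single t c) = mconst c * (if j = i then single s 1 else 0)"
        unfolding lincoef_def by (simp add: lin s_def)
      then show ?thesis by (simp add: mconst_def mvar_def mult_single ts)
    qed
    then have "(\<Sum>j\<in>?X. lincoef j (single t c) * mvar (Ind j)) = single t c"
      using i by simp
    then show ?thesis by (simp add: g_def)
  next
    case False
    then have "lincoef j (single t c) = 0" if "j \<in> ?X" for j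
      using that by (auto simp: lincoef_def linear_in_def)
    then have "g (single t c) = single t c" by (simp add: g_def)
    moreover have "keys t \<subseteq> Par ` {1..m} \<union> Ind ` {i\<in>{1..k}. w i < d}"
    proof
      fix v assume v: "v \<in> keys t"
      show "v \<in> Par ` {1..m} \<union> Ind ` {i\<in>{1..k}. w i < d}"
      proof (cases v)
        case (Ind j)
        then have "Ind j \<in> Par ` {1..m} \<union> Ind ` {1..k}" using v t(1) by blast
        then have j: "j \<in> {1..k}" "0 < lookup t (Ind j)" using v Ind by (auto simp: in_keys_iff)
        have "w j \<le> lookup t (Ind j) * w j" using j(2) by simp
        also have "\<dots> \<le> d" using wdeg_ge[of t "Ind j" w] t(2) by simp
        finally have "w j \<le> d" .
        moreover have "w j \<noteq> d" using False j by auto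
        ultimately show ?thesis using j Ind by auto
      qed (use v t(1) in auto)
    qed
    ultimately show ?thesis by (auto simp: mpoly_ring_iff)
  qed
  have "g (\<Sum>t\<in>T. single t (lookup p t)) \<in> ?C"
    if "finite T" "T \<subseteq> keys p" for T
    using that
  proof (induction T)
    case (insert t T)
    have "g (single t (lookup p t)) \<in> ?C"
      using insert.prems p by (intro single) (auto simp: P_ring_def mpoly_ring_iff whom_def)
    with insert show ?case by (auto simp: g_add)
  qed (simp add: g0)
  from this[of "keys p"] show ?thesis by (simp add: g_def flip: sum_of_terms)
qed


section \<open>Eliminating indeterminates\<close>

text \<open>Equations \<open>F\<^sub>j = 0\<close> in \<open>I\<close> that can be solved for \<open>x\<^sub>j\<close> with \<open>j \<in> J\<close>, by recursion on the weight, once \<open>h\<close>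
is inverted.  The last axiom says that \<open>J\<close> is as large as possible: the linear parts of the \<open>F\<^sub>j\<close> at
\<open>\<Gamma>\<close> span those of \<open>I\<close>.  Homogeneity enters only through these consequences, which survive
the specialization to the fiber.\<close>

locale elimination =
  fixes m k :: nat and w :: "nat \<Rightarrow> nat" and I :: "(pvar, 'a::field) mpoly set" and \<Gamma> :: "nat \<Rightarrow> 'a"
    and J :: "nat set" and h :: "(pvar, 'a) mpoly" and F :: "nat \<Rightarrow> (pvar, 'a) mpoly"
  assumes I_ideal: "ideal I (P_ring m k)"
    and I_zsec: "f \<in> I \<Longrightarrow> zsec f = 0"
    and J_sub: "J \<subseteq> {1..k}"
    and h_param: "h \<in> carrier (A_ring m)"
    and h_unit: "eval_at \<Gamma> h \<noteq> 0"
    and F_mem: "j \<in> J \<Longrightarrow> F j \<in> I"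
    and F_solve: "j \<in> J \<Longrightarrow> h * mvar (Ind j) - F j
        \<in> polys (Par ` {1..m} \<union> Ind ` ({1..k} - J) \<union> Ind ` {i\<in>J. w i < w j})"
    and F_deriv: "i \<in> J \<Longrightarrow> j \<in> J \<Longrightarrow> deriv_at \<Gamma> (Ind i) (F j) = (if i = j then eval_at \<Gamma> h else 0)"
    and deriv_at_determined: "f \<in> I \<Longrightarrow> (\<And>j. j \<in> J \<Longrightarrow> deriv_at \<Gamma> (Ind j) f = 0) \<Longrightarrow> i \<in> {1..k} \<Longrightarrow> deriv_at \<Gamma> (Ind i) f = 0"

text \<open>The component of weight \<open>0\<close> of \<open>f\<close> lies in \<open>I \<inter> A = 0\<close>, and it is the restriction of \<open>f\<close> to the zero
section.\<close>

lemma positive_algebra_zsec: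
  assumes pos: "positive_algebra m k w I" and f: "f \<in> I"
  shows "zsec f = 0"
proof -
  have id: "ideal I (P_ring m k)" and hc: "hom_component w 0 f \<in> I"
    and w: "\<And>j. j \<in> {1..k} \<Longrightarrow> 0 < w j" and A: "I \<inter> carrier (A_ring m) = {0}"
    using pos f by (auto simp: positive_algebra_def homogeneous_ideal_def)
  have fP: "f \<in> carrier (P_ring m k)" using id f by (metis ideal.Icarr)
  have vars: "keys t \<subseteq> Par ` {1..m} \<union> Ind ` {1..k}" if "t \<in> keys f" for t
    using fP that unfolding P_ring_def mpoly_ring_iff by blast
  have par: "param_only t \<longleftrightarrow> wdeg w t = 0" if t: "t \<in> keys f" for t
  proof
    assume t0: "wdeg w t = 0"
    have "lookup t (Ind j) = 0" for j
    proof (cases "j \<in> {1..k}")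
      case True
      then show ?thesis using wdeg_ge[of t "Ind j" w] t0 w[of j] by simp
    next
      case False
      then have "Ind j \<notin> keys t" using vars[OF t] by blast
      then show ?thesis by (simp add: in_keys_iff)
    qed
    then show "param_only t" by (simp add: param_only_def)
  qed (rule wdeg_param_only)
  have "hom_component w 0 f \<in> carrier (A_ring m)"
    unfolding A_ring_def mpoly_ring_iff
  proof
    fix t assume "t \<in> keys (hom_component w 0 f)"
    then have t: "wdeg w t = 0" "t \<in> keys f" by (auto simp: in_keys_iff lookup_hom_component split: if_splits)
    then have "param_only t" using par by blast
    then have "Ind j \<notin> keys t" for j by (simp add: param_only_def in_keys_iff)
    then show "keys t \<subseteq> Par ` {1..m}"
      using vars[OF t(2)] by blast
  qed
  with hc A have h0: "hom_component w 0 f = 0" by blast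
  have "\<not> param_only t" if "t \<in> keys f" for t
  proof
    assume "param_only t"
    then have "wdeg w t = 0" by (rule wdeg_param_only)
    then have "lookup f t = 0" using lookup_hom_component[of w 0 f t] h0 by simp
    then show False using that by (simp add: in_keys_iff)
  qed
  then show ?thesis
    unfolding msubst_eq_lin_ext poly.lin_ext_def by (intro sum.neutral) (simp add: mon_zero_section)
qed

text \<open>Take \<open>J\<close> of maximal size such that there are homogeneous elements \<open>F\<^sub>j \<in> I\<close> of weight \<open>w\<^sub>j\<close> whose
coefficients of \<open>x\<^sub>i\<close>, \<open>i \<in> J\<close>, are \<open>h\<close> times the identity matrix, with \<open>h(\<Gamma>) \<noteq> 0\<close>.  Reducing a
homogeneous element of \<open>I\<close> by the \<open>F\<^sub>j\<close> must leave linear coefficients that vanish at \<open>\<Gamma>\<close>; otherwise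
the remainder provides a further pivot.  Clearing denominators with \<open>h\<close> avoids localizing \<open>A\<close>.\<close>

theorem elimination_exists:
  assumes pos: "positive_algebra m k w I"
  obtains J h F where "elimination m k w I \<Gamma> J h F"
proof -
  have id: "ideal I (P_ring m k)" and hc: "\<And>f d. f \<in> I \<Longrightarrow> hom_component w d f \<in> I"
    and w: "\<And>j. j \<in> {1..k} \<Longrightarrow> 0 < w j"
    using pos by (auto simp: positive_algebra_def homogeneous_ideal_def)
  note ideal_I = mpoly_idealD[OF id[unfolded P_ring_def], folded P_ring_def]
  have AP: "a \<in> carrier (P_ring m k)" if "a \<in> carrier (A_ring m)" for a :: "(pvar, 'a) mpoly"
    using that A_sub_P by blast
  have A_closed: "a * b \<in> carrier (A_ring m)" if "a \<in> carrier (A_ring m)" "b \<in> carrier (A_ring m)"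
    for a b :: "(pvar, 'a) mpoly"
    using that by (auto simp: A_ring_def)
  define pre where "pre = (\<lambda>(J, h, F). J \<subseteq> {1..k} \<and> h \<in> carrier (A_ring m) \<and> eval_at \<Gamma> h \<noteq> 0 \<and>
    (\<forall>j\<in>J. F j \<in> I \<and> whom w (w j) (F j) \<and> (\<forall>i\<in>J. lincoef i (F j) = (if i = j then h else 0))))"
  have "pre ({}, 1, \<lambda>_. 0)" by (simp add: pre_def A_ring_def)
  moreover have "\<forall>y. pre y \<longrightarrow> card (fst y) < Suc k"
  proof (intro allI impI)
    fix y assume "pre y"
    then have "fst y \<subseteq> {1..k}" by (cases y) (simp add: pre_def)
    then show "card (fst y) < Suc k" using card_mono[of "{1..k}" "fst y"] by simp
  qed
  ultimately obtain y where y: "pre y" "\<And>y'. pre y' \<Longrightarrow> card (fst y') \<le> card (fst y)"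
    using ex_has_greatest_nat[of pre _ "\<lambda>y. card (fst y)" "Suc k"] by blast
  obtain J h F where JhF: "y = (J, h, F)" by (cases y)
  have J: "J \<subseteq> {1..k}" "finite J" and h: "h \<in> carrier (A_ring m)" "eval_at \<Gamma> h \<noteq> 0"
    and F: "\<And>j. j \<in> J \<Longrightarrow> F j \<in> I" "\<And>j. j \<in> J \<Longrightarrow> whom w (w j) (F j)"
      "\<And>i j. i \<in> J \<Longrightarrow> j \<in> J \<Longrightarrow> lincoef i (F j) = (if i = j then h else 0)"
    using y(1) finite_subset[of J "{1..k}"] by (auto simp: JhF pre_def)
  have FP: "F j \<in> carrier (P_ring m k)" if "j \<in> J" for j using F(1)[OF that] ideal_I(1) by blast
  have reduced: "eval_at \<Gamma> (lincoef i0 (h * f - (\<Sum>j\<in>{j\<in>J. w j = d}. lincoef j f * F j))) = 0"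
    if f: "f \<in> I" "whom w d f" and i0: "i0 \<in> {1..k}" for f d i0
  proof (rule ccontr)
    (* the remainder of f; it has a nonzero linear coefficient at i0, outside of J *)
    define G where "G = h * f - (\<Sum>j\<in>{j\<in>J. w j = d}. lincoef j f * F j)"
    assume "eval_at \<Gamma> (lincoef i0 (h * f - (\<Sum>j\<in>{j\<in>J. w j = d}. lincoef j f * F j))) \<noteq> 0"
    then have ne: "eval_at \<Gamma> (lincoef i0 G) \<noteq> 0" by (simp add: G_def)
    have fP: "f \<in> carrier (P_ring m k)" using f ideal_I(1) by blast
    have cA: "lincoef i p \<in> carrier (A_ring m)" if "p \<in> carrier (P_ring m k)" for i and p :: "(pvar, 'a) mpoly"
      using lincoef_closed[OF that] .
    have "(\<Sum>j\<in>X. lincoef j f * F j) \<in> I" if "X \<subseteq> J" "finite X" for X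
      using that(2,1)
      by (induction X) (auto intro!: ideal_I(2,3) ideal_I(6) F(1) AP cA fP)
    then have GI: "G \<in> I"
      unfolding G_def using J(2) by (intro ideal_I(5) ideal_I(6) f AP h) auto
    have GP: "G \<in> carrier (P_ring m k)" using GI ideal_I(1) by blast
    have Gh: "whom w d G"
      unfolding G_def using F(2) f(2) h(1) cA[OF fP]
      by (intro whom_diff whom_sum whom_param_mult[of _ m]) auto
    have coefG: "lincoef i G = h * lincoef i f - (\<Sum>j\<in>{j\<in>J. w j = d}. lincoef j f * lincoef i (F j))" for i
      unfolding G_def by (simp add: lincoef_diff lincoef_sum lincoef_param_mult[OF h(1)] lincoef_param_mult[OF cA[OF fP]])
    have zeroG: "lincoef i G = 0" if i: "i \<in> J" for i
    proof -
      have "(\<Sum>j\<in>{j\<in>J. w j = d}. lincoef j f * lincoef i (F j))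
          = (\<Sum>j\<in>{j\<in>J. w j = d}. if j = i then lincoef i f * h else 0)"
        by (rule sum.cong) (auto simp: F(3) i)
      also have "\<dots> = (if w i = d then lincoef i f * h else 0)" using i J(2) by simp
      finally have "lincoef i G = h * lincoef i f - (if w i = d then lincoef i f * h else 0)"
        by (simp add: coefG)
      moreover have "lincoef i f = 0" if "w i \<noteq> d"
        using that f(2) by (intro lincoef_eq_0_of_wdeg[of _ w]) (auto simp: whom_def)
      ultimately show ?thesis by (auto simp: mult.commute)
    qed
    have "lincoef i0 G \<noteq> 0" using ne by auto
    then have "i0 \<notin> J" and wi0: "w i0 = d"
      using zeroG lincoef_eq_0_of_wdeg[of G w i0] Gh by (auto simp: whom_def)
    let ?g = "lincoef i0 G"
    (* one step of Gaussian elimination with pivot ?g *)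
    let ?F = "\<lambda>j. if j = i0 then h * G else ?g * F j - lincoef i0 (F j) * G"
    have gA: "?g \<in> carrier (A_ring m)" by (rule cA[OF GP])
    have cF: "lincoef i0 (F j) \<in> carrier (A_ring m)" if "j \<in> J" for j by (rule cA[OF FP[OF that]])
    have "pre (insert i0 J, h * ?g, ?F)"
      unfolding pre_def
    proof (clarify, intro conjI ballI)
      show "insert i0 J \<subseteq> {1..k}" using J i0 by auto
      show "h * ?g \<in> carrier (A_ring m)" by (rule A_closed[OF h(1) gA])
      show "eval_at \<Gamma> (h * ?g) \<noteq> 0" using h(2) ne by (simp add: eval_at_mult)
      fix j assume j: "j \<in> insert i0 J"
      show "?F j \<in> I"
        using j F(1) GI h(1) gA cF by (auto intro!: ideal_I(5,6) AP)
      show "whom w (w j) (?F j)"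
      proof (cases "j = i0")
        case True
        then show ?thesis using whom_param_mult[OF h(1) Gh] wi0 by simp
      next
        case False
        then have jJ: "j \<in> J" using j by simp
        have "whom w (w j) (lincoef i0 (F j) * G)"
        proof (cases "w i0 = w j")
          case True
          then show ?thesis using whom_param_mult[OF cF[OF jJ] Gh] wi0 by simp
        next
          case False
          then have "lincoef i0 (F j) = 0"
            using F(2)[OF jJ] by (intro lincoef_eq_0_of_wdeg[of _ w]) (auto simp: whom_def)
          then show ?thesis by simp
        qed
        then show ?thesis
          using False whom_param_mult[OF gA F(2)[OF jJ]] by (auto intro: whom_diff)
      qed
      fix i assume i: "i \<in> insert i0 J"
      show "lincoef i (?F j) = (if i = j then h * ?g else 0)"
      proof (cases "j = i0")
        case True
        then show ?thesis using i zeroG \<open>i0 \<notin> J\<close> by (auto simp: lincoef_param_mult[OF h(1)])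
      next
        case False
        then have jJ: "j \<in> J" using j by simp
        have "lincoef i (?F j) = ?g * lincoef i (F j) - lincoef i0 (F j) * lincoef i G"
          using False by (simp add: lincoef_diff lincoef_param_mult[OF gA] lincoef_param_mult[OF cF[OF jJ]])
        then show ?thesis
          using i jJ zeroG F(3)[of i j] \<open>i0 \<notin> J\<close> False by (auto simp: mult.commute)
      qed
    qed
    then have "card (insert i0 J) \<le> card J" using y(2) by (force simp: JhF)
    then show False using \<open>i0 \<notin> J\<close> J(2) by simp
  qed
  have "elimination m k w I \<Gamma> J h F"
  proof (rule elimination.intro)
    fix j assume j: "j \<in> J"
    let ?C = "polys (Par ` {1..m} \<union> Ind ` ({1..k} - J) \<union> Ind ` {i\<in>J. w i < w j}) :: (pvar, 'a) mpoly set"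
    let ?X = "{i\<in>{1..k}. w i = w j}"
    have jk: "j \<in> ?X" using j J by auto
    have rest: "F j - (\<Sum>i\<in>?X. lincoef i (F j) * mvar (Ind i)) \<in> ?C"
      by (rule subsetD[OF mpoly_ring_mono whom_linear_part[OF FP[OF j] F(2)[OF j] w w]])
         (use j J in auto)
    have others: "(\<Sum>i\<in>?X - {j}. lincoef i (F j) * mvar (Ind i)) \<in> ?C"
    proof (rule mpoly_sum_closed)
      fix i assume i: "i \<in> ?X - {j}"
      show "lincoef i (F j) * mvar (Ind i) \<in> ?C"
      proof (cases "i \<in> J")
        case True
        then show ?thesis using F(3)[OF True j] i by simp
      next
        case False
        have "lincoef i (F j) \<in> ?C"
          by (rule subsetD[OF mpoly_ring_mono lincoef_closed[OF FP[OF j], unfolded A_ring_def]]) auto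
        then show ?thesis using False i by (intro mpoly_mult_closed) auto
      qed
    qed
    have split: "(\<Sum>i\<in>?X. lincoef i (F j) * mvar (Ind i))
        = h * mvar (Ind j) + (\<Sum>i\<in>?X - {j}. lincoef i (F j) * mvar (Ind i))"
      using jk F(3)[OF j j] by (subst sum.remove[of _ j]) auto
    have "- (F j - (\<Sum>i\<in>?X. lincoef i (F j) * mvar (Ind i)))
        - (\<Sum>i\<in>?X - {j}. lincoef i (F j) * mvar (Ind i)) \<in> ?C"
      by (rule mpoly_diff_closed[OF mpoly_uminus_closed[OF rest] others])
    also have "- (F j - (\<Sum>i\<in>?X. lincoef i (F j) * mvar (Ind i)))
        - (\<Sum>i\<in>?X - {j}. lincoef i (F j) * mvar (Ind i)) = h * mvar (Ind j) - F j"
      unfolding split by simp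
    finally show "h * mvar (Ind j) - F j \<in> ?C" .
  next
    fix i j assume "i \<in> J" "j \<in> J"
    then show "deriv_at \<Gamma> (Ind i) (F j) = (if i = j then eval_at \<Gamma> h else 0)"
      using F(3)[of i j] by (simp flip: eval_at_lincoef)
  next
    fix f i assume f: "f \<in> I" "\<And>j. j \<in> J \<Longrightarrow> deriv_at \<Gamma> (Ind j) f = 0" and i: "i \<in> {1..k}"
    (* derivatives in the direction of x_i only see the component of weight w i *)
    let ?f = "hom_component w (w i) f"
    have "eval_at \<Gamma> (lincoef i (h * ?f - (\<Sum>j\<in>{j\<in>J. w j = w i}. lincoef j ?f * F j))) = 0"
      by (rule reduced) (use hc f whom_hom_component i in auto)
    moreover have "deriv_at \<Gamma> (Ind j) ?f = deriv_at \<Gamma> (Ind j) f" if "w j = w i" for j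
      using lincoef_hom_component[of j w f] that by (simp flip: eval_at_lincoef)
    moreover have "deriv_at \<Gamma> (Ind i) h = 0"
      using eval_at_lincoef[of \<Gamma> i h] by (simp add: lincoef_param[OF h(1)])
    moreover have "eval_at \<Gamma> (F j) = 0" if "j \<in> J" for j
      using positive_algebra_zsec[OF pos F(1)[OF that]] eval_at_zsec[of \<Gamma> "F j"] by simp
    ultimately have "eval_at \<Gamma> h * deriv_at \<Gamma> (Ind i) f = 0"
      using f(2)
      by (simp add: eval_at_lincoef deriv_at_diff deriv_at_sum deriv_at_mult)
    then show "deriv_at \<Gamma> (Ind i) f = 0" using h(2) by simp
  qed (use id J h F(1) positive_algebra_zsec[OF pos] in auto)
  then show thesis by (rule that)
qed


lemma P_ring_simps [simp]:
  "mult (P_ring m k) = (*)" "one (P_ring m k) = 1" "zero (P_ring m k) = 0" "add (P_ring m k) = (+)"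
  by (simp_all add: P_ring_def)

text \<open>Taylor expansion to order zero at \<open>\<Gamma>\<^sub>0\<close>.\<close>

lemma minus_value_mem_genideal:
  assumes p: "p \<in> polys V" and V: "V \<subseteq> W"
  shows "p - mconst (eval_at \<Gamma> p)
    \<in> genideal (mpoly_ring W) ((\<lambda>v. mvar v - mconst (eval_at \<Gamma> (mvar v))) ` V)"
    (is "_ \<in> ?G")
proof -
  interpret R: cring "mpoly_ring W :: (pvar, 'a) mpoly ring" by (rule mpoly_ring_cring)
  have sub: "(\<lambda>v. mvar v - mconst (eval_at \<Gamma> (mvar v))) ` V \<subseteq> polys W"
    using V by (auto intro!: mpoly_diff_closed)
  have id: "ideal ?G (mpoly_ring W)" by (rule R.genideal_ideal[OF sub])
  note G = mpoly_idealD[OF id]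
  have W: "p \<in> polys W" if "p \<in> polys V" for p :: "(pvar, 'a) mpoly"
    using that mpoly_ring_mono[OF V] by blast
  show ?thesis
    using p
  proof (induction p rule: mpoly_ring_induct)
    case (const c)
    show ?case using G(2) by simp
  next
    case (var v)
    then show ?case using R.genideal_self[OF sub] by blast
  next
    case (add p q)
    have eq: "p + q - mconst (eval_at \<Gamma> (p + q)) = (p - mconst (eval_at \<Gamma> p)) + (q - mconst (eval_at \<Gamma> q))"
      by (simp add: eval_at_add mconst_add)
    show ?case unfolding eq by (rule G(3)[OF add.IH])
  next
    case (mult p q)
    have eq: "p * q - mconst (eval_at \<Gamma> (p * q)) = q * (p - mconst (eval_at \<Gamma> p)) + mconst (eval_at \<Gamma> p) * (q - mconst (eval_at \<Gamma> q))"
      by (simp add: eval_at_mult mconst_mult algebra_simps)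
    show ?case
      unfolding eq by (intro G(3) G(6) mult.IH W mult.hyps mconst_closed)
  qed
qed

lemma kernel_eval_at_prime: "primeideal {p \<in> carrier (P_ring m k). eval_at \<Gamma> p = 0} (P_ring m k)"
  unfolding P_ring_def
proof (rule primeidealI)
  let ?V = "Par ` {1..m} \<union> Ind ` {1..k}"
  let ?M = "{p \<in> polys ?V. eval_at \<Gamma> p = 0}"
  show "ideal ?M (mpoly_ring ?V)"
    by (rule mpoly_idealI) (auto simp: eval_at_add eval_at_mult)
  show "cring (mpoly_ring ?V)" by (rule mpoly_ring_cring)
  have "1 \<notin> ?M" "1 \<in> polys ?V" by auto
  then show "polys ?V \<noteq> ?M" by blast
qed (auto simp: eval_at_mult)

lemma zero_point_ideal_eq: "zero_point_ideal m k \<Gamma> = {p \<in> carrier (P_ring m k). eval_at \<Gamma> p = 0}"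
proof -
  let ?V = "Par ` {1..m} \<union> Ind ` {1..k}"
  let ?S = "(\<lambda>v. mvar v - mconst (eval_at \<Gamma> (mvar v))) ` ?V"
  interpret R: cring "P_ring m k :: (pvar, 'a) mpoly ring" unfolding P_ring_def by (rule mpoly_ring_cring)
  have S: "(\<lambda>i. mvar (Par i) - mconst (\<Gamma> i)) ` {1..m} \<union> (\<lambda>j. mvar (Ind j)) ` {1..k} = ?S"
    by (simp add: image_Un image_image)
  have "?S \<subseteq> {p \<in> carrier (P_ring m k). eval_at \<Gamma> p = 0}"
    by (auto simp: P_ring_def eval_at_diff intro!: mpoly_diff_closed)
  then have "genideal (P_ring m k) ?S \<subseteq> {p \<in> carrier (P_ring m k). eval_at \<Gamma> p = 0}"
    by (rule R.genideal_minimal[OF primeideal.axioms(1)[OF kernel_eval_at_prime]])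
  moreover have "p \<in> genideal (P_ring m k) ?S" if "p \<in> carrier (P_ring m k)" "eval_at \<Gamma> p = 0" for p
    using minus_value_mem_genideal[of p ?V ?V \<Gamma>] that by (simp add: P_ring_def)
  ultimately show ?thesis unfolding zero_point_ideal_def S by blast
qed

lemma inj_mvar: "inj (mvar :: 'v \<Rightarrow> ('v, 'a::field) mpoly)"
proof (rule injI)
  fix u v :: 'v assume "(mvar u :: ('v, 'a) mpoly) = mvar v"
  then have "lookup (mvar u :: ('v, 'a) mpoly) (single u 1) = lookup (mvar v :: ('v, 'a) mpoly) (single u 1)"
    by simp
  then show "u = v" by (simp add: lookup_mvar split: if_splits)
qed

lemma independent_variables: "mpoly_vs.independent (mvar ` X :: ('v, 'a::field) mpoly set)"
  unfolding mpoly_vs.independent_explicit_finite_subsets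
proof (intro allI impI ballI)
  fix S :: "('v, 'a) mpoly set" and u and s
  assume S: "S \<subseteq> mvar ` X" "finite S" and sum: "(\<Sum>s\<in>S. mconst (u s) * s) = 0" and s: "s \<in> S"
  obtain v where v: "s = mvar v" using S s by blast
  have "0 = lookup (\<Sum>s\<in>S. mconst (u s) * s) (single v 1)"
    by (simp add: sum)
  also have "\<dots> = (\<Sum>s'\<in>S. if s' = s then u s else 0)"
    unfolding lookup_sum
  proof (rule sum.cong[OF refl])
    fix s' assume "s' \<in> S"
    then obtain v' where "s' = mvar v'" using S by blast
    then show "lookup (mconst (u s') * s') (single v 1) = (if s' = s then u s else 0)"
      by (auto simp: v lookup_mvar inj_eq[OF inj_mvar])
  qed
  also have "\<dots> = u s" using S s by simp
  finally show "u s = 0" by simp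
qed

lemma primeideal_restrict:
  assumes Q: "primeideal Q (mpoly_ring V)" and W: "W \<subseteq> V"
  shows "primeideal (Q \<inter> polys W) (mpoly_ring W)"
proof (rule primeidealI)
  note Qi = mpoly_idealD[OF mpoly_primeD(1)[OF Q]]
  note sub = mpoly_ring_mono[OF W]
  show "ideal (Q \<inter> polys W) (mpoly_ring W)"
    by (rule mpoly_idealI) (use sub in \<open>auto intro!: Qi(2,3,6)\<close>)
  show "cring (mpoly_ring W)" by (rule mpoly_ring_cring)
  have "1 \<notin> Q" using mpoly_primeD(3)[OF Q, of 1] by auto
  moreover have "1 \<in> polys W" by blast
  ultimately show "polys W \<noteq> Q \<inter> polys W" by blast
  fix a b assume ab: "a \<in> polys W" "b \<in> polys W"
    "a \<otimes>\<^bsub>mpoly_ring W\<^esub> b \<in> Q \<inter> polys W"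
  then have "a \<in> Q \<or> b \<in> Q" using mpoly_primeD(2)[OF Q, of a b] sub by auto
  then show "a \<in> Q \<inter> polys W \<or> b \<in> Q \<inter> polys W" using ab by blast
qed

lemma kernel_msubst_prime:
  fixes \<sigma> :: "'v \<Rightarrow> ('u::linorder, 'a::field) mpoly"
  shows "primeideal {p \<in> polys V. msubst \<sigma> p = 0} (mpoly_ring V)"
proof (rule primeidealI)
  let ?Q = "{p \<in> polys V. msubst \<sigma> p = 0}"
  show "ideal ?Q (mpoly_ring V)" by (rule mpoly_idealI) (auto simp: msubst_add msubst_mult)
  show "cring (mpoly_ring V :: ('v, 'a) mpoly ring)" by (rule mpoly_ring_cring)
  have "1 \<notin> ?Q" "1 \<in> polys V" by auto
  then show "polys V \<noteq> ?Q" by blast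
qed (auto simp: msubst_mult)

text \<open>The hypothesis \<open>C n0\<close> excludes the empty
set, whose supremum is \<open>0\<close>.\<close>

lemma Sup_enat_attained:
  assumes S: "Sup {enat n | n. C n} = enat N" and C: "C n0"
  shows "C N"
proof (rule ccontr)
  assume no: "\<not> C N"
  have less: "n < N" if "C n" for n
  proof -
    have "enat n \<le> Sup {enat n | n. C n}" using that by (intro Sup_upper) auto
    then have "n \<le> N" using S by simp
    with no that show ?thesis by (metis le_neq_implies_less)
  qed
  have "Sup {enat n | n. C n} \<le> enat (N - 1)"
  proof (rule Sup_least)
    fix x assume "x \<in> {enat n | n. C n}"
    then obtain n where "x = enat n" "C n" by blast
    then show "x \<le> enat (N - 1)" using less[of n] by simp
  qed
  then show False using S less[OF C] by simp
qed


section \<open>Embedding dimension of the local ring at a zero point\<close>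

context elimination
begin

abbreviation "M \<equiv> zero_point_ideal m k \<Gamma>"
abbreviation "Loc \<equiv> zero_point_local_ring m k I \<Gamma>"

definition free_vars :: "pvar set" where
  "free_vars = Par ` {1..m} \<union> Ind ` ({1..k} - J)"

lemma finite_free_vars: "finite free_vars"
  by (simp add: free_vars_def)

lemma free_vars_sub: "free_vars \<subseteq> Par ` {1..m} \<union> Ind ` {1..k}"
  by (auto simp: free_vars_def)

lemma card_free_vars: "card free_vars = m + card ({1..k} - J)"
  unfolding free_vars_def
  by (subst card_Un_disjoint) (auto simp: card_image inj_on_def)

lemmas I_simps = mpoly_idealD[OF I_ideal[unfolded P_ring_def], folded P_ring_def]

lemma P_closed:
  assumes "p \<in> carrier (P_ring m k)" "q \<in> carrier (P_ring m k)"
  shows "p + q \<in> carrier (P_ring m k)" "p - q \<in> carrier (P_ring m k)" "p * q \<in> carrier (P_ring m k)"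
  using assms unfolding P_ring_def by auto

lemma P_power: "p \<in> carrier (P_ring m k) \<Longrightarrow> p ^ n \<in> carrier (P_ring m k)"
  unfolding P_ring_def by auto

lemma I_sub_P: "f \<in> I \<Longrightarrow> f \<in> carrier (P_ring m k)"
  using I_simps(1) by blast

lemma h_P: "h \<in> carrier (P_ring m k)"
  using h_param A_sub_P by blast

lemma free_sub_P: "polys free_vars \<subseteq> carrier (P_ring m k)"
  unfolding P_ring_def by (rule mpoly_ring_mono[OF free_vars_sub])

lemma eval_at_I: "f \<in> I \<Longrightarrow> eval_at \<Gamma> f = 0"
  using I_zsec[of f] eval_at_zsec[of \<Gamma> f] by simp

lemma I_sub_M: "I \<subseteq> M"
  using eval_at_I I_simps(1) by (auto simp: zero_point_ideal_eq)

lemma M_prime: "primeideal M (P_ring m k)"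
  unfolding zero_point_ideal_eq by (rule kernel_eval_at_prime)

lemma h_notin_M: "h \<notin> M" "h ^ N \<notin> M"
  using h_unit by (auto simp: zero_point_ideal_eq eval_at_power)

text \<open>The elements \<open>p\<close> that have such a representation form a subring that contains the free variables.  It
contains \<open>x\<^sub>j\<close> for \<open>j \<in> J\<close> by induction on the weight, because \<open>h x\<^sub>j - F\<^sub>j\<close> is a polynomial in free and
lighter variables.  It is used for \<open>T = I\<close> and, to compare \<open>R\<close> with its fiber, for a smaller ideal.\<close>

lemma clear_denominators:
  assumes T: "ideal T (P_ring m k)" "\<And>j. j \<in> J \<Longrightarrow> F j \<in> T" and p: "p \<in> carrier (P_ring m k)"
  obtains N b q where "b \<in> polys free_vars" "q \<in> T" "h ^ N * p = b + q"
proof -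
  let ?V = "Par ` {1..m} \<union> Ind ` {1..k}"
  note T_simps = mpoly_idealD[OF T(1)[unfolded P_ring_def], folded P_ring_def]
  let ?B = "polys free_vars :: (pvar, 'a) mpoly set"
  define S where "S = {p \<in> carrier (P_ring m k). \<exists>N. \<exists>b\<in>?B. \<exists>q\<in>T. h ^ N * p = b + q}"
  have hB: "h \<in> ?B"
    using h_param mpoly_ring_mono[of "Par ` {1..m}" free_vars] by (auto simp: A_ring_def free_vars_def)
  have BP: "b \<in> carrier (P_ring m k)" if "b \<in> ?B" for b using that free_sub_P by blast
  have B_S: "b \<in> S" if "b \<in> ?B" for b
  proof -
    have "h ^ 0 * b = b + 0" by simp
    then show ?thesis using that T_simps(2) BP unfolding S_def by blast
  qed
  have S_add: "p1 + p2 \<in> S" if p1: "p1 \<in> S" and p2: "p2 \<in> S" for p1 p2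
  proof -
    obtain N1 b1 q1 where 1: "b1 \<in> ?B" "q1 \<in> T" "h ^ N1 * p1 = b1 + q1" "p1 \<in> carrier (P_ring m k)" using p1 by (auto simp: S_def)
    obtain N2 b2 q2 where 2: "b2 \<in> ?B" "q2 \<in> T" "h ^ N2 * p2 = b2 + q2" "p2 \<in> carrier (P_ring m k)" using p2 by (auto simp: S_def)
    have "h ^ (N1 + N2) * (p1 + p2) = h ^ N2 * (h ^ N1 * p1) + h ^ N1 * (h ^ N2 * p2)"
      by (simp add: power_add algebra_simps)
    also have "\<dots> = (h ^ N2 * b1 + h ^ N1 * b2) + (h ^ N2 * q1 + h ^ N1 * q2)"
      unfolding 1(3) 2(3) by (simp add: algebra_simps)
    finally have "h ^ (N1 + N2) * (p1 + p2) = (h ^ N2 * b1 + h ^ N1 * b2) + (h ^ N2 * q1 + h ^ N1 * q2)" .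
    moreover have "h ^ N2 * b1 + h ^ N1 * b2 \<in> ?B" using 1 2 hB by auto
    moreover have "h ^ N2 * q1 + h ^ N1 * q2 \<in> T"
      by (intro T_simps(3) T_simps(6) 1(2) 2(2) P_power h_P)
    ultimately show ?thesis using P_closed(1)[OF 1(4) 2(4)] unfolding S_def by blast
  qed
  have S_mult: "p1 * p2 \<in> S" if p1: "p1 \<in> S" and p2: "p2 \<in> S" for p1 p2
  proof -
    obtain N1 b1 q1 where 1: "b1 \<in> ?B" "q1 \<in> T" "h ^ N1 * p1 = b1 + q1" "p1 \<in> carrier (P_ring m k)" using p1 by (auto simp: S_def)
    obtain N2 b2 q2 where 2: "b2 \<in> ?B" "q2 \<in> T" "h ^ N2 * p2 = b2 + q2" "p2 \<in> carrier (P_ring m k)" using p2 by (auto simp: S_def)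
    have "h ^ (N1 + N2) * (p1 * p2) = (h ^ N1 * p1) * (h ^ N2 * p2)"
      by (simp add: power_add algebra_simps)
    also have "\<dots> = b1 * b2 + (b1 * q2 + (b2 + q2) * q1)"
      unfolding 1(3) 2(3) by (simp add: algebra_simps)
    finally have "h ^ (N1 + N2) * (p1 * p2) = b1 * b2 + (b1 * q2 + (b2 + q2) * q1)" .
    moreover have "b1 * b2 \<in> ?B" using 1 2 by auto
    moreover have q2P: "q2 \<in> carrier (P_ring m k)" using 2(2) T_simps(1) by blast
    have "b1 * q2 + (b2 + q2) * q1 \<in> T"
      by (intro T_simps(3) T_simps(6) 1(2) 2(2) P_closed(1) BP[OF 1(1)] BP[OF 2(1)] q2P)
    ultimately show ?thesis using P_closed(3)[OF 1(4) 2(4)] unfolding S_def by blast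
  qed
  have S_gen: "p \<in> S" if "p \<in> polys W" "\<And>v. v \<in> W \<Longrightarrow> mvar v \<in> S" for p W
    using that(1) by (induction p rule: mpoly_ring_induct) (auto intro: B_S S_add S_mult that(2))
  have S_free: "mvar v \<in> S" if "v \<in> free_vars" for v
    using that by (intro B_S) simp
  have S_J: "mvar (Ind j) \<in> S" if "j \<in> J" for j
    using that
  proof (induction "w j" arbitrary: j rule: less_induct)
    case less
    have "h * mvar (Ind j) - F j \<in> S"
      by (rule S_gen[OF F_solve[OF less.prems]]) (use less.hyps S_free in \<open>auto simp: free_vars_def\<close>)
    then obtain N b q where *: "b \<in> ?B" "q \<in> T" "h ^ N * (h * mvar (Ind j) - F j) = b + q" by (auto simp: S_def)
    have "h ^ Suc N * mvar (Ind j) = h ^ N * (h * mvar (Ind j) - F j) + h ^ N * F j"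
      by (simp add: algebra_simps)
    also have "\<dots> = b + (q + h ^ N * F j)" unfolding *(3) by simp
    finally have "h ^ Suc N * mvar (Ind j) = b + (q + h ^ N * F j)" .
    moreover have "q + h ^ N * F j \<in> T"
      by (intro T_simps(3) T_simps(6) *(2) T(2) less.prems P_power h_P)
    moreover have "mvar (Ind j) \<in> carrier (P_ring m k)" using less.prems J_sub by (auto simp: P_ring_def)
    ultimately show ?case using *(1) unfolding S_def by blast
  qed
  have "p \<in> S"
    by (rule S_gen[OF p[unfolded P_ring_def]]) (use S_free S_J in \<open>auto simp: free_vars_def\<close>)
  then show thesis using that by (auto simp: S_def)
qed

text \<open>The tangent vectors of \<open>R\<close> at \<open>\<Gamma>\<^sub>0\<close>: the derivative in the direction of the free variable \<open>v\<close>, corrected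
in the directions \<open>x\<^sub>j\<close>, \<open>j \<in> J\<close>, so that it vanishes on the \<open>F\<^sub>j\<close>.  These forms are a basis of the dual
of the cotangent space.\<close>

definition tangent_form :: "pvar \<Rightarrow> (pvar, 'a) mpoly \<Rightarrow> 'a" where
  "tangent_form v p = deriv_at \<Gamma> v p - (\<Sum>j\<in>J. deriv_at \<Gamma> v (F j) / eval_at \<Gamma> h * deriv_at \<Gamma> (Ind j) p)"

lemma finite_J: "finite J"
  using J_sub finite_subset by blast

lemma tangent_form_add: "tangent_form v (p + q) = tangent_form v p + tangent_form v q"
  by (simp add: tangent_form_def deriv_at_add distrib_left sum.distrib)

lemma tangent_form_mult: "eval_at \<Gamma> p = 0 \<Longrightarrow> tangent_form v (r * p) = eval_at \<Gamma> r * tangent_form v p"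
  by (simp add: tangent_form_def deriv_at_mult right_diff_distrib sum_distrib_left mult_ac)

lemma tangent_form_mvar: "u \<in> free_vars \<Longrightarrow> v \<in> free_vars \<Longrightarrow> tangent_form v (mvar u - mconst c) = (if u = v then 1 else 0)"
proof -
  assume uv: "u \<in> free_vars" "v \<in> free_vars"
  have "(\<Sum>j\<in>J. deriv_at \<Gamma> v (F j) / eval_at \<Gamma> h * deriv_at \<Gamma> (Ind j) (mvar u - mconst c)) = 0"
    by (rule sum.neutral) (use uv in \<open>auto simp: deriv_at_diff free_vars_def\<close>)
  then show ?thesis by (simp add: tangent_form_def deriv_at_diff)
qed

text \<open>Derivatives in the directions of the parameters vanish on \<open>I\<close>, because \<open>I\<close> vanishes on the zero
section.  For \<open>x\<^sub>i\<close> with \<open>i \<notin> J\<close>, subtract from \<open>f\<close> the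
combination of the \<open>F\<^sub>j\<close> that has the same derivatives in the directions of \<open>J\<close>; the difference has
vanishing linear part.\<close>

lemma tangent_form_I:
  assumes f: "f \<in> I" and v: "v \<in> free_vars"
  shows "tangent_form v f = 0"
proof (cases v)
  case (Par i)
  have "deriv_at \<Gamma> v g = 0" if "g \<in> I" for g
    using deriv_at_Par_zsec[of \<Gamma> i g] I_zsec[OF that] by (simp add: Par)
  then show ?thesis using f F_mem by (simp add: tangent_form_def)
next
  case (Ind i)
  let ?c = "\<lambda>j. mconst (deriv_at \<Gamma> (Ind j) f / eval_at \<Gamma> h)"
  let ?g = "f - (\<Sum>j\<in>J. ?c j * F j)"
  have "(\<Sum>j\<in>X. ?c j * F j) \<in> I" if "X \<subseteq> J" "finite X" for X
    using that(2,1) by (induction X) (auto simp: P_ring_def intro!: I_simps(2,3) I_simps(6) F_mem)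
  then have gI: "?g \<in> I" using finite_J by (intro I_simps(5) f) auto
  have dg: "deriv_at \<Gamma> u ?g = deriv_at \<Gamma> u f - (\<Sum>j\<in>J. deriv_at \<Gamma> (Ind j) f / eval_at \<Gamma> h * deriv_at \<Gamma> u (F j))" for u
    by (simp add: deriv_at_diff deriv_at_sum deriv_at_mult)
  have "deriv_at \<Gamma> (Ind i) ?g = 0"
  proof (rule deriv_at_determined[OF gI])
    show "i \<in> {1..k}" using v Ind by (auto simp: free_vars_def)
    fix j assume j: "j \<in> J"
    have "(\<Sum>l\<in>J. deriv_at \<Gamma> (Ind l) f / eval_at \<Gamma> h * deriv_at \<Gamma> (Ind j) (F l)) = (\<Sum>l\<in>J. if l = j then deriv_at \<Gamma> (Ind j) f else 0)"
      by (rule sum.cong) (auto simp: F_deriv j h_unit)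
    then show "deriv_at \<Gamma> (Ind j) ?g = 0" using j finite_J by (simp add: dg)
  qed
  then have "deriv_at \<Gamma> (Ind i) f = (\<Sum>j\<in>J. deriv_at \<Gamma> (Ind j) f / eval_at \<Gamma> h * deriv_at \<Gamma> (Ind i) (F j))"
    unfolding dg by simp
  then show ?thesis by (simp add: tangent_form_def Ind mult_ac)
qed

definition tangent_vector :: "(pvar, 'a) mpoly \<Rightarrow> (pvar, 'a) mpoly" where
  "tangent_vector p = (\<Sum>v\<in>free_vars. mconst (tangent_form v p) * mvar v)"

text \<open>The elements of \<open>M\<close> whose tangent vector lies in the span of the tangent vectors of \<open>H\<close> form an ideal
that contains \<open>H \<union> I\<close>.  Hence up to units the ideal contains \<open>M\<close>, and the tangent vectors of \<open>H\<close> span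
the space with basis \<open>free_vars\<close>.\<close>

lemma card_generators_ge:
  assumes H: "H \<subseteq> M" "finite H"
    and gen: "\<And>p. p \<in> M \<Longrightarrow> \<exists>u\<in>carrier (P_ring m k) - M. u * p \<in> genideal (P_ring m k) (H \<union> I)"
  shows "card free_vars \<le> card H"
proof -
  interpret R: cring "P_ring m k :: (pvar, 'a) mpoly ring" unfolding P_ring_def by (rule mpoly_ring_cring)
  let ?W = "mpoly_vs.span (tangent_vector ` H)"
  have Mev: "p \<in> M \<longleftrightarrow> p \<in> carrier (P_ring m k) \<and> eval_at \<Gamma> p = 0" for p by (simp add: zero_point_ideal_eq)
  have vec_add: "tangent_vector (p + q) = tangent_vector p + tangent_vector q" for p q
    by (simp add: tangent_vector_def tangent_form_add mconst_add distrib_right sum.distrib)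
  have vec_mult: "tangent_vector (r * p) = mconst (eval_at \<Gamma> r) * tangent_vector p" if "p \<in> M" for r p
  proof -
    have "tangent_form v (r * p) = eval_at \<Gamma> r * tangent_form v p" for v using that by (intro tangent_form_mult) (simp add: Mev)
    then show ?thesis by (simp only: tangent_vector_def mconst_mult sum_distrib_left mult.assoc)
  qed
  have vec_I: "tangent_vector f = 0" if "f \<in> I" for f
    using that by (simp add: tangent_vector_def tangent_form_I)
  have "ideal {p \<in> M. tangent_vector p \<in> ?W} (P_ring m k)"
    unfolding P_ring_def
  proof (rule mpoly_idealI, unfold P_ring_def[symmetric])
    show "{p \<in> M. tangent_vector p \<in> ?W} \<subseteq> carrier (P_ring m k)" by (auto simp: Mev)
    show "0 \<in> {p \<in> M. tangent_vector p \<in> ?W}"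
      using vec_I[OF I_simps(2)] I_sub_M I_simps(2) by (auto simp: mpoly_vs.span_zero)
    show "p + q \<in> {p \<in> M. tangent_vector p \<in> ?W}" if "p \<in> {p \<in> M. tangent_vector p \<in> ?W}" "q \<in> {p \<in> M. tangent_vector p \<in> ?W}" for p q
      using that by (auto simp: vec_add Mev eval_at_add intro: P_closed(1) mpoly_vs.span_add)
    show "r * p \<in> {p \<in> M. tangent_vector p \<in> ?W}" if "p \<in> {p \<in> M. tangent_vector p \<in> ?W}" "r \<in> carrier (P_ring m k)" for p r
      using that by (auto simp: vec_mult intro: mpoly_vs.span_scale) (auto simp: Mev eval_at_mult intro: P_closed(3))
  qed
  moreover have "H \<union> I \<subseteq> {p \<in> M. tangent_vector p \<in> ?W}"
    using H I_sub_M by (auto simp: vec_I mpoly_vs.span_zero intro: mpoly_vs.span_base)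
  ultimately have sub: "genideal (P_ring m k) (H \<union> I) \<subseteq> {p \<in> M. tangent_vector p \<in> ?W}"
    by (rule R.genideal_minimal)
  have "mvar v \<in> ?W" if v: "v \<in> free_vars" for v
  proof -
    let ?e = "mvar v - mconst (eval_at \<Gamma> (mvar v))"
    have "mvar v \<in> carrier (P_ring m k)" using v free_vars_sub by (auto simp: P_ring_def)
    then have e: "?e \<in> M" by (auto simp: Mev eval_at_diff P_ring_def intro!: mpoly_diff_closed)
    have "tangent_vector ?e = (\<Sum>u\<in>free_vars. if u = v then mvar v else 0)"
      unfolding tangent_vector_def by (rule sum.cong) (auto simp: tangent_form_mvar v)
    then have Dv: "tangent_vector ?e = mvar v" using v finite_free_vars by simp
    obtain u where u: "u \<in> carrier (P_ring m k) - M" "u * ?e \<in> genideal (P_ring m k) (H \<union> I)"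
      using gen[OF e] by blast
    then have "mconst (eval_at \<Gamma> u) * mvar v \<in> ?W" using sub vec_mult[OF e, of u] Dv by auto
    then have "mconst (inverse (eval_at \<Gamma> u)) * (mconst (eval_at \<Gamma> u) * mvar v) \<in> ?W" by (rule mpoly_vs.span_scale)
    moreover have "eval_at \<Gamma> u \<noteq> 0" using u(1) by (auto simp: Mev)
    ultimately show ?thesis by (simp flip: mult.assoc mconst_mult)
  qed
  then have "card (mvar ` free_vars :: (pvar, 'a) mpoly set) \<le> card (tangent_vector ` H)"
    using mpoly_vs.independent_span_bound[OF _ independent_variables, of "tangent_vector ` H" free_vars] H(2) by auto
  then show ?thesis
    using card_image_le[OF H(2), of tangent_vector] by (simp add: card_image inj_mvar inj_on_subset[OF inj_mvar])
qed

lemma localization: "\<exists>\<theta>. localization_at (P_ring m k) Loc \<theta> M I"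
  unfolding zero_point_local_ring_def
  using localization_at_quotient[OF _ I_ideal M_prime I_sub_M] mpoly_ring_cring by (auto simp: P_ring_def)

theorem embdim_eq: "embdim Loc = card free_vars"
proof -
  obtain \<theta> where "localization_at (P_ring m k) Loc \<theta> M I" using localization by blast
  then interpret L: localization_at "P_ring m k" Loc \<theta> M I .
  let ?gen = "\<lambda>n G. G \<subseteq> carrier Loc \<and> finite G \<and> card G = n \<and> genideal Loc G = max_ideal Loc"
  let ?G = "(\<lambda>v. mvar v - mconst (eval_at \<Gamma> (mvar v))) ` free_vars"
  have lower: "card free_vars \<le> n" if "?gen n G" for n G
  proof -
    have G: "finite G" "G \<subseteq> carrier Loc" "genideal Loc G = L.extend M"
      using that by (simp_all add: L.max_ideal_eq)
    obtain H where H: "H \<subseteq> M" "finite H" "card H \<le> card G"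
      "\<And>p. p \<in> M \<Longrightarrow> \<exists>u\<in>carrier (P_ring m k) - M. u \<otimes>\<^bsub>P_ring m k\<^esub> p \<in> genideal (P_ring m k) (H \<union> I)"
      using L.generators_lift[OF G] by blast
    then show ?thesis using card_generators_ge[of H] that by simp
  qed
  have GP: "?G \<subseteq> carrier (P_ring m k)"
    using free_vars_sub by (auto simp: P_ring_def intro!: mpoly_diff_closed)
  have "eval_at \<Gamma> g = 0" if "g \<in> ?G" for g using that by (auto simp only: eval_at_diff eval_at_mconst diff_self)
  with GP have GM: "?G \<subseteq> M" unfolding zero_point_ideal_eq by blast
  have "genideal Loc (\<theta> ` ?G) = L.extend M"
  proof (rule L.extend_M_generated[OF GM])
    fix p assume p: "p \<in> M"
    then have pP: "p \<in> carrier (P_ring m k)" "eval_at \<Gamma> p = 0" unfolding zero_point_ideal_eq by blast+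
    obtain N b q where b: "b \<in> polys free_vars" "q \<in> I" "h ^ N * p = b + q"
      using clear_denominators[OF I_ideal F_mem pP(1)] by blast
    have "eval_at \<Gamma> (h ^ N * p) = eval_at \<Gamma> (b + q)" using b(3) by simp
    then have "eval_at \<Gamma> b = 0" using pP(2) eval_at_I[OF b(2)] by (simp add: eval_at_mult eval_at_add)
    then have bG: "b \<in> genideal (P_ring m k) ?G"
      using minus_value_mem_genideal[OF b(1) free_vars_sub, of \<Gamma>] by (simp add: P_ring_def)
    have GI: "?G \<union> I \<subseteq> carrier (P_ring m k)" using GP I_simps(1) by blast
    have "ideal (genideal (P_ring m k) (?G \<union> I)) (P_ring m k)" by (rule L.R.genideal_ideal[OF GI])
    note J_simps = mpoly_idealD[OF this[unfolded P_ring_def], folded P_ring_def]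
    have self: "?G \<union> I \<subseteq> genideal (P_ring m k) (?G \<union> I)" by (rule L.R.genideal_self[OF GI])
    have "genideal (P_ring m k) ?G \<subseteq> genideal (P_ring m k) (?G \<union> I)"
      by (rule L.R.genideal_minimal[OF L.R.genideal_ideal[OF GI]]) (use self in blast)
    then have "h ^ N * p \<in> genideal (P_ring m k) (?G \<union> I)"
      unfolding b(3) using bG b(2) self by (intro J_simps(3)) auto
    moreover have "h ^ N \<in> carrier (P_ring m k) - M" using h_notin_M(2) P_power[OF h_P] by blast
    ultimately show "\<exists>u\<in>carrier (P_ring m k) - M. u \<otimes>\<^bsub>P_ring m k\<^esub> p \<in> genideal (P_ring m k) (?G \<union> I)"
      by auto
  qed
  then have upper: "?gen (card (\<theta> ` ?G)) (\<theta> ` ?G)"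
    using GP finite_free_vars by (auto simp: L.max_ideal_eq)
  then have le: "embdim Loc \<le> card (\<theta> ` ?G)"
    unfolding embdim_def by (intro Least_le) blast
  have "\<exists>G. ?gen (embdim Loc) G"
    unfolding embdim_def by (rule LeastI_ex) (use upper in blast)
  then have "card free_vars \<le> embdim Loc" using lower by blast
  moreover have "card (\<theta> ` ?G) \<le> card free_vars"
    using card_image_le[OF finite_free_vars, of "\<lambda>v. mvar v - mconst (eval_at \<Gamma> (mvar v))"]
      card_image_le[of ?G \<theta>] finite_free_vars by simp
  ultimately show ?thesis using le by simp
qed

theorem regular_iff: "regular_local_ring Loc \<longleftrightarrow> krull_dim Loc = enat (card free_vars)"
proof -
  obtain \<theta> where "localization_at (P_ring m k) Loc \<theta> M I" using localization by blast
  then interpret L: localization_at "P_ring m k" Loc \<theta> M I .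
  have "noetherian_ring (P_ring m k :: (pvar, 'a) mpoly ring)"
    unfolding P_ring_def by (rule noetherian_mpoly_ring) simp
  then show ?thesis
    unfolding regular_local_ring_def embdim_eq using L.noetherian L.local_ring by blast
qed


section \<open>Dimension of the local ring at a zero point\<close>

definition prime_chain :: "nat \<Rightarrow> (nat \<Rightarrow> (pvar, 'a) mpoly set) \<Rightarrow> bool" where
  "prime_chain n Q \<longleftrightarrow> (\<forall>i\<le>n. primeideal (Q i) (P_ring m k) \<and> I \<subseteq> Q i \<and> Q i \<subseteq> M) \<and> (\<forall>i<n. Q i \<subset> Q (Suc i))"

lemma krull_dim_Loc: "krull_dim Loc = Sup {enat n | n. \<exists>Q. prime_chain n Q}"
  using localization localization_at.krull_dim_eq unfolding prime_chain_def by blast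

text \<open>Strictness survives: if \<open>p\<close> lies in the larger prime only, then so does the free part of \<open>h\<^sup>N p\<close>,
because \<open>h \<notin> M\<close>.\<close>

lemma contract_chain:
  assumes Q: "prime_chain n Q"
  shows "\<And>i. i \<le> n \<Longrightarrow> primeideal (Q i \<inter> polys free_vars) (mpoly_ring free_vars)"
    and "\<And>i. i < n \<Longrightarrow> Q i \<inter> polys free_vars \<subset> Q (Suc i) \<inter> polys free_vars"
proof -
  let ?B = "polys free_vars :: (pvar, 'a) mpoly set"
  have prime: "primeideal (Q i) (P_ring m k)" "I \<subseteq> Q i" "Q i \<subseteq> M" if "i \<le> n" for i
    using Q that by (auto simp: prime_chain_def)
  show "primeideal (Q i \<inter> ?B) (mpoly_ring free_vars)" if "i \<le> n" for i
    by (rule primeideal_restrict[OF prime(1)[OF that, unfolded P_ring_def] free_vars_sub])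
  fix i assume i: "i < n"
  have less: "Q i \<subset> Q (Suc i)" using Q i unfolding prime_chain_def by blast
  then obtain p where p: "p \<in> Q (Suc i)" "p \<notin> Q i" by blast
  have i': "Suc i \<le> n" "i \<le> n" using i by auto
  note pr = mpoly_primeD[OF prime(1)[unfolded P_ring_def], folded P_ring_def]
  note id = mpoly_idealD[OF pr(1)[unfolded P_ring_def], folded P_ring_def]
  have pP: "p \<in> carrier (P_ring m k)" using id(1)[OF i'(1)] p(1) by blast
  obtain N b q where b: "b \<in> ?B" "q \<in> I" "h ^ N * p = b + q"
    using clear_denominators[OF I_ideal F_mem pP] by blast
  have q: "q \<in> Q i" "q \<in> Q (Suc i)" using b(2) prime(2)[OF i'(1)] prime(2)[OF i'(2)] by auto
  have hN: "h ^ N \<in> carrier (P_ring m k)" by (rule P_power[OF h_P])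
  have "h ^ N * p \<in> Q (Suc i)" by (rule id(6)[OF i'(1) p(1) hN])
  then have "b \<in> Q (Suc i)" using id(5)[OF i'(1) _ q(2), of "h ^ N * p"] b(3) by simp
  moreover have "b \<notin> Q i"
  proof
    assume "b \<in> Q i"
    then have "h ^ N * p \<in> Q i" unfolding b(3) by (rule id(3)[OF i'(2) _ q(1)])
    then have "h ^ N \<in> Q i" using pr(2)[OF i'(2) hN pP] p(2) by blast
    then show False using h_notin_M(2) prime(3)[OF i'(2)] by blast
  qed
  ultimately show "Q i \<inter> ?B \<subset> Q (Suc i) \<inter> ?B"
    using b(1) less by blast
qed

lemma chain_length_le: "prime_chain n Q \<Longrightarrow> n \<le> card free_vars"
  using prime_chain_length_le[OF finite_free_vars, of n "\<lambda>i. Q i \<inter> polys free_vars"]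
    contract_chain by blast

text \<open>A nonzero \<open>f \<in> I \<inter> B\<close> would lie in the smallest prime of a contracted chain of maximal length, so the
zero ideal of the domain \<open>B\<close> could be put below it.\<close>

lemma full_dimension_imp_free:
  assumes dim: "krull_dim Loc = enat (card free_vars)"
    and f: "f \<in> I" "f \<in> polys free_vars"
  shows "f = 0"
proof (rule ccontr)
  assume "f \<noteq> 0"
  let ?B = "polys free_vars :: (pvar, 'a) mpoly set"
  have "prime_chain 0 (\<lambda>_. M)" using M_prime I_sub_M by (simp add: prime_chain_def)
  then have "\<exists>Q. prime_chain 0 Q" by blast
  then have "\<exists>Q. prime_chain (card free_vars) Q"
    by (rule Sup_enat_attained[of "\<lambda>n. \<exists>Q. prime_chain n Q", rotated])
       (rule trans[OF krull_dim_Loc[symmetric] dim])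
  then obtain Q where Q: "prime_chain (card free_vars) Q" by blast
  note C = contract_chain[OF Q]
  have zero: "primeideal {0} (mpoly_ring free_vars :: (pvar, 'a) mpoly ring)"
  proof -
    have "msubst mvar p = p" for p :: "(pvar, 'a) mpoly"
      by (rule msubst_ident[OF carrier_mpoly_ring_UNIV refl])
    then have eq: "{p \<in> polys free_vars. msubst mvar p = 0} = {0 :: (pvar, 'a) mpoly}"
      by (simp only: mpoly_0_closed) blast
    show ?thesis
      using kernel_msubst_prime[of free_vars "mvar :: pvar \<Rightarrow> (pvar, 'a) mpoly"] unfolding eq .
  qed
  define Q' where "Q' i = (case i of 0 \<Rightarrow> {0} | Suc i \<Rightarrow> Q i \<inter> ?B)" for i
  have "Suc (card free_vars) \<le> card free_vars"
  proof (rule prime_chain_length_le[OF finite_free_vars, of _ Q'])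
    show "primeideal (Q' i) (mpoly_ring free_vars)" if "i \<le> Suc (card free_vars)" for i
      using that zero C(1) by (cases i) (auto simp: Q'_def)
    show "Q' i \<subset> Q' (Suc i)" if i: "i < Suc (card free_vars)" for i
    proof (cases i)
      case 0
      have "f \<in> Q 0" using Q f(1) by (auto simp: prime_chain_def)
      moreover have "0 \<in> Q 0 \<inter> ?B"
        using mpoly_idealD(2)[OF mpoly_primeD(1)[OF C(1)[of 0]]] by simp
      ultimately show ?thesis using f(2) \<open>f \<noteq> 0\<close> 0 by (auto simp: Q'_def)
    next
      case (Suc j)
      then show ?thesis using C(2)[of j] i by (simp add: Q'_def)
    qed
  qed
  then show False by simp
qed

text \<open>Solve the equations \<open>F\<^sub>j = 0\<close> for \<open>x\<^sub>j\<close>, \<open>j \<in> J\<close>, by iterating the substitution that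
\<open>F\<^sub>j\<close> prescribes.  The value at \<open>x\<^sub>j\<close> is stable after \<open>w\<^sub>j + 1\<close> steps, because it depends on lighter
variables only.\<close>

lemma retraction:
  assumes m: "m = 0"
  obtains \<sigma> where "\<And>v. v \<in> free_vars \<Longrightarrow> \<sigma> v = mvar v"
    and "\<And>j. j \<in> J \<Longrightarrow> \<sigma> (Ind j) \<in> polys free_vars"
    and "\<And>j. j \<in> J \<Longrightarrow> msubst \<sigma> (F j) = 0"
    and "\<And>j. eval_at \<Gamma> (\<sigma> (Ind j)) = 0"
proof -
  have fv: "free_vars = Ind ` ({1..k} - J)" unfolding free_vars_def using m by simp
  let ?G = "\<lambda>j. h * mvar (Ind j) - F j"
  define step where "step \<sigma> v = (case v of Par i \<Rightarrow> 0 | Ind j \<Rightarrow>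
      if j \<in> J then mconst (inverse (eval_at \<Gamma> h)) * msubst \<sigma> (?G j) else mvar v)" for \<sigma> v
  define \<sigma>0 :: "pvar \<Rightarrow> (pvar, 'a) mpoly" where
    "\<sigma>0 v = (case v of Par i \<Rightarrow> 0 | Ind j \<Rightarrow> if j \<in> J then 0 else mvar v)" for v
  define \<sigma> where "\<sigma> n = (step ^^ n) \<sigma>0" for n
  have \<sigma>_0: "\<sigma> 0 = \<sigma>0" and \<sigma>_Suc: "\<sigma> (Suc n) = step (\<sigma> n)" for n
    by (simp_all add: \<sigma>_def)
  have h: "h = mconst (eval_at \<Gamma> h)"
    using spec_param[OF h_param, of \<Gamma>] h_param spec_ident[of h 0 \<Gamma>] m
    by (metis A_ring_def KX_ring_def atLeastatMost_empty_iff2 image_empty not_one_le_zero)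
  have G_vars: "?G j \<in> polys (Ind ` ({1..k} - J) \<union> Ind ` {i\<in>J. w i < w j})" if "j \<in> J" for j
    using F_solve[OF that] m by simp
  have free: "\<sigma> n v = mvar v" if "v \<in> free_vars" for n v
    using that unfolding fv by (cases n) (auto simp: \<sigma>_0 \<sigma>_Suc \<sigma>0_def step_def)
  have closed: "\<sigma> n (Ind j) \<in> polys free_vars" if "j \<in> J" for n j
    using that
  proof (induction n arbitrary: j)
    case (Suc n)
    have "msubst (\<sigma> n) (?G j) \<in> polys free_vars"
      by (rule msubst_closed[OF G_vars[OF Suc.prems]]) (use Suc.IH free in \<open>auto simp: fv\<close>)
    then show ?case using Suc.prems by (auto simp: \<sigma>_Suc step_def)
  qed (simp add: \<sigma>_0 \<sigma>0_def)
  have ev0: "eval_at \<Gamma> (\<sigma> n (Ind j)) = 0" for n j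
  proof (induction n arbitrary: j)
    case (Suc n)
    have "eval_at \<Gamma> (msubst (\<sigma> n) p) = eval_at \<Gamma> p" if "p \<in> polys (Ind ` X)" for p X
      using that by (induction p rule: mpoly_ring_induct)
        (auto simp: msubst_add msubst_mult eval_at_add eval_at_mult Suc.IH)
    from this[of _ "({1..k} - J) \<union> {i\<in>J. w i < w j}"] G_vars[of j]
    have "eval_at \<Gamma> (msubst (\<sigma> n) (?G j)) = eval_at \<Gamma> (?G j)" if "j \<in> J"
      using that by (simp add: image_Un)
    then show ?case using eval_at_I[OF F_mem[of j]] by (auto simp: \<sigma>_Suc step_def eval_at_mult eval_at_diff)
  qed (simp add: \<sigma>_0 \<sigma>0_def)
  have stable: "\<sigma> n (Ind j) = \<sigma> (Suc n) (Ind j)" if "j \<in> J" "w j < n" for n j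
    using that
  proof (induction n arbitrary: j)
    case (Suc n)
    have "msubst (\<sigma> n) (?G j) = msubst (\<sigma> (Suc n)) (?G j)"
    proof (rule msubst_cong[OF G_vars[OF Suc.prems(1)]])
      fix v assume "v \<in> Ind ` ({1..k} - J) \<union> Ind ` {i\<in>J. w i < w j}"
      then show "\<sigma> n v = \<sigma> (Suc n) v"
        using Suc.IH Suc.prems(2) free[of v n] free[of v "Suc n"] by (auto simp: fv)
    qed
    then show ?case using Suc.prems(1) by (simp add: \<sigma>_Suc[of n] \<sigma>_Suc[of "Suc n"] step_def)
  qed simp
  (* exceeds all weights that occur *)
  define T where "T = Suc (sum w J)"
  have T: "w j < T" if "j \<in> J" for j
    using member_le_sum[OF that, of w] finite_J by (simp add: T_def)
  show thesis
  proof (rule that[of "\<sigma> T"])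
    fix j assume j: "j \<in> J"
    have "\<sigma> T (Ind j) = mconst (inverse (eval_at \<Gamma> h)) * msubst (\<sigma> T) (?G j)"
      using stable[OF j T[OF j]] j by (simp add: \<sigma>_Suc step_def)
    then have "mconst (eval_at \<Gamma> h) * \<sigma> T (Ind j) = msubst (\<sigma> T) (?G j)"
      using h_unit by (simp flip: mult.assoc mconst_mult)
    also have "\<dots> = mconst (eval_at \<Gamma> h) * \<sigma> T (Ind j) - msubst (\<sigma> T) (F j)"
      by (subst h) (simp add: msubst_diff msubst_mult)
    finally show "msubst (\<sigma> T) (F j) = 0" by simp
  qed (use free closed ev0 in auto)
qed

text \<open>The kernels of \<open>\<sigma>\<close> followed by setting the first \<open>i\<close> free variables to \<open>0\<close> are primes, as \<open>K[X]\<close> is a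
domain, and they increase strictly with \<open>i\<close>.\<close>

lemma full_dimension_of_retraction:
  assumes m: "m = 0" and free: "\<And>v. v \<in> free_vars \<Longrightarrow> \<sigma> v = mvar v"
    and ev0: "\<And>j. eval_at \<Gamma> (\<sigma> (Ind j)) = 0" and I: "\<And>f. f \<in> I \<Longrightarrow> msubst \<sigma> f = 0"
  shows "krull_dim Loc = enat (card free_vars)"
proof (rule antisym)
  show "krull_dim Loc \<le> enat (card free_vars)"
    unfolding krull_dim_Loc by (rule Sup_least) (use chain_length_le in auto)
  have fv: "free_vars = Ind ` ({1..k} - J)" unfolding free_vars_def using m by simp
  let ?n = "card free_vars"
  obtain e where e: "bij_betw e {0..<?n} free_vars"
    using ex_bij_betw_nat_finite[OF finite_free_vars] by blast
  define kill :: "nat \<Rightarrow> pvar \<Rightarrow> (pvar, 'a) mpoly" where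
    "kill i v = (if v \<in> e ` {..<i} then 0 else mvar v)" for i v
  have e_Ind: "\<exists>j. e i = Ind j" if "i < ?n" for i
    using bij_betw_apply[OF e, of i] that fv by auto
  define Q where "Q i = {p \<in> carrier (P_ring m k). msubst (\<lambda>v. msubst (kill i) (\<sigma> v)) p = 0}" for i
  have eval_at_kill: "eval_at \<Gamma> (msubst (kill i) p) = eval_at \<Gamma> p" if le: "i \<le> ?n" for i p
    using carrier_mpoly_ring_UNIV[of p]
  proof (induction p rule: mpoly_ring_induct)
    case (var v)
    show ?case
    proof (cases "v \<in> e ` {..<i}")
      case True
      then obtain l where "v = e l" "l < i" by blast
      then obtain j where "v = Ind j" using e_Ind[of l] le by auto
      with True show ?thesis by (simp add: kill_def)
    qed (simp add: kill_def)
  qed (auto simp: msubst_add msubst_mult eval_at_add eval_at_mult)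
  have eval_at_Q: "eval_at \<Gamma> (msubst (\<lambda>v. msubst (kill i) (\<sigma> v)) p) = eval_at \<Gamma> p"
    if "i \<le> ?n" "p \<in> carrier (P_ring m k)" for i p
    using that(2) unfolding P_ring_def
    by (induction p rule: mpoly_ring_induct)
       (auto simp: m msubst_add msubst_mult eval_at_add eval_at_mult eval_at_kill[OF that(1)] ev0)
  have "prime_chain ?n Q"
    unfolding prime_chain_def
  proof (intro conjI allI impI)
    fix i assume i: "i \<le> ?n"
    show "primeideal (Q i) (P_ring m k)" unfolding Q_def P_ring_def by (rule kernel_msubst_prime)
    show "I \<subseteq> Q i" using I I_sub_P by (auto simp: Q_def simp flip: msubst_msubst)
    show "Q i \<subseteq> M"
    proof
      fix p assume "p \<in> Q i"
      then show "p \<in> M" using eval_at_Q[OF i, of p] by (auto simp: Q_def zero_point_ideal_eq)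
    qed
  next
    fix i assume i: "i < ?n"
    have ei: "e i \<in> free_vars" using bij_betw_apply[OF e, of i] i by auto
    have "e i \<notin> e ` {..<i}"
      using inj_onD[OF bij_betw_imp_inj_on[OF e], of i] i by fastforce
    moreover have "mvar (e i) \<noteq> (0 :: (pvar, 'a) mpoly)"
      by (metis lookup_mvar lookup_zero zero_neq_one)
    moreover have "mvar (e i) \<in> carrier (P_ring m k)"
      unfolding P_ring_def using ei free_vars_sub by auto
    ultimately have "mvar (e i) \<notin> Q i" "mvar (e i) \<in> Q (Suc i)"
      by (auto simp: Q_def free[OF ei] kill_def)
    moreover have "Q i \<subseteq> Q (Suc i)"
    proof
      fix p assume p: "p \<in> Q i"
      have "msubst (kill (Suc i)) (msubst (kill i) (msubst \<sigma> p)) = msubst (kill (Suc i)) (msubst \<sigma> p)"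
        unfolding msubst_msubst[of "kill (Suc i)" "kill i"]
        by (rule arg_cong[of _ _ "\<lambda>\<tau>. msubst \<tau> (msubst \<sigma> p)"]) (auto simp: kill_def fun_eq_iff)
      then show "p \<in> Q (Suc i)" using p by (auto simp: Q_def simp flip: msubst_msubst)
    qed
    ultimately show "Q i \<subset> Q (Suc i)" by blast
  qed
  then show "enat ?n \<le> krull_dim Loc"
    unfolding krull_dim_Loc by (intro Sup_upper) blast
qed

text \<open>Setting \<open>a\<^sub>i\<close> to \<open>\<gamma>\<^sub>i\<close> turns \<open>h\<close> into a nonzero constant and changes neither the derivatives in the
directions of the \<open>x\<^sub>j\<close> at \<open>\<Gamma>\<^sub>0\<close> nor the triangular shape of the equations.\<close>

lemma elimination_fiber:
  "elimination 0 k w (fiber_ideal I \<Gamma>) \<Gamma> J (mconst (eval_at \<Gamma> h)) (\<lambda>j. spec \<Gamma> (F j))"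
proof (rule elimination.intro)
  show "ideal (fiber_ideal I \<Gamma>) (P_ring 0 k)"
    unfolding P_ring_def
  proof (rule mpoly_idealI, unfold P_ring_def[symmetric] KX_eq_P[symmetric])
    show "fiber_ideal I \<Gamma> \<subseteq> carrier (KX_ring k)"
      using spec_closed[OF I_sub_P] by (auto simp: fiber_ideal_def)
    show "0 \<in> fiber_ideal I \<Gamma>"
      using I_simps(2) msubst_0 by (metis fiber_ideal_def image_eqI)
    show "p + q \<in> fiber_ideal I \<Gamma>" if "p \<in> fiber_ideal I \<Gamma>" "q \<in> fiber_ideal I \<Gamma>" for p q
      using that I_simps(3) by (auto simp: fiber_ideal_def simp flip: msubst_add)
    show "r * p \<in> fiber_ideal I \<Gamma>" if p: "p \<in> fiber_ideal I \<Gamma>" and r: "r \<in> carrier (KX_ring k)" for p r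
    proof -
      obtain f where f: "f \<in> I" "p = spec \<Gamma> f" using p by (auto simp: fiber_ideal_def)
      have "r * f \<in> I" using I_simps(6)[OF f(1)] r KX_sub_P by blast
      moreover have "r * p = spec \<Gamma> (r * f)" by (simp add: f msubst_mult spec_ident[OF r])
      ultimately show ?thesis by (simp add: fiber_ideal_def)
    qed
  qed
  show "zsec f = 0" if "f \<in> fiber_ideal I \<Gamma>" for f
    using that I_zsec by (auto simp: fiber_ideal_def zsec_spec)
  show "J \<subseteq> {1..k}" by (rule J_sub)
  show "mconst (eval_at \<Gamma> h) \<in> carrier (A_ring 0)" by (simp add: A_ring_def)
  show "eval_at \<Gamma> (mconst (eval_at \<Gamma> h)) \<noteq> 0" using h_unit by simp
  show "spec \<Gamma> (F j) \<in> fiber_ideal I \<Gamma>" if "j \<in> J" for j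
    using F_mem[OF that] by (simp add: fiber_ideal_def)
  show "mconst (eval_at \<Gamma> h) * mvar (Ind j) - spec \<Gamma> (F j)
      \<in> polys (Par ` {1..0} \<union> Ind ` ({1..k} - J) \<union> Ind ` {i\<in>J. w i < w j})" if "j \<in> J" for j
  proof -
    have "spec \<Gamma> (h * mvar (Ind j) - F j) = mconst (eval_at \<Gamma> h) * mvar (Ind j) - spec \<Gamma> (F j)"
      by (simp add: msubst_diff msubst_mult spec_param[OF h_param])
    moreover have "spec \<Gamma> (h * mvar (Ind j) - F j)
        \<in> polys (Par ` {1..0} \<union> Ind ` ({1..k} - J) \<union> Ind ` {i\<in>J. w i < w j})"
      by (rule msubst_closed[OF F_solve[OF that]]) auto
    ultimately show ?thesis by simp
  qed
  show "deriv_at \<Gamma> (Ind i) (spec \<Gamma> (F j)) = (if i = j then eval_at \<Gamma> (mconst (eval_at \<Gamma> h)) else 0)" if "i \<in> J" "j \<in> J" for i j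
    using F_deriv[OF that] by (simp add: deriv_at_Ind_spec)
  show "deriv_at \<Gamma> (Ind i) f = 0"
    if "f \<in> fiber_ideal I \<Gamma>" "\<And>j. j \<in> J \<Longrightarrow> deriv_at \<Gamma> (Ind j) f = 0" "i \<in> {1..k}" for f i
    using that deriv_at_determined by (auto simp: fiber_ideal_def deriv_at_Ind_spec)
qed

end


text \<open>Without parameters \<open>h\<close> is a constant, so every class contains a polynomial in the free variables.  It
is unique if \<open>I\<close> contains no nonzero such polynomial.\<close>

lemma (in elimination) affine_space_of_free:
  assumes m: "m = 0" and free: "\<And>f. f \<in> I \<Longrightarrow> f \<in> polys free_vars \<Longrightarrow> f = 0"
  shows "\<exists>n::nat. \<exists>\<phi> \<in> ring_iso (P_ring m k Quot I) (mpoly_ring {1..n} :: (nat, 'a) mpoly ring).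
    \<forall>c. \<phi> (I +>\<^bsub>P_ring m k\<^esub> mconst c) = mconst c"
proof -
  interpret P: cring "P_ring m k :: (pvar, 'a) mpoly ring" unfolding P_ring_def by (rule mpoly_ring_cring)
  interpret I: ideal I "P_ring m k" by (rule I_ideal)
  let ?coset = "\<lambda>p. I +>\<^bsub>P_ring m k\<^esub> p"
  have fv: "free_vars = Ind ` ({1..k} - J)" unfolding free_vars_def using m by simp
  define n where "n = card ({1..k} - J)"
  let ?N = "mpoly_ring {1..n} :: (nat, 'a) mpoly ring"
  obtain e where e: "bij_betw e {1..n} ({1..k} - J)"
    using ex_bij_betw_nat_finite_1[of "{1..k} - J"] by (auto simp: n_def)
  define \<psi> :: "(nat, 'a) mpoly \<Rightarrow> (pvar, 'a) mpoly" where "\<psi> = msubst (\<lambda>i. mvar (Ind (e i)))"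
  define \<chi> :: "(pvar, 'a) mpoly \<Rightarrow> (nat, 'a) mpoly" where
    "\<chi> = msubst (\<lambda>v. case v of Par i \<Rightarrow> 0 | Ind j \<Rightarrow> mvar (inv_into {1..n} e j))"
  have \<psi>_closed: "\<psi> p \<in> polys free_vars" if "p \<in> carrier ?N" for p
    unfolding \<psi>_def by (rule msubst_closed[OF that]) (use bij_betw_apply[OF e] in \<open>auto simp: fv\<close>)
  have \<psi>_P: "\<psi> p \<in> carrier (P_ring m k)" if "p \<in> carrier ?N" for p
    using \<psi>_closed[OF that] free_sub_P by blast
  have \<chi>_closed: "\<chi> p \<in> carrier ?N" if "p \<in> polys free_vars" for p
    unfolding \<chi>_def
  proof (rule msubst_closed[OF that])
    fix v assume "v \<in> free_vars"
    then obtain j where j: "v = Ind j" "j \<in> e ` {1..n}" using bij_betw_imp_surj_on[OF e] by (auto simp: fv)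
    then have "inv_into {1..n} e j \<in> {1..n}" by (intro inv_into_into)
    then show "(case v of Par i \<Rightarrow> 0 | Ind j \<Rightarrow> mvar (inv_into {1..n} e j)) \<in> carrier ?N"
      using j(1) by simp
  qed
  have \<chi>\<psi>: "\<chi> (\<psi> p) = p" if "p \<in> carrier ?N" for p
    unfolding \<psi>_def \<chi>_def msubst_msubst
    by (rule msubst_ident[OF that]) (use bij_betw_inv_into_left[OF e] in simp)
  have \<psi>\<chi>: "\<psi> (\<chi> p) = p" if "p \<in> polys free_vars" for p
    unfolding \<psi>_def \<chi>_def msubst_msubst
    by (rule msubst_ident[OF that]) (use bij_betw_inv_into_right[OF e] in \<open>auto simp: fv\<close>)
  have \<psi>_hom: "\<psi> \<in> ring_hom ?N (P_ring m k)"
    by (rule ring_hom_memI) (auto simp: \<psi>_P, auto simp: \<psi>_def msubst_mult msubst_add)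
  have hom: "(\<lambda>p. ?coset (\<psi> p)) \<in> ring_hom ?N (P_ring m k Quot I)"
    using ring_hom_trans[OF \<psi>_hom I.rcos_ring_hom] by (simp add: o_def)
  have coset_eq: "?coset p = ?coset q \<longleftrightarrow> p - q \<in> I"
    if "p \<in> carrier (P_ring m k)" "q \<in> carrier (P_ring m k)" for p q
  proof -
    have "p \<ominus>\<^bsub>P_ring m k\<^esub> q = p - q" using that unfolding P_ring_def by (rule mpoly_a_minus)
    then show ?thesis using P.quotient_eq_iff_same_a_r_cos[OF I_ideal that] by simp
  qed
  have inj: "inj_on (\<lambda>p. ?coset (\<psi> p)) (carrier ?N)"
  proof (rule inj_onI)
    fix p q assume pq: "p \<in> carrier ?N" "q \<in> carrier ?N" "?coset (\<psi> p) = ?coset (\<psi> q)"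
    then have "\<psi> p - \<psi> q \<in> I" using coset_eq \<psi>_P by blast
    then have "\<psi> p - \<psi> q = 0" using \<psi>_closed pq by (intro free) auto
    then have "\<chi> (\<psi> p) = \<chi> (\<psi> q)" by simp
    then show "p = q" using pq \<chi>\<psi> by simp
  qed
  have surj: "(\<lambda>p. ?coset (\<psi> p)) ` carrier ?N = carrier (P_ring m k Quot I)"
  proof
    show "(\<lambda>p. ?coset (\<psi> p)) ` carrier ?N \<subseteq> carrier (P_ring m k Quot I)"
      using ring_hom_closed[OF hom] by blast
    show "carrier (P_ring m k Quot I) \<subseteq> (\<lambda>p. ?coset (\<psi> p)) ` carrier ?N"
    proof
      fix x assume "x \<in> carrier (P_ring m k Quot I)"
      then obtain p where p: "p \<in> carrier (P_ring m k)" "x = ?coset p"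
        unfolding FactRing_def A_RCOSETS_def' by auto
      obtain l b q where b: "b \<in> polys free_vars" "q \<in> I" "h ^ l * p = b + q"
        using clear_denominators[OF I_ideal F_mem p(1)] by blast
      have "h \<in> carrier (KX_ring k)"
        using h_param m mpoly_ring_mono[of "{}" "Ind ` {1..k}"] by (auto simp: A_ring_def KX_ring_def)
      then have h: "h = mconst (eval_at \<Gamma> h)"
        using spec_param[OF h_param, of \<Gamma>] spec_ident[of h k \<Gamma>] by simp
      let ?c = "inverse (eval_at \<Gamma> h ^ l)"
      have "mconst ?c * (h ^ l * p) = p"
        using h_unit by (subst h) (simp add: mconst_power flip: mult.assoc mconst_mult)
      then have "p = mconst ?c * b + mconst ?c * q" unfolding b(3) distrib_left by simp
      then have eq: "p - mconst ?c * b = mconst ?c * q" by (metis add_diff_cancel_left')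
      have "mconst ?c * q \<in> I" by (rule I_simps(6)[OF b(2)]) (simp add: P_ring_def)
      moreover have cb: "mconst ?c * b \<in> polys free_vars" using b(1) by auto
      moreover have "mconst ?c * b \<in> carrier (P_ring m k)" using cb free_sub_P by blast
      ultimately have "x = ?coset (mconst ?c * b)"
        using coset_eq[OF p(1)] by (simp add: p(2) eq)
      then have "x = ?coset (\<psi> (\<chi> (mconst ?c * b)))" by (simp add: \<psi>\<chi>[OF cb])
      then show "x \<in> (\<lambda>p. ?coset (\<psi> p)) ` carrier ?N" using \<chi>_closed[OF cb] by blast
    qed
  qed
  have iso: "(\<lambda>p. ?coset (\<psi> p)) \<in> ring_iso ?N (P_ring m k Quot I)"
    using hom inj surj by (simp add: ring_iso_def bij_betw_def)
  let ?\<phi> = "inv_into (carrier ?N) (\<lambda>p. ?coset (\<psi> p))"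
  have "?\<phi> \<in> ring_iso (P_ring m k Quot I) ?N"
    by (rule ring_iso_set_sym[OF cring.axioms(1)[OF mpoly_ring_cring] iso])
  moreover have "?\<phi> (?coset (mconst c)) = mconst c" for c
    using inv_into_f_f[OF inj, of "mconst c"] by (simp add: \<psi>_def)
  ultimately show ?thesis by blast
qed

lemma fiber_ring_eq: "fiber_ring k I \<Gamma> = P_ring 0 k Quot fiber_ideal I \<Gamma>"
  by (simp add: fiber_ring_def KX_eq_P)

lemma fiber_local_ring_eq: "fiber_local_ring k I \<Gamma> = zero_point_local_ring 0 k (fiber_ideal I \<Gamma>) \<Gamma>"
proof -
  have "genideal (KX_ring k) ((\<lambda>j. mvar (Ind j)) ` {1..k}) = (zero_point_ideal 0 k \<Gamma> :: (pvar, 'a) mpoly set)"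
    by (simp add: zero_point_ideal_def KX_eq_P)
  then show ?thesis
    by (simp only: fiber_local_ring_def zero_point_local_ring_def fiber_ring_eq KX_eq_P)
qed

theorem corollary4p5:
  fixes m k :: nat
    and w :: "nat \<Rightarrow> nat"
    and I :: "(pvar, 'a::field) mpoly set"
    and \<Gamma> :: "nat \<Rightarrow> 'a"
  assumes "positive_algebra m k w I"
  shows "(regular_local_ring (zero_point_local_ring m k I \<Gamma>) \<longleftrightarrow>
            regular_local_ring (fiber_local_ring k I \<Gamma>) \<and>
            krull_dim (fiber_local_ring k I \<Gamma>) + enat m = krull_dim (zero_point_local_ring m k I \<Gamma>))
       \<and> (regular_local_ring (fiber_local_ring k I \<Gamma>) \<longrightarrow> fiber_iso_affine_space k I \<Gamma>)"
proof -
  obtain J h F where "elimination m k w I \<Gamma> J h F"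
    using elimination_exists[OF assms] .
  then interpret R: elimination m k w I \<Gamma> J h F .
  interpret Fib: elimination 0 k w "fiber_ideal I \<Gamma>" \<Gamma> J "mconst (eval_at \<Gamma> h)" "\<lambda>j. spec \<Gamma> (F j)"
    by (rule R.elimination_fiber)
  have dims: "card R.free_vars = card Fib.free_vars + m"
    by (simp add: R.card_free_vars Fib.card_free_vars)
  have fiber_full: "krull_dim Fib.Loc = enat (card Fib.free_vars)"
    if full: "krull_dim R.Loc = enat (card R.free_vars)"
  proof -
    obtain \<sigma> where \<sigma>: "\<And>v. v \<in> Fib.free_vars \<Longrightarrow> \<sigma> v = mvar v"
      "\<And>j. j \<in> J \<Longrightarrow> \<sigma> (Ind j) \<in> polys Fib.free_vars"
      "\<And>j. j \<in> J \<Longrightarrow> msubst \<sigma> (spec \<Gamma> (F j)) = 0" "\<And>j. eval_at \<Gamma> (\<sigma> (Ind j)) = 0"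
      by (rule Fib.retraction[OF refl]) (rule that)
    (* this ideal contains the F j and lies in I; applying clear_denominators to it, rather
       than to I, transports information on the B-part to the fiber *)
    let ?T = "{f \<in> I. msubst \<sigma> (spec \<Gamma> f) = 0}"
    have T: "ideal ?T (P_ring m k)"
      unfolding P_ring_def
    proof (rule mpoly_idealI, unfold P_ring_def[symmetric])
      show "?T \<subseteq> carrier (P_ring m k)" using R.I_simps(1) by blast
      show "0 \<in> ?T" using R.I_simps(2) by simp
    qed (auto simp: msubst_add msubst_mult intro: R.I_simps(3) R.I_simps(6))
    have FT: "F j \<in> ?T" if "j \<in> J" for j
      using R.F_mem[OF that] \<sigma>(3)[OF that] by simp
    have "msubst \<sigma> g = 0" if "g \<in> fiber_ideal I \<Gamma>" for g
    proof -
      obtain f where f: "f \<in> I" "g = spec \<Gamma> f" using \<open>g \<in> fiber_ideal I \<Gamma>\<close> by (auto simp: fiber_ideal_def)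
      obtain N b q where b: "b \<in> polys R.free_vars" "q \<in> ?T" "h ^ N * f = b + q"
        by (rule R.clear_denominators[OF T FT R.I_sub_P[OF f(1)]])
      have "h ^ N * f \<in> I" by (rule R.I_simps(6)[OF f(1) R.P_power[OF R.h_P]])
      then have "b \<in> I" using R.I_simps(5)[of "h ^ N * f" q] b(2,3) by simp
      then have "b = 0" using R.full_dimension_imp_free[OF full] b(1) by blast
      then have "msubst \<sigma> (spec \<Gamma> (h ^ N * f)) = 0" using b(2,3) by simp
      then have "mconst (eval_at \<Gamma> h ^ N) * msubst \<sigma> g = 0"
        by (simp add: f(2) msubst_mult msubst_power spec_param[OF R.h_param] mconst_power)
      then show ?thesis using R.h_unit by simp
    qed
    then show ?thesis using Fib.full_dimension_of_retraction[OF refl \<sigma>(1,4)] by blast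
  qed
  have "regular_local_ring R.Loc \<longleftrightarrow> regular_local_ring Fib.Loc \<and> krull_dim Fib.Loc + enat m = krull_dim R.Loc"
    unfolding R.regular_iff Fib.regular_iff using fiber_full by (auto simp: dims)
  moreover have "fiber_iso_affine_space k I \<Gamma>" if "regular_local_ring Fib.Loc"
    unfolding fiber_iso_affine_space_def fiber_ring_eq KX_eq_P
    by (rule Fib.affine_space_of_free[OF refl])
       (rule Fib.full_dimension_imp_free, use that in \<open>simp_all add: Fib.regular_iff\<close>)
  ultimately show ?thesis by (simp add: fiber_local_ring_eq)
qed

end
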